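(* There exists a universal constant $c>0$ such that for every $n \geq 2$ and $1 \leq k \leq n-1$ there exists an origin-symmetric convex body $K \subseteq \mathbb{R}^n$ such that \[d_{\mathrm{ovr}}(K, \mathcal{BP}_k^n) \geq c \sqrt{\frac{n}{k}}\, (\log(n))^{-1/2}.\]
   Context: A convex body is a compact convex set with non-empty interior; $|\cdot|_n$ denotes $n$-dimensional volume and $|\cdot|$ the Euclidean norm. A star body in $\mathbb{R}^n$ is a set of the form $K = \{0\} \cup \{x \in \mathbb{R}^n \setminus \{0\}: |x| \leq \rho_K(x/|x|)\}$, where the radial function $\rho_K : S^{n-1} \to (0,\infty)$ is continuous and strictly positive. The radial distance between star bodies $K,L$ is $\max_{v \in S^{n-1}} |\rho_K(v) - \rho_L(v)|$. For star bodies $K,L$ and $p>0$, the radial $p$-sum $K \tilde+_p L$ is the star body with radial function given by $\rho_{K \tilde+_p L}^p = \rho_K^p + \rho_L^p$. For an integer $k$ with $1\le k<n$, the class $\mathcal{BP}_k^n$ of generalized $k$-intersection bodies is the closure, in the radial metric (within star bodies), of the set of finite radial $k$-sums of origin-symmetric ellipsoids in $\mathbb{R}^n$. For a class $\mathcal{C}$ of star bodies, the outer volume ratio distance from a star body $K$ to $\mathcal{C}$ is \[d_{\mathrm{ovr}}(K, \mathcal{C}) = \inf \left\{ \left( \frac{|D|_n}{|K|_n} \right)^{1/n} : K \subseteq D,\ D \in \mathcal{C} \right\}.\] "Universal constant" means that $c$ does not depend on $n$ or $k$. *)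

theory Defs
  imports "HOL-Analysis.Analysis"
begin

text \<open>
  The dimension is a natural number bound inside the main statement, after the universal constant,
  so \<open>\<real>\<^sup>n\<close> cannot be a type. It is the library space \<^const>\<open>Euclidean_space\<close>: the real
  sequences vanishing from index \<open>n\<close> on, with the product topology. The origin is \<open>\<lambda>_. 0\<close>, the
  Euclidean norm is \<open>L2_set x {..<n}\<close>, and the unit sphere \<open>S\<^sup>n\<^sup>-\<^sup>1\<close> is \<open>nsphere (n - 1)\<close>, which
  requires \<open>n \<ge> 1\<close>.
\<close>

abbreviation space_Rn :: "nat \<Rightarrow> (nat \<Rightarrow> real) set" where
  "space_Rn n \<equiv> topspace (Euclidean_space n)"

abbreviation unit_sphere :: "nat \<Rightarrow> (nat \<Rightarrow> real) set" where
  "unit_sphere n \<equiv> topspace (nsphere (n - 1))"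

abbreviation enorm :: "nat \<Rightarrow> (nat \<Rightarrow> real) \<Rightarrow> real" where
  "enorm n x \<equiv> L2_set x {..<n}"

text \<open>
  Restricting to \<open>{..<n}\<close> identifies \<open>\<real>\<^sup>n\<close> with the space of the \<open>n\<close>-fold product of the
  one-dimensional Lebesgue measure. The product measure is not completed; all sets measured below
  are compact.
\<close>

definition volume :: "nat \<Rightarrow> (nat \<Rightarrow> real) set \<Rightarrow> real" where
  "volume n K = measure (Pi\<^sub>M {..<n} (\<lambda>_. lborel)) ((\<lambda>x. restrict x {..<n}) ` K)"

definition convex_body :: "nat \<Rightarrow> (nat \<Rightarrow> real) set \<Rightarrow> bool" where
  "convex_body n K \<longleftrightarrow>
     compactin (Euclidean_space n) K \<and>
     Euclidean_space n interior_of K \<noteq> {} \<and>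
     (\<forall>x\<in>K. \<forall>y\<in>K. \<forall>u\<ge>0. \<forall>v\<ge>0. u + v = 1 \<longrightarrow> (\<lambda>i. u * x i + v * y i) \<in> K)"

definition origin_symmetric :: "(nat \<Rightarrow> real) set \<Rightarrow> bool" where
  "origin_symmetric K \<longleftrightarrow> (\<forall>x\<in>K. (\<lambda>i. - x i) \<in> K)"


definition admissible_radial :: "nat \<Rightarrow> ((nat \<Rightarrow> real) \<Rightarrow> real) \<Rightarrow> bool" where
  "admissible_radial n \<rho> \<longleftrightarrow>
     continuous_map (nsphere (n - 1)) euclideanreal \<rho> \<and> (\<forall>v\<in>unit_sphere n. \<rho> v > 0)"

definition star_set :: "nat \<Rightarrow> ((nat \<Rightarrow> real) \<Rightarrow> real) \<Rightarrow> (nat \<Rightarrow> real) set" where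
  "star_set n \<rho> = {\<lambda>_. 0} \<union>
     {x \<in> space_Rn n - {\<lambda>_. 0}. enorm n x \<le> \<rho> (\<lambda>i. x i / enorm n x)}"

definition star_body :: "nat \<Rightarrow> (nat \<Rightarrow> real) set \<Rightarrow> bool" where
  "star_body n K \<longleftrightarrow> (\<exists>\<rho>. admissible_radial n \<rho> \<and> K = star_set n \<rho>)"

text \<open>
  The values on the unit sphere do not depend on the choice, by \<open>radial_fun_eq\<close> below; the values
  elsewhere are never used.
\<close>

definition radial_fun :: "nat \<Rightarrow> (nat \<Rightarrow> real) set \<Rightarrow> (nat \<Rightarrow> real) \<Rightarrow> real" where
  "radial_fun n K = (SOME \<rho>. admissible_radial n \<rho> \<and> K = star_set n \<rho>)"

text \<open>
  For star bodies the supremum is a maximum, since the radial functions are continuous on the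
  nonempty compact sphere.
\<close>

definition radial_dist :: "nat \<Rightarrow> (nat \<Rightarrow> real) set \<Rightarrow> (nat \<Rightarrow> real) set \<Rightarrow> real" where
  "radial_dist n K L = (SUP v\<in>unit_sphere n. \<bar>radial_fun n K v - radial_fun n L v\<bar>)"

definition radial_sum :: "nat \<Rightarrow> real \<Rightarrow> (nat \<Rightarrow> real) set \<Rightarrow> (nat \<Rightarrow> real) set \<Rightarrow> (nat \<Rightarrow> real) set" where
  "radial_sum n p K L =
     star_set n (\<lambda>v. (radial_fun n K v powr p + radial_fun n L v powr p) powr (1 / p))"

definition linear_map :: "nat \<Rightarrow> (nat \<Rightarrow> nat \<Rightarrow> real) \<Rightarrow> (nat \<Rightarrow> real) \<Rightarrow> nat \<Rightarrow> real" where
  "linear_map n A x = (\<lambda>i. if i < n then \<Sum>j<n. A i j * x j else 0)"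

text \<open>Origin-symmetric ellipsoids are the images of the unit ball under invertible linear maps.\<close>

definition symmetric_ellipsoid :: "nat \<Rightarrow> (nat \<Rightarrow> real) set \<Rightarrow> bool" where
  "symmetric_ellipsoid n E \<longleftrightarrow>
     (\<exists>A. bij_betw (linear_map n A) (space_Rn n) (space_Rn n) \<and>
          E = linear_map n A ` {x \<in> space_Rn n. enorm n x \<le> 1})"

inductive_set ellipsoid_radial_sums :: "nat \<Rightarrow> nat \<Rightarrow> (nat \<Rightarrow> real) set set" for n k :: nat where
  single: "symmetric_ellipsoid n E \<Longrightarrow> E \<in> ellipsoid_radial_sums n k"
| add: "L \<in> ellipsoid_radial_sums n k \<Longrightarrow> symmetric_ellipsoid n E \<Longrightarrow>
        radial_sum n (real k) L E \<in> ellipsoid_radial_sums n k"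

definition radial_closure :: "nat \<Rightarrow> (nat \<Rightarrow> real) set set \<Rightarrow> (nat \<Rightarrow> real) set set" where
  "radial_closure n \<C> = {K. star_body n K \<and> (\<forall>\<epsilon>>0. \<exists>L\<in>\<C>. radial_dist n K L < \<epsilon>)}"

definition BP :: "nat \<Rightarrow> nat \<Rightarrow> (nat \<Rightarrow> real) set set" where
  "BP k n = radial_closure n (ellipsoid_radial_sums n k)"

text \<open>Extended reals give the infimum over the empty set its usual value \<open>\<infinity>\<close>.\<close>

definition d_ovr :: "nat \<Rightarrow> (nat \<Rightarrow> real) set \<Rightarrow> (nat \<Rightarrow> real) set set \<Rightarrow> ereal" where
  "d_ovr n K \<C> =
     (INF D \<in> {D \<in> \<C>. K \<subseteq> D}. ereal ((volume n D / volume n K) powr (1 / real n)))"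


lemma unit_sphere_iff:
  assumes "n \<ge> 1"
  shows "v \<in> unit_sphere n \<longleftrightarrow> v \<in> space_Rn n \<and> enorm n v = 1"
proof -
  have "{..n - 1} = {..<n}" "Suc (n - 1) = n"
    using assms by auto
  then show ?thesis
    by (simp add: nsphere_def L2_set_def)
qed

lemma scaled_in_star_set_iff:
  assumes "n \<ge> 1" "v \<in> unit_sphere n" "t > 0"
  shows "(\<lambda>i. t * v i) \<in> star_set n \<rho> \<longleftrightarrow> t \<le> \<rho> v"
proof -
  have v: "v \<in> space_Rn n" "enorm n v = 1"
    using unit_sphere_iff assms by auto
  have norm: "enorm n (\<lambda>i. t * v i) = t"
    using L2_set_right_distrib[of t v "{..<n}"] v assms by simp
  moreover have "enorm n (\<lambda>_. 0) = 0"
    by (simp add: L2_set_def)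
  ultimately have "(\<lambda>i. t * v i) \<noteq> (\<lambda>_. 0)"
    using assms by (metis less_irrefl)
  moreover have "(\<lambda>i. t * v i) \<in> space_Rn n"
    using v by (simp add: topspace_Euclidean_space)
  ultimately show ?thesis
    using norm assms by (simp add: star_set_def)
qed

lemma radial_fun_eq:
  assumes "n \<ge> 1" "admissible_radial n \<rho>" "v \<in> unit_sphere n"
  shows "radial_fun n (star_set n \<rho>) v = \<rho> v"
proof -
  let ?\<sigma> = "radial_fun n (star_set n \<rho>)"
  have \<sigma>: "admissible_radial n ?\<sigma> \<and> star_set n \<rho> = star_set n ?\<sigma>"
    unfolding radial_fun_def
    by (rule someI[of "\<lambda>\<sigma>. admissible_radial n \<sigma> \<and> star_set n \<rho> = star_set n \<sigma>" \<rho>])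
       (simp add: assms)
  then have "t \<le> ?\<sigma> v \<longleftrightarrow> t \<le> \<rho> v" if "t > 0" for t
    using scaled_in_star_set_iff[OF assms(1,3) that] by metis
  moreover have "?\<sigma> v > 0" "\<rho> v > 0"
    using \<sigma> assms by (auto simp: admissible_radial_def)
  ultimately have "?\<sigma> v \<le> \<rho> v" "\<rho> v \<le> ?\<sigma> v"
    by auto
  then show ?thesis
    by simp
qed

lemma star_body_radial_sum:
  assumes "star_body n K" "star_body n L" "p > 0"
  shows "star_body n (radial_sum n p K L)"
proof -
  have adm: "admissible_radial n (radial_fun n M)" if "star_body n M" for M
    using someI_ex[OF that[unfolded star_body_def]] by (simp add: radial_fun_def)
  have pos: "radial_fun n M v > 0" if "star_body n M" "v \<in> unit_sphere n" for M v
    using adm that by (auto simp: admissible_radial_def)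
  have cont: "continuous_map (nsphere (n - 1)) euclideanreal (\<lambda>v. f v powr q)"
    if "continuous_map (nsphere (n - 1)) euclideanreal f" "\<And>v. v \<in> unit_sphere n \<Longrightarrow> f v > 0"
    for f and q :: real
    unfolding continuous_map_atin
  proof
    fix v assume v: "v \<in> unit_sphere n"
    have "limitin euclideanreal f (f v) (atin (nsphere (n - 1)) v)"
      using that(1) v unfolding continuous_map_atin by blast
    then have "((\<lambda>v. f v powr q) \<longlongrightarrow> f v powr q) (atin (nsphere (n - 1)) v)"
      using that(2)[OF v] by (intro tendsto_powr) auto
    then show "limitin euclideanreal (\<lambda>v. f v powr q) (f v powr q) (atin (nsphere (n - 1)) v)"
      by simp
  qed
  let ?\<rho> = "\<lambda>v. (radial_fun n K v powr p + radial_fun n L v powr p) powr (1 / p)"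
  have "admissible_radial n ?\<rho>"
    unfolding admissible_radial_def
  proof (intro conjI ballI cont continuous_map_add)
    fix v assume v: "v \<in> unit_sphere n"
    show K: "radial_fun n K v > 0" and L: "radial_fun n L v > 0"
      using pos assms v by auto
    show "radial_fun n K v powr p + radial_fun n L v powr p > 0"
      using K L by (simp add: add_pos_pos)
    then show "?\<rho> v > 0"
      by simp
  qed (use adm assms in \<open>auto simp: admissible_radial_def\<close>)
  then show ?thesis
    unfolding star_body_def radial_sum_def by blast
qed

end

theory Submission
  imports Defs "HOL-Probability.Probability"
begin

text \<open>
  Up to a factor \<open>2\<close>, a body \<open>D\<close> of the class is given by \<open>\<rho>\<^sub>D\<^sup>k = F\<close> with
  \<open>F x = \<Sum>\<^sub>l \<bar>T\<^sub>l x\<bar>\<^sup>-\<^sup>k\<close>. Since \<open>\<bar>v\<bar>\<^sup>-\<^sup>k\<close> is a positive mixture of Gaussians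
  \<open>exp (- t\<^sup>2 \<bar>v\<bar>\<^sup>2 / 2)\<close>, and these are positive mixtures of plane waves, a finite set \<open>y\<^sub>1, \<dots>, y\<^sub>N\<close>
  whose empirical characteristic function is close to that of a truncated standard Gaussian makes the
  average of \<open>F\<close> over small Gaussian perturbations of the \<open>y\<^sub>j\<close> at most three times the Gaussian mean of \<open>F\<close>,
  for all \<open>T\<^sub>l\<close> simultaneously. It is enough to control the frequencies in a grid of \<open>\<real>\<^sup>n\<close>, and
  \<open>N = n^O(k)\<close> points chosen one after the other achieve this.

  If \<open>D\<close> contains the convex hull \<open>K\<close> of the points \<open>\<plusminus>y\<^sub>j\<close> enlarged by a ball of radius \<open>2\<close>, then \<open>F \<ge> 2\<^sup>-\<^sup>k\<close>
  at most perturbed points, so the Gaussian mean of \<open>F\<close> is at least \<open>c\<^sup>k\<close>; as \<open>{F > t\<^sup>k}\<close> lies in a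
  dilate of \<open>D\<close>, this forces \<open>\<bar>D\<bar>\<^sub>n \<ge> c\<^sup>n\<close>. On the other hand \<open>K\<close> has few vertices of norm at most \<open>2 \<surd>n\<close>, so
  Maurey's covering argument gives \<open>\<bar>K\<bar>\<^sub>n \<le> (C \<surd>(k ln n / n))\<^sup>n\<close>.
\<close>

subsection \<open>Gaussian and Lebesgue measure in coordinates\<close>

text \<open>The obstacle is uniformity in the matrices: a nearly degenerate \<open>T\<close> makes
  |T x|^-k arbitrarily peaked near a subspace, so values at isolated points say nothing about its
  mean. Perturbing each point at scale \<sigma> = 1 / sqrt n damps high frequencies, which leaves
  finitely many to control, and moves a point by at most 2 with probability at least 3/4; hence the
  radius of the added ball. The accuracy \<delta> = (\<sigma> / sqrt 2)^k is forced by homogeneity: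
  an error \<delta> times the mean at scale \<sigma> / sqrt 2 equals one further Gaussian mean. As
  1/\<delta> is at most n^k, polynomially many points in n and 1/\<delta> give ln N = O(k ln n), the
  source of the factor k ln n. When 16 k ln n exceeds n, the asserted bound is below 1 and
  monotonicity of volume suffices. Otherwise 2 k \<le> n, and the Gaussian masses of the level sets
  decay faster than their heights grow.\<close>

abbreviation lebn :: "nat \<Rightarrow> (nat \<Rightarrow> real) measure" where
  "lebn n \<equiv> Pi\<^sub>M {..<n} (\<lambda>_. lborel)"

definition ip :: "nat \<Rightarrow> (nat \<Rightarrow> real) \<Rightarrow> (nat \<Rightarrow> real) \<Rightarrow> real" where
  "ip n x y = (\<Sum>i<n. x i * y i)"

definition gauss :: "nat \<Rightarrow> (nat \<Rightarrow> real) measure" where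
  "gauss n = Pi\<^sub>M {..<n} (\<lambda>_. density lborel std_normal_density)"

lemma sets_gauss [measurable_cong]: "sets (gauss n) = sets (Pi\<^sub>M {..<n} (\<lambda>_. borel))"
  unfolding gauss_def by (intro sets_PiM_cong) auto

lemma space_gauss: "space (gauss n) = space (lebn n)"
  by (simp add: gauss_def space_PiM)

lemma prob_space_std_normal: "prob_space (density lborel std_normal_density)"
  by (rule prob_space_normal_density) simp

lemma prob_space_gauss: "prob_space (gauss n)"
  unfolding gauss_def by (intro prob_space_PiM prob_space_std_normal)

interpretation gauss: prob_space "gauss n" for n
  by (rule prob_space_gauss)

lemma borel_measurable_ip [measurable]:
  assumes [measurable]: "\<And>i. i < n \<Longrightarrow> (\<lambda>x. f x i) \<in> borel_measurable M"
    "\<And>i. i < n \<Longrightarrow> (\<lambda>x. g x i) \<in> borel_measurable M"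
  shows "(\<lambda>x. ip n (f x) (g x)) \<in> borel_measurable M"
  unfolding ip_def by (intro borel_measurable_sum borel_measurable_times) auto

lemma borel_measurable_enorm [measurable]:
  assumes [measurable]: "\<And>i. i < n \<Longrightarrow> (\<lambda>x. f x i) \<in> borel_measurable M"
  shows "(\<lambda>x. enorm n (f x)) \<in> borel_measurable M"
proof -
  have [measurable]: "(\<lambda>x. \<Sum>i<n. (f x i)\<^sup>2) \<in> borel_measurable M"
    by (intro borel_measurable_sum borel_measurable_power) auto
  show ?thesis unfolding L2_set_def by measurable
qed

lemma borel_measurable_linear_map [measurable]:
  assumes [measurable]: "\<And>i. i < n \<Longrightarrow> (\<lambda>x. f x i) \<in> borel_measurable M"
  shows "(\<lambda>x. linear_map n A (f x) i) \<in> borel_measurable M"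
proof (cases "i < n")
  case True
  then have "(\<lambda>x. linear_map n A (f x) i) = (\<lambda>x. \<Sum>j<n. A i j * f x j)"
    by (simp add: linear_map_def)
  also have "\<dots> \<in> borel_measurable M"
    by (intro borel_measurable_sum borel_measurable_times) auto
  finally show ?thesis .
qed (simp add: linear_map_def)

lemma enorm_sq: "(enorm n x)\<^sup>2 = (\<Sum>i<n. (x i)\<^sup>2)"
  by (simp add: L2_set_def sum_nonneg)

lemma ip_self: "ip n x x = (enorm n x)\<^sup>2"
  unfolding enorm_sq by (simp add: ip_def power2_eq_square)

lemma ip_commute: "ip n x y = ip n y x"
  by (simp add: ip_def mult.commute)

lemma enorm_scale: "enorm n (\<lambda>i. t * x i) = \<bar>t\<bar> * enorm n x"
  unfolding L2_set_def by (simp add: power_mult_distrib real_sqrt_mult flip: sum_distrib_left)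

lemma ip_le_enorm: "\<bar>ip n x y\<bar> \<le> enorm n x * enorm n y"
proof -
  have "\<bar>ip n x y\<bar> \<le> (\<Sum>i<n. \<bar>x i\<bar> * \<bar>y i\<bar>)"
    unfolding ip_def by (rule order_trans[OF sum_abs]) (simp add: abs_mult)
  also have "\<dots> \<le> enorm n x * enorm n y"
    by (rule L2_set_mult_ineq)
  finally show ?thesis .
qed

lemma product_sigma_finite_std_normal:
  "product_sigma_finite (\<lambda>_::nat. density lborel std_normal_density)"
  by (intro product_sigma_finite.intro prob_space_imp_sigma_finite prob_space_std_normal)

lemma product_sigma_finite_lborel: "product_sigma_finite (\<lambda>_::nat. lborel :: real measure)"
  by (intro product_sigma_finite.intro sigma_finite_lborel)

lemma gauss_char:
  "(CLINT x|gauss n. iexp (ip n \<xi> x)) = complex_of_real (exp (- (enorm n \<xi>)\<^sup>2 / 2))"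
proof -
  interpret product_sigma_finite "\<lambda>_::nat. density lborel std_normal_density"
    by (rule product_sigma_finite_std_normal)
  interpret N: prob_space "density lborel std_normal_density"
    by (rule prob_space_std_normal)
  have "(CLINT x|gauss n. iexp (ip n \<xi> x))
      = (CLINT x|gauss n. (\<Prod>i<n. iexp (\<xi> i * x i)))"
    by (simp add: ip_def exp_sum sum_distrib_left)
  also have "\<dots> = (\<Prod>i<n. CLINT y|density lborel std_normal_density. iexp (\<xi> i * y))"
    unfolding gauss_def
  proof (rule product_integral_prod)
    show "integrable (density lborel std_normal_density) (\<lambda>y. iexp (\<xi> i * y))" for i
      by (rule N.integrable_const_bound[of _ 1]) (auto simp: norm_exp_i_times)
  qed simp
  also have "\<dots> = (\<Prod>i<n. complex_of_real (exp (- (\<xi> i)\<^sup>2 / 2)))"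
    using char_std_normal_distribution unfolding char_def by (simp add: fun_eq_iff)
  also have "\<dots> = complex_of_real (exp (- (enorm n \<xi>)\<^sup>2 / 2))"
    by (simp add: enorm_sq sum_negf sum_divide_distrib flip: exp_sum of_real_prod)
  finally show ?thesis .
qed

text \<open>The phase \<open>a\<close> allows a shift: in the representation of perturbed points it
  is the inner product of the frequency with the centre of the perturbation.\<close>

lemma gauss_cos:
  "(\<integral>x. cos (a + ip n \<xi> x) \<partial>gauss n) = cos a * exp (- (enorm n \<xi>)\<^sup>2 / 2)"
proof -
  have int: "integrable (gauss n) (\<lambda>x. iexp a * iexp (ip n \<xi> x))"
    by (rule gauss.integrable_const_bound[of _ 1]) (auto simp: norm_mult norm_exp_i_times)
  have "(\<integral>x. cos (a + ip n \<xi> x) \<partial>gauss n) = (\<integral>x. Re (iexp a * iexp (ip n \<xi> x)) \<partial>gauss n)"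
    by (intro Bochner_Integration.integral_cong refl)
       (simp add: distrib_left Re_exp flip: exp_add)
  also have "\<dots> = Re (CLINT x|gauss n. iexp a * iexp (ip n \<xi> x))"
    by (rule integral_Re[OF int])
  also have "\<dots> = Re (iexp a * complex_of_real (exp (- (enorm n \<xi>)\<^sup>2 / 2)))"
    by (simp only: integral_mult_right_zero gauss_char)
  also have "\<dots> = cos a * exp (- (enorm n \<xi>)\<^sup>2 / 2)"
    by (simp add: Re_exp)
  finally show ?thesis .
qed

text \<open>This passes between Gaussian mass and volume in both directions: an upper bound on the
  density bounds masses of level sets, a lower bound on a ball bounds the volume of that
  ball.\<close>

lemma gauss_density:
  "gauss n = density (lebn n) (\<lambda>x. ennreal ((1 / sqrt (2 * pi)) ^ n * exp (- (enorm n x)\<^sup>2 / 2)))"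
    (is "_ = ?D")
proof -
  interpret N: product_sigma_finite "\<lambda>_::nat. density lborel std_normal_density"
    by (rule product_sigma_finite_std_normal)
  interpret L: product_sigma_finite "\<lambda>_::nat. lborel :: real measure"
    by (rule product_sigma_finite_lborel)
  have "exp (- (enorm n x)\<^sup>2 / 2) = (\<Prod>i<n. exp (- (x i)\<^sup>2 / 2))" for x
    by (simp add: enorm_sq sum_divide_distrib exp_sum flip: sum_negf)
  then have eq: "ennreal ((1 / sqrt (2 * pi)) ^ n * exp (- (enorm n x)\<^sup>2 / 2))
      = (\<Prod>i<n. ennreal (std_normal_density (x i)))" for x
    by (simp add: prod_ennreal std_normal_density_def prod_dividef power_divide)
  have "?D = Pi\<^sub>M {..<n} (\<lambda>_. density lborel std_normal_density)"
  proof (rule N.PiM_eqI)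
    show "sets ?D = sets (Pi\<^sub>M {..<n} (\<lambda>_. density lborel std_normal_density))"
      unfolding sets_density by (intro sets_PiM_cong) auto
  next
    fix A :: "nat \<Rightarrow> real set" assume A: "\<And>i. i \<in> {..<n} \<Longrightarrow> A i \<in> sets (density lborel std_normal_density)"
    then have [measurable]: "\<And>i. i < n \<Longrightarrow> A i \<in> sets borel" by simp
    have A': "Pi\<^sub>E {..<n} A \<in> sets (lebn n)"
      by (rule sets_PiM_I_finite) auto
    have "emeasure ?D (Pi\<^sub>E {..<n} A)
        = (\<integral>\<^sup>+x. (\<Prod>i<n. ennreal (std_normal_density (x i))) * indicator (Pi\<^sub>E {..<n} A) x \<partial>lebn n)"
      unfolding eq using A' by (intro emeasure_density) measurable
    also have "\<dots> = (\<integral>\<^sup>+x. (\<Prod>i<n. ennreal (std_normal_density (x i)) * indicator (A i) (x i)) \<partial>lebn n)"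
      by (intro nn_integral_cong)
         (auto simp: prod.distrib indicator_def space_PiM PiE_iff split: if_splits)
    also have "\<dots> = (\<Prod>i<n. \<integral>\<^sup>+y. ennreal (std_normal_density y) * indicator (A i) y \<partial>lborel)"
      by (rule L.product_nn_integral_prod) auto
    also have "\<dots> = (\<Prod>i<n. emeasure (density lborel std_normal_density) (A i))"
      by (intro prod.cong refl) (auto simp: emeasure_density)
    finally show "emeasure ?D (Pi\<^sub>E {..<n} A)
        = (\<Prod>i\<in>{..<n}. emeasure (density lborel std_normal_density) (A i))" .
  qed simp
  then show ?thesis by (simp add: gauss_def)
qed

text \<open>Markov's inequality for |x|^2, whose mean is n, at the level 4 n leaves mass at most 1/4
  outside.\<close>

lemma gauss_norm_bound:
  assumes "n \<ge> 1"
  shows "measure (gauss n) {x \<in> space (gauss n). enorm n x \<le> 2 * sqrt n} \<ge> 3 / 4"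
proof -
  have comp: "distr (gauss n) (density lborel std_normal_density) (\<lambda>x. x i)
      = density lborel std_normal_density" if "i < n" for i
    unfolding gauss_def using that by (intro distr_PiM_component prob_space_std_normal) auto
  have m: "integrable (density lborel std_normal_density) (\<lambda>y. y\<^sup>2)"
      "(\<integral>y. y\<^sup>2 \<partial>density lborel std_normal_density) = 1"
    using std_normal_moment_even[of 1]
    by (auto simp: integrable_density integral_density has_bochner_integral_iff)
  have c: "integrable (gauss n) (\<lambda>x. (x i)\<^sup>2) \<and> (\<integral>x. (x i)\<^sup>2 \<partial>gauss n) = 1" if "i < n" for i
  proof -
    have "(\<lambda>x. x i) \<in> Pi\<^sub>M {..<n} (\<lambda>_. borel) \<rightarrow>\<^sub>M (borel :: real measure)"
      using that by (intro measurable_component_singleton) auto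
    then have [measurable]: "(\<lambda>x. x i) \<in> gauss n \<rightarrow>\<^sub>M borel"
      by (simp add: measurable_cong_sets[OF sets_gauss refl])
    have [measurable]: "(\<lambda>x. x i) \<in> gauss n \<rightarrow>\<^sub>M density lborel std_normal_density"
      by simp
    show ?thesis
      using m integrable_distr_eq[of "\<lambda>x. x i" "gauss n" "density lborel std_normal_density" "\<lambda>y. y\<^sup>2"]
        integral_distr[of "\<lambda>x. x i" "gauss n" "density lborel std_normal_density" "\<lambda>y. y\<^sup>2"]
      unfolding comp[OF that] by simp
  qed
  have i: "integrable (gauss n) (\<lambda>x. (enorm n x)\<^sup>2)" "(\<integral>x. (enorm n x)\<^sup>2 \<partial>gauss n) = n"
    using c by (auto simp: enorm_sq)
  have "measure (gauss n) {x \<in> space (gauss n). 4 * real n \<le> (enorm n x)\<^sup>2} \<le> (\<integral>x. (enorm n x)\<^sup>2 \<partial>gauss n) / (4 * real n)"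
    using assms by (intro integral_Markov_inequality_measure[where A="space (gauss n)"] i) auto
  then have le: "measure (gauss n) {x \<in> space (gauss n). 4 * real n \<le> (enorm n x)\<^sup>2} \<le> 1/4"
    using assms by (simp add: i)
  have "1 - measure (gauss n) {x \<in> space (gauss n). 4 * real n \<le> (enorm n x)\<^sup>2}
     = measure (gauss n) {x \<in> space (gauss n). \<not> (4 * real n \<le> (enorm n x)\<^sup>2)}"
    by (subst gauss.prob_neg) auto
  also have "\<dots> \<le> measure (gauss n) {x \<in> space (gauss n). enorm n x \<le> 2 * sqrt n}"
  proof (intro gauss.finite_measure_mono subsetI)
    fix x assume "x \<in> {x \<in> space (gauss n). \<not> (4 * real n \<le> (enorm n x)\<^sup>2)}"
    then have "x \<in> space (gauss n)" "(enorm n x)\<^sup>2 \<le> (2 * sqrt n)\<^sup>2" by (auto simp: power_mult_distrib)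
    then show "x \<in> {x \<in> space (gauss n). enorm n x \<le> 2 * sqrt n}"
      by (auto intro: power2_le_imp_le)
  qed measurable
  finally show ?thesis using le by simp
qed

text \<open>The push-forward under the affine map, multiplied by t^n, agrees with Lebesgue measure
  on boxes by the one-dimensional formula in each coordinate, and boxes determine the product
  measure.\<close>

lemma emeasure_lebn_affine:
  assumes "t > 0" and S: "S \<in> sets (lebn n)"
  shows "emeasure (lebn n) S
    = ennreal (t ^ n) * emeasure (lebn n) ((\<lambda>x. \<lambda>i\<in>{..<n}. b i + t * x i) -` S \<inter> space (lebn n))"
proof -
  interpret L: product_sigma_finite "\<lambda>_::nat. lborel :: real measure"
    by (rule product_sigma_finite_lborel)
  let ?\<phi> = "\<lambda>x. \<lambda>i\<in>{..<n}. b i + t * x i"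
  have \<phi>[measurable]: "?\<phi> \<in> lebn n \<rightarrow>\<^sub>M lebn n"
    by (intro measurable_restrict) auto
  let ?D = "density (distr (lebn n) (lebn n) ?\<phi>) (\<lambda>_. ennreal (t ^ n))"
  have "?D = lebn n"
  proof (rule L.PiM_eqI)
    fix A :: "nat \<Rightarrow> real set" assume "\<And>i. i \<in> {..<n} \<Longrightarrow> A i \<in> sets lborel"
    then have A[measurable]: "\<And>i. i < n \<Longrightarrow> A i \<in> sets borel" by simp
    have A': "Pi\<^sub>E {..<n} A \<in> sets (lebn n)"
      by (rule sets_PiM_I_finite) auto
    have pre: "?\<phi> -` Pi\<^sub>E {..<n} A \<inter> space (lebn n) = Pi\<^sub>E {..<n} (\<lambda>i. (\<lambda>x. b i + t * x) -` A i)"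
      by (auto simp: space_PiM PiE_iff)
    have one: "emeasure lborel (A i) = ennreal t * emeasure lborel ((\<lambda>x. b i + t * x) -` A i)" if "i < n" for i
    proof -
      have "emeasure lborel (A i) = emeasure (density (distr lborel borel (\<lambda>x. b i + t * x)) (\<lambda>_. ennreal \<bar>t\<bar>)) (A i)"
        using \<open>t > 0\<close> by (subst lborel_real_affine[of t "b i"]) auto
      also have "\<dots> = ennreal t * emeasure lborel ((\<lambda>x. b i + t * x) -` A i)"
        using A[OF that] \<open>t > 0\<close> by (simp add: emeasure_density_const emeasure_distr)
      finally show ?thesis .
    qed
    have "emeasure ?D (Pi\<^sub>E {..<n} A) = ennreal (t ^ n) * emeasure (lebn n) (?\<phi> -` Pi\<^sub>E {..<n} A \<inter> space (lebn n))"
      using A' by (simp add: emeasure_density_const emeasure_distr)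
    also have "\<dots> = ennreal (t ^ n) * (\<Prod>i<n. emeasure lborel ((\<lambda>x. b i + t * x) -` A i))"
      unfolding pre by (subst L.emeasure_PiM) (auto intro!: measurable_sets_borel[OF _ A])
    also have "\<dots> = (\<Prod>i<n. ennreal t * emeasure lborel ((\<lambda>x. b i + t * x) -` A i))"
      using \<open>t > 0\<close> by (simp add: prod.distrib ennreal_power)
    also have "\<dots> = (\<Prod>i<n. emeasure lborel (A i))"
      by (intro prod.cong) (auto simp: one)
    finally show "emeasure ?D (Pi\<^sub>E {..<n} A) = (\<Prod>i\<in>{..<n}. emeasure lborel (A i))" .
  qed (auto)
  then have "emeasure (lebn n) S = emeasure ?D S" by simp
  also have "\<dots> = ennreal (t ^ n) * emeasure (lebn n) (?\<phi> -` S \<inter> space (lebn n))"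
    using S by (simp add: emeasure_density_const emeasure_distr)
  finally show ?thesis .
qed

subsection \<open>Fourier comparison of smoothed Gaussians\<close>

lemma ip_linear_map:
  "ip n (linear_map n S x) G = ip n (linear_map n (\<lambda>i j. S j i) G) x"
proof -
  have "ip n (linear_map n S x) G = (\<Sum>i<n. \<Sum>j<n. S i j * x j * G i)"
    by (simp add: ip_def linear_map_def sum_distrib_right)
  also have "\<dots> = (\<Sum>j<n. \<Sum>i<n. S i j * x j * G i)"
    by (rule sum.swap)
  also have "\<dots> = ip n (linear_map n (\<lambda>i j. S j i) G) x"
    by (simp add: ip_def linear_map_def sum_distrib_left sum_distrib_right mult_ac)
  finally show ?thesis .
qed

lemma linear_map_scale: "linear_map n S (\<lambda>i. t * x i) = (\<lambda>i. t * linear_map n S x i)"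
  by (auto simp: linear_map_def sum_distrib_left mult_ac fun_eq_iff)

lemma ip_add_right: "ip n \<xi> (\<lambda>i. x i + y i) = ip n \<xi> x + ip n \<xi> y"
  by (simp add: ip_def distrib_left sum.distrib)

lemma ip_scale_right: "ip n \<xi> (\<lambda>i. t * x i) = t * ip n \<xi> x"
  by (simp add: ip_def sum_distrib_left mult_ac)

lemma ip_scale_left: "ip n (\<lambda>i. t * \<xi> i) x = t * ip n \<xi> x"
  by (simp add: ip_def sum_distrib_left mult_ac)

abbreviation (input) tmap :: "nat \<Rightarrow> (nat \<Rightarrow> nat \<Rightarrow> real) \<Rightarrow> (nat \<Rightarrow> real) \<Rightarrow> nat \<Rightarrow> real" where
  "tmap n S \<equiv> linear_map n (\<lambda>i j. S j i)"

lemma pair_prob_space_gauss: "prob_space \<nu> \<Longrightarrow> pair_prob_space (gauss n) \<nu>"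
  by (intro pair_prob_space.intro pair_sigma_finite.intro prob_space_imp_sigma_finite prob_space_gauss)

text \<open>The frequency of the plane wave is \<open>S\<^sup>T G\<close> for a standard Gaussian \<open>G\<close>.\<close>

lemma gauss_linear_exp:
  "(\<integral>g. exp (- (enorm n (linear_map n S (\<lambda>i. x i + s * g i)))\<^sup>2 / 2) \<partial>gauss n)
    = (\<integral>G. cos (ip n (tmap n S G) x) * exp (- (s * enorm n (tmap n S G))\<^sup>2 / 2) \<partial>gauss n)"
proof -
  interpret P: pair_prob_space "gauss n" "gauss n"
    by (intro pair_prob_space_gauss prob_space_gauss)
  let ?f = "\<lambda>g G. cos (ip n (tmap n S G) x + ip n (\<lambda>i. s * tmap n S G i) g)"
  \<comment> \<open>For fixed \<open>G\<close> the wave is read as a function of \<open>g\<close>: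
    the centre \<open>x\<close> enters only the phase, and integrating out \<open>g\<close> produces
    the damping factor.\<close>
  have eq: "cos (0 + ip n (linear_map n S (\<lambda>i. x i + s * g i)) G) = ?f g G" for g G
    by (subst ip_linear_map) (simp add: ip_add_right ip_scale_right ip_scale_left)
  have "(\<integral>g. exp (- (enorm n (linear_map n S (\<lambda>i. x i + s * g i)))\<^sup>2 / 2) \<partial>gauss n)
      = (\<integral>g. (\<integral>G. ?f g G \<partial>gauss n) \<partial>gauss n)"
    unfolding eq[symmetric] gauss_cos by simp
  also have "\<dots> = (\<integral>G. (\<integral>g. ?f g G \<partial>gauss n) \<partial>gauss n)"
  proof (rule P.Fubini_integral[symmetric])
    have [measurable]: "case_prod ?f \<in> borel_measurable (gauss n \<Otimes>\<^sub>M gauss n)"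
      by measurable
    show "integrable (gauss n \<Otimes>\<^sub>M gauss n) (case_prod ?f)"
      by (rule P.integrable_const_bound[of _ 1]) auto
  qed
  also have "\<dots> = (\<integral>G. cos (ip n (tmap n S G) x) * exp (- (s * enorm n (tmap n S G))\<^sup>2 / 2) \<partial>gauss n)"
    unfolding gauss_cos enorm_scale by (simp add: power_mult_distrib)
  finally show ?thesis .
qed

lemma gauss_linear_exp_0:
  "(\<integral>g. exp (- (enorm n (linear_map n S (\<lambda>i. s * g i)))\<^sup>2 / 2) \<partial>gauss n)
    = (\<integral>G. exp (- (s * enorm n (tmap n S G))\<^sup>2 / 2) \<partial>gauss n)"
  using gauss_linear_exp[of n S "\<lambda>_. 0" s] by (simp add: ip_def)

text \<open>
  All weights in the Fourier representation are nonnegative, so an upper bound at every single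
  frequency is enough and no net of matrices \<open>S\<close> is needed.
\<close>

lemma gauss_average_comparison:
  fixes y :: "nat \<Rightarrow> nat \<Rightarrow> real"
  assumes "prob_space \<nu>" and sets_\<nu> [measurable_cong]: "sets \<nu> = sets (Pi\<^sub>M {..<n} (\<lambda>_. borel))"
    and le: "\<And>\<xi>. (\<Sum>j<N. cos (ip n \<xi> (y j))) * exp (- (\<sigma> * enorm n \<xi>)\<^sup>2 / 2)
      \<le> N * ((\<integral>x. cos (ip n \<xi> x) \<partial>\<nu>) * exp (- (\<sigma> * enorm n \<xi>)\<^sup>2 / 2)
              + \<delta> * exp (- (\<sigma> * enorm n \<xi>)\<^sup>2 / 4))"
  shows "(\<Sum>j<N. \<integral>g. exp (- (enorm n (linear_map n S (\<lambda>i. y j i + \<sigma> * g i)))\<^sup>2 / 2) \<partial>gauss n)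
    \<le> N * ((\<integral>x. (\<integral>g. exp (- (enorm n (linear_map n S (\<lambda>i. x i + \<sigma> * g i)))\<^sup>2 / 2) \<partial>gauss n) \<partial>\<nu>)
       + \<delta> * (\<integral>g. exp (- (enorm n (linear_map n S (\<lambda>i. \<sigma> / sqrt 2 * g i)))\<^sup>2 / 2) \<partial>gauss n))"
proof -
  interpret \<nu>: prob_space \<nu> by fact
  interpret P: pair_prob_space "gauss n" \<nu>
    by (intro pair_prob_space_gauss \<open>prob_space \<nu>\<close>)
  let ?e = "\<lambda>G. exp (- (\<sigma> * enorm n (tmap n S G))\<^sup>2 / 2)"
  let ?e2 = "\<lambda>G. exp (- (\<sigma> / sqrt 2 * enorm n (tmap n S G))\<^sup>2 / 2)"
  let ?\<phi> = "\<lambda>G. \<integral>x. cos (ip n (tmap n S G) x) \<partial>\<nu>"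
  have [measurable]: "case_prod (\<lambda>G x. cos (ip n (tmap n S G) x)) \<in> borel_measurable (gauss n \<Otimes>\<^sub>M \<nu>)"
    by measurable
  have i1: "integrable (gauss n) (\<lambda>G. cos (ip n (tmap n S G) (y j)) * ?e G)" for j
    by (rule gauss.integrable_const_bound[of _ 1]) (auto simp: abs_mult intro!: mult_le_one)
  have ie: "integrable (gauss n) ?e2"
    by (rule gauss.integrable_const_bound[of _ 1]) auto
  have i3: "integrable (gauss n \<Otimes>\<^sub>M \<nu>) (case_prod (\<lambda>G x. cos (ip n (tmap n S G) x) * ?e G))"
    by (rule P.integrable_const_bound[of _ 1]) (auto simp: split_beta' abs_mult intro!: mult_le_one)
  have i2: "integrable (gauss n) (\<lambda>G. ?\<phi> G * ?e G)"
    using P.integrable_fst'[OF i3] by simp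
  have "(\<Sum>j<N. \<integral>g. exp (- (enorm n (linear_map n S (\<lambda>i. y j i + \<sigma> * g i)))\<^sup>2 / 2) \<partial>gauss n)
     = (\<integral>G. (\<Sum>j<N. cos (ip n (tmap n S G) (y j))) * ?e G \<partial>gauss n)"
    unfolding gauss_linear_exp sum_distrib_right using i1 by simp
  also have "\<dots> \<le> (\<integral>G. N * (?\<phi> G * ?e G + \<delta> * ?e2 G) \<partial>gauss n)"
  proof (rule integral_mono)
    show "integrable (gauss n) (\<lambda>G. (\<Sum>j<N. cos (ip n (tmap n S G) (y j))) * ?e G)"
      unfolding sum_distrib_right using i1 by simp
    show "integrable (gauss n) (\<lambda>G. N * (?\<phi> G * ?e G + \<delta> * ?e2 G))"
      using i2 ie by simp
    show "(\<Sum>j<N. cos (ip n (tmap n S G) (y j))) * ?e G \<le> N * (?\<phi> G * ?e G + \<delta> * ?e2 G)" for G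
      using le[of "tmap n S G"] by (simp add: power_mult_distrib power_divide)
  qed
  also have "\<dots> = N * ((\<integral>G. ?\<phi> G * ?e G \<partial>gauss n) + \<delta> * (\<integral>G. ?e2 G \<partial>gauss n))"
    using i2 ie by simp
  also have "(\<integral>G. ?\<phi> G * ?e G \<partial>gauss n) = (\<integral>G. (\<integral>x. cos (ip n (tmap n S G) x) * ?e G \<partial>\<nu>) \<partial>gauss n)"
    by simp
  also have "\<dots> = (\<integral>x. (\<integral>G. cos (ip n (tmap n S G) x) * ?e G \<partial>gauss n) \<partial>\<nu>)"
    by (rule P.Fubini_integral[OF i3, symmetric])
  finally show ?thesis
    unfolding gauss_linear_exp gauss_linear_exp_0 .
qed

text \<open>On the Fourier side, where all weights are positive, additional smoothing only inserts a
  factor of at most 1.\<close>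

lemma gauss_smoothing_le:
  "(\<integral>x. (\<integral>g. exp (- (enorm n (linear_map n S (\<lambda>i. x i + \<sigma> * g i)))\<^sup>2 / 2) \<partial>gauss n) \<partial>gauss n)
    \<le> (\<integral>g. exp (- (enorm n (linear_map n S g))\<^sup>2 / 2) \<partial>gauss n)"
proof -
  interpret P: pair_prob_space "gauss n" "gauss n"
    by (intro pair_prob_space_gauss prob_space_gauss)
  let ?e = "\<lambda>t G. exp (- (t * enorm n (tmap n S G))\<^sup>2 / 2)"
  have i3: "integrable (gauss n \<Otimes>\<^sub>M gauss n) (case_prod (\<lambda>G x. cos (ip n (tmap n S G) x) * ?e \<sigma> G))"
    by (rule P.integrable_const_bound[of _ 1]) (auto simp: split_beta' abs_mult intro!: mult_le_one)
  have cos0: "(\<integral>x. cos (ip n \<xi> x) \<partial>gauss n) = exp (- (enorm n \<xi>)\<^sup>2 / 2)" for \<xi>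
    using gauss_cos[of n 0 \<xi>] by simp
  have "(\<integral>x. (\<integral>g. exp (- (enorm n (linear_map n S (\<lambda>i. x i + \<sigma> * g i)))\<^sup>2 / 2) \<partial>gauss n) \<partial>gauss n)
      = (\<integral>G. (\<integral>x. cos (ip n (tmap n S G) x) * ?e \<sigma> G \<partial>gauss n) \<partial>gauss n)"
    unfolding gauss_linear_exp by (rule P.Fubini_integral[OF i3])
  also have "\<dots> = (\<integral>G. ?e 1 G * ?e \<sigma> G \<partial>gauss n)"
    by (simp add: cos0)
  also have "\<dots> \<le> (\<integral>G. ?e 1 G \<partial>gauss n)"
  proof (rule integral_mono)
    show "integrable (gauss n) (\<lambda>G. ?e 1 G * ?e \<sigma> G)" "integrable (gauss n) (?e 1)"
      by (rule gauss.integrable_const_bound[of _ 1]; auto intro!: AE_I2 mult_le_one simp: abs_mult)+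
    show "?e 1 G * ?e \<sigma> G \<le> ?e 1 G" for G by (simp add: mult_left_le)
  qed
  finally show ?thesis using gauss_linear_exp_0[of n S 1] by simp
qed

subsection \<open>Well-distributed finite point sets\<close>

text \<open>A random variable cannot exceed its mean almost surely. The set \<open>A\<close> of full
  measure allows the point to be chosen in the truncation region.\<close>

lemma (in prob_space) exists_le_expectation:
  fixes f :: "'a \<Rightarrow> real"
  assumes "integrable M f" "AE x in M. x \<in> A"
  shows "\<exists>x\<in>A. f x \<le> expectation f"
proof (rule ccontr)
  assume "\<not> (\<exists>x\<in>A. f x \<le> expectation f)"
  then have "AE x in M. expectation f < f x"
    using assms(2) by (auto simp: not_le elim!: eventually_mono)
  then have "expectation f < expectation f"
    by (intro expectation_greater assms(1))
  then show False by simp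
qed

text \<open>
  The points are chosen one at a time: by Hoeffding's lemma, averaging over the next point multiplies
  the potential by at most \<open>exp (l\<^sup>2 / 2)\<close>, hence some choice does so.
\<close>

lemma (in prob_space) exists_deviation_potential_bound:
  fixes f :: "'i \<Rightarrow> 'a \<Rightarrow> real"
  assumes "finite \<Xi>" and f [measurable]: "\<And>\<xi>. f \<xi> \<in> borel_measurable M"
    and f1: "\<And>\<xi> x. \<bar>f \<xi> x\<bar> \<le> 1" and "AE x in M. x \<in> A" "l > 0"
  shows "\<exists>y. (\<forall>j::nat. y j \<in> A) \<and>
    (\<Sum>\<xi>\<in>\<Xi>. exp (l * (\<Sum>j<N. f \<xi> (y j) - expectation (f \<xi>)))) \<le> card \<Xi> * exp (N * (l\<^sup>2 / 2))"
proof (induction N)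
  case 0
  obtain a where "a \<in> A"
    using exists_le_expectation[of "\<lambda>_. 0" A] assms by auto
  then show ?case by (intro exI[of _ "\<lambda>_. a"]) simp
next
  case (Suc N)
  then obtain y where y: "\<And>j. y j \<in> A"
    and le: "(\<Sum>\<xi>\<in>\<Xi>. exp (l * (\<Sum>j<N. f \<xi> (y j) - expectation (f \<xi>)))) \<le> card \<Xi> * exp (N * (l\<^sup>2 / 2))"
    by blast
  \<comment> \<open>The weight \<open>w\<close> carries the points already chosen, \<open>h\<close>
    is the factor contributed by the next one.\<close>
  define w where "w \<xi> = exp (l * (\<Sum>j<N. f \<xi> (y j) - expectation (f \<xi>)))" for \<xi>
  define h where "h \<xi> x = exp (l * (f \<xi> x - expectation (f \<xi>)))" for \<xi> x
  have int_f: "integrable M (f \<xi>)" for \<xi>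
    by (rule integrable_const_bound[of _ 1]) (auto simp: f1)
  have [measurable]: "h \<xi> \<in> borel_measurable M" for \<xi>
    unfolding h_def by measurable
  have int_h: "integrable M (h \<xi>)" for \<xi>
  proof (rule integrable_const_bound[of _ "exp (l * (1 - expectation (f \<xi>)))"])
    show "AE x in M. norm (h \<xi> x) \<le> exp (l * (1 - expectation (f \<xi>)))"
      using f1 \<open>l > 0\<close> by (auto simp: h_def abs_le_iff)
  qed simp
  \<comment> \<open>The values lie in an interval of length 2, so the exponent in Hoeffding's lemma
    is l^2 * 2^2 / 8.\<close>
  have E_h: "expectation (h \<xi>) \<le> exp (l\<^sup>2 / 2)" for \<xi>
  proof -
    interpret H: interval_bounded_random_variable M "f \<xi>" "- 1" 1
      using f1 by unfold_locales (auto simp: abs_le_iff minus_le_iff)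
    have "ennreal (expectation (h \<xi>)) = (\<integral>\<^sup>+x. h \<xi> x \<partial>M)"
      using int_h by (intro nn_integral_eq_integral[symmetric]) (auto simp: h_def)
    also have "\<dots> \<le> ennreal (exp (l\<^sup>2 * (1 - - 1)\<^sup>2 / 8))"
      unfolding h_def by (rule H.Hoeffdings_lemma_nn_integral[OF \<open>l > 0\<close>])
    finally show ?thesis by simp
  qed
  have "integrable M (\<lambda>x. \<Sum>\<xi>\<in>\<Xi>. w \<xi> * h \<xi> x)"
    using int_h by simp
  then obtain a where a: "a \<in> A" "(\<Sum>\<xi>\<in>\<Xi>. w \<xi> * h \<xi> a) \<le> expectation (\<lambda>x. \<Sum>\<xi>\<in>\<Xi>. w \<xi> * h \<xi> x)"
    using exists_le_expectation assms(4) by blast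
  note a(2)
  also have "expectation (\<lambda>x. \<Sum>\<xi>\<in>\<Xi>. w \<xi> * h \<xi> x) = (\<Sum>\<xi>\<in>\<Xi>. w \<xi> * expectation (h \<xi>))"
    using int_h by simp
  also have "\<dots> \<le> (\<Sum>\<xi>\<in>\<Xi>. w \<xi> * exp (l\<^sup>2 / 2))"
    by (intro sum_mono mult_left_mono E_h) (simp add: w_def)
  also have "\<dots> = (\<Sum>\<xi>\<in>\<Xi>. w \<xi>) * exp (l\<^sup>2 / 2)"
    by (simp add: sum_distrib_right)
  also have "\<dots> \<le> (card \<Xi> * exp (N * (l\<^sup>2 / 2))) * exp (l\<^sup>2 / 2)"
    using le by (intro mult_right_mono) (simp_all add: w_def)
  also have "\<dots> = card \<Xi> * exp (Suc N * (l\<^sup>2 / 2))"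
    by (simp add: algebra_simps add_divide_distrib flip: exp_add)
  finally have "(\<Sum>\<xi>\<in>\<Xi>. w \<xi> * h \<xi> a) \<le> card \<Xi> * exp (Suc N * (l\<^sup>2 / 2))" .
  moreover have "w \<xi> * h \<xi> a = exp (l * (\<Sum>j<Suc N. f \<xi> ((y(N := a)) j) - expectation (f \<xi>)))" for \<xi>
    by (simp add: w_def h_def distrib_left flip: exp_add)
  ultimately show ?case
    using y a(1) by (intro exI[of _ "y(N := a)"]) simp
qed

text \<open>The rate \<open>l\<close> is taken to be \<delta>. One summand of the potential is at
  most the whole sum, so \<delta> times a deviation is at most ln (card \<Xi>) + N \<delta>^2 / 2;
  the size of \<open>N\<close> bounds the logarithm by the same N \<delta>^2 / 2.\<close>

lemma (in prob_space) exists_small_deviations: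
  fixes f :: "'i \<Rightarrow> 'a \<Rightarrow> real"
  assumes "finite \<Xi>" and "\<And>\<xi>. f \<xi> \<in> borel_measurable M"
    and "\<And>\<xi> x. \<bar>f \<xi> x\<bar> \<le> 1" and "AE x in M. x \<in> A" "\<delta> > 0"
    and N: "2 * ln (card \<Xi>) \<le> \<delta>\<^sup>2 * N"
  shows "\<exists>y. (\<forall>j::nat. y j \<in> A) \<and> (\<forall>\<xi>\<in>\<Xi>. (\<Sum>j<N. f \<xi> (y j)) \<le> N * (expectation (f \<xi>) + \<delta>))"
proof -
  obtain y where y: "\<And>j. y j \<in> A" and
    le: "(\<Sum>\<xi>\<in>\<Xi>. exp (\<delta> * (\<Sum>j<N. f \<xi> (y j) - expectation (f \<xi>)))) \<le> card \<Xi> * exp (N * (\<delta>\<^sup>2 / 2))"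
    using exists_deviation_potential_bound[of \<Xi> f A \<delta> N] assms(1-5) by blast
  have "(\<Sum>j<N. f \<xi> (y j)) \<le> N * (expectation (f \<xi>) + \<delta>)" if "\<xi> \<in> \<Xi>" for \<xi>
  proof -
    have "card \<Xi> > 0" using that assms(1) card_gt_0_iff by blast
    have "exp (\<delta> * (\<Sum>j<N. f \<xi> (y j) - expectation (f \<xi>)))
        \<le> (\<Sum>\<xi>\<in>\<Xi>. exp (\<delta> * (\<Sum>j<N. f \<xi> (y j) - expectation (f \<xi>))))"
      using that assms(1) by (intro member_le_sum) auto
    also note le
    also have "card \<Xi> * exp (N * (\<delta>\<^sup>2 / 2)) = exp (ln (card \<Xi>) + N * (\<delta>\<^sup>2 / 2))"
      using \<open>card \<Xi> > 0\<close> by (simp add: exp_add)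
    finally have "\<delta> * (\<Sum>j<N. f \<xi> (y j) - expectation (f \<xi>)) \<le> ln (card \<Xi>) + N * (\<delta>\<^sup>2 / 2)"
      by simp
    also have "\<dots> \<le> \<delta> * (N * \<delta>)"
      using N by (simp add: power2_eq_square mult_ac)
    finally have "(\<Sum>j<N. f \<xi> (y j) - expectation (f \<xi>)) \<le> N * \<delta>"
      using \<open>\<delta> > 0\<close> by simp
    then show ?thesis by (simp add: sum_subtractf algebra_simps)
  qed
  then show ?thesis using y by blast
qed

section \<open>Reduction from all frequencies to a finite grid\<close>

lemma exists_grid_point:
  fixes \<xi> :: "nat \<Rightarrow> real"
  assumes "\<eta> > 0" and "enorm n \<xi> \<le> \<eta> * real L"
  shows "\<exists>\<xi>'\<in>Pi\<^sub>E {..<n} (\<lambda>_. (\<lambda>k::int. \<eta> * real_of_int k) ` {- int L..int L}). \<forall>i<n. \<bar>\<xi> i - \<xi>' i\<bar> \<le> \<eta>"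
proof (intro bexI allI impI)
  let ?\<xi>' = "\<lambda>i\<in>{..<n}. \<eta> * real_of_int \<lfloor>\<xi> i / \<eta>\<rfloor>"
  have *: "\<eta> * real_of_int \<lfloor>\<xi> i / \<eta>\<rfloor> \<le> \<xi> i" "\<xi> i - \<eta> * real_of_int \<lfloor>\<xi> i / \<eta>\<rfloor> \<le> \<eta>" for i
  proof -
    have "real_of_int \<lfloor>\<xi> i / \<eta>\<rfloor> \<le> \<xi> i / \<eta>" "\<xi> i / \<eta> \<le> real_of_int \<lfloor>\<xi> i / \<eta>\<rfloor> + 1" by linarith+
    then show "\<eta> * real_of_int \<lfloor>\<xi> i / \<eta>\<rfloor> \<le> \<xi> i" "\<xi> i - \<eta> * real_of_int \<lfloor>\<xi> i / \<eta>\<rfloor> \<le> \<eta>"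
      using \<open>\<eta> > 0\<close> by (simp_all only: pos_le_divide_eq pos_divide_le_eq) (simp_all add: algebra_simps)
  qed
  show "\<bar>\<xi> i - ?\<xi>' i\<bar> \<le> \<eta>" if "i < n" for i
    using * [of i] that by simp
  show "?\<xi>' \<in> Pi\<^sub>E {..<n} (\<lambda>_. (\<lambda>k::int. \<eta> * real_of_int k) ` {- int L..int L})"
  proof (rule restrict_PiE_iff[THEN iffD2], intro ballI imageI)
    fix i assume "i \<in> {..<n}"
    then have "(\<xi> i)\<^sup>2 \<le> (enorm n \<xi>)\<^sup>2"
      unfolding enorm_sq by (intro member_le_sum) auto
    then have "\<bar>\<xi> i\<bar> \<le> enorm n \<xi>"
      by (simp flip: abs_le_square_iff)
    then have "\<bar>\<xi> i\<bar> \<le> \<eta> * real L" using assms by simp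
    then have "- real L \<le> \<xi> i / \<eta>" "\<xi> i / \<eta> \<le> real L"
      using \<open>\<eta> > 0\<close> by (auto simp: field_simps abs_le_iff)
    then show "\<lfloor>\<xi> i / \<eta>\<rfloor> \<in> {- int L..int L}"
      by (auto simp: le_floor_iff floor_le_iff)
  qed
qed

lemma cos_diff_le: "\<bar>cos x - cos y\<bar> \<le> \<bar>x - (y::real)\<bar>"
proof -
  have "\<bar>cos x - cos y\<bar> = 2 * \<bar>sin ((x + y) / 2)\<bar> * \<bar>sin ((y - x) / 2)\<bar>"
    by (simp add: cos_diff_cos abs_mult)
  also have "\<dots> \<le> 2 * 1 * \<bar>(y - x) / 2\<bar>"
    by (intro mult_mono abs_sin_le_one abs_sin_x_le_abs_x) auto
  finally show ?thesis by simp
qed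

text \<open>A coordinatewise error \<eta> is a Euclidean error of at most sqrt n * \<eta>. The
  cosine is 1-Lipschitz, so Cauchy-Schwarz with |x| \<le> 2 sqrt n gives the bound.\<close>

lemma cos_ip_diff_le:
  assumes "\<And>i. i < n \<Longrightarrow> \<bar>\<xi> i - \<xi>' i\<bar> \<le> \<eta>" "enorm n x \<le> 2 * sqrt n"
  shows "\<bar>cos (ip n \<xi> x) - cos (ip n \<xi>' x)\<bar> \<le> 2 * real n * \<eta>"
proof (cases "n = 0")
  case False
  then have "\<eta> \<ge> 0" using assms(1)[of 0] by force
  have "(enorm n (\<lambda>i. \<xi> i - \<xi>' i))\<^sup>2 \<le> (\<Sum>i<n. \<eta>\<^sup>2)"
    unfolding enorm_sq
  proof (rule sum_mono)
    fix i assume "i \<in> {..<n}"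
    then show "(\<xi> i - \<xi>' i)\<^sup>2 \<le> \<eta>\<^sup>2"
      using assms(1)[of i] \<open>\<eta> \<ge> 0\<close> abs_le_square_iff[of "\<xi> i - \<xi>' i" \<eta>] by simp
  qed
  then have "(enorm n (\<lambda>i. \<xi> i - \<xi>' i))\<^sup>2 \<le> (sqrt n * \<eta>)\<^sup>2"
    by (simp add: power_mult_distrib)
  then have d: "enorm n (\<lambda>i. \<xi> i - \<xi>' i) \<le> sqrt n * \<eta>"
    by (rule power2_le_imp_le) (simp add: \<open>\<eta> \<ge> 0\<close>)
  have "\<bar>cos (ip n \<xi> x) - cos (ip n \<xi>' x)\<bar> \<le> \<bar>ip n (\<lambda>i. \<xi> i - \<xi>' i) x\<bar>"
    using cos_diff_le[of "ip n \<xi> x" "ip n \<xi>' x"] by (simp add: ip_def left_diff_distrib sum_subtractf)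
  also have "\<dots> \<le> enorm n (\<lambda>i. \<xi> i - \<xi>' i) * enorm n x"
    by (rule ip_le_enorm)
  also have "\<dots> \<le> (sqrt n * \<eta>) * (2 * sqrt n)"
    using d assms(2) \<open>\<eta> \<ge> 0\<close> by (intro mult_mono) auto
  also have "\<dots> = 2 * real n * \<eta>" by simp
  finally show ?thesis .
qed (simp add: ip_def)

text \<open>The truncation serves twice: as the region of the points \<open>y j\<close>, which
  bounds the vertices and makes the waves Lipschitz in the frequency, and as the range of
  perturbations that are certain to stay inside the body.\<close>

definition gauss_core :: "nat \<Rightarrow> (nat \<Rightarrow> real) set" where
  "gauss_core n = {x \<in> space (gauss n). enorm n x \<le> 2 * sqrt n}"

lemma sets_gauss_core [measurable]: "gauss_core n \<in> sets (gauss n)"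
  unfolding gauss_core_def by measurable

lemma emeasure_gauss_core: "n \<ge> 1 \<Longrightarrow> emeasure (gauss n) (gauss_core n) \<ge> ennreal (3 / 4)"
  using gauss_norm_bound by (simp add: gauss.emeasure_eq_measure gauss_core_def)

text \<open>The error budget \<delta> splits into \<delta>/2 for the deviation at a grid frequency,
  \<delta>/4 for moving the empirical sum to the grid and \<delta>/4 for moving the mean back. Off
  the grid no sampling is involved: even trivial bounds are absorbed, because the error term is
  damped with half the exponent.\<close>

lemma exists_good_points:
  assumes "n \<ge> 1" "0 < \<delta>" "\<delta> \<le> 1" and \<delta>: "2 \<le> \<delta> * exp (real n ^ 2)"
    and L: "16 * real n ^ 3 \<le> \<delta> * real L"
    and N: "8 * n * ln (2 * real L + 1) \<le> \<delta>\<^sup>2 * N"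
  defines "\<nu> \<equiv> uniform_measure (gauss n) (gauss_core n)"
  shows "\<exists>y. (\<forall>j::nat. y j \<in> gauss_core n) \<and>
    (\<forall>\<xi>. (\<Sum>j<N. cos (ip n \<xi> (y j))) * exp (- (1 / sqrt n * enorm n \<xi>)\<^sup>2 / 2)
      \<le> N * ((\<integral>x. cos (ip n \<xi> x) \<partial>\<nu>) * exp (- (1 / sqrt n * enorm n \<xi>)\<^sup>2 / 2)
              + \<delta> * exp (- (1 / sqrt n * enorm n \<xi>)\<^sup>2 / 4)))"
proof -
  \<comment> \<open>With this mesh the Lipschitz error 2 n \<eta> is \<delta>/4, and the grid
    reaches out to \<eta> L \<ge> 2 n^2.\<close>
  define \<eta> where "\<eta> = \<delta> / (8 * n)"
  have "\<eta> > 0" using assms by (simp add: \<eta>_def)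
  define \<Xi> where "\<Xi> = Pi\<^sub>E {..<n} (\<lambda>_. (\<lambda>k::int. \<eta> * real_of_int k) ` {- int L..int L})"
  have inj: "inj_on (\<lambda>k::int. \<eta> * real_of_int k) {- int L..int L}"
    using \<open>\<eta> > 0\<close> by (auto simp: inj_on_def)
  have card: "card \<Xi> = (2 * L + 1) ^ n"
  proof -
    have "nat (int L - (- int L) + 1) = 2 * L + 1" by simp
    then show ?thesis unfolding \<Xi>_def by (simp add: card_PiE card_image[OF inj])
  qed
  have "finite \<Xi>" unfolding \<Xi>_def by (intro finite_PiE) auto
  have pos: "emeasure (gauss n) (gauss_core n) \<noteq> 0"
    using emeasure_gauss_core[OF assms(1)] by (auto simp: ennreal_eq_0_iff)
  interpret \<nu>: prob_space \<nu>
    unfolding \<nu>_def using pos by (intro prob_space_uniform_measure) auto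
  have core: "AE x in \<nu>. x \<in> gauss_core n"
    unfolding \<nu>_def by (intro AE_uniform_measureI) auto
  have [measurable_cong]: "sets \<nu> = sets (Pi\<^sub>M {..<n} (\<lambda>_. borel))"
    by (simp add: \<nu>_def sets_gauss)
  have cos_m [measurable]: "(\<lambda>x. cos (ip n \<xi> x)) \<in> borel_measurable \<nu>" for \<xi>
    by measurable
  have int: "integrable \<nu> (\<lambda>x. cos (ip n \<xi> x))" for \<xi>
    by (rule \<nu>.integrable_const_bound[of _ 1]) auto
  have c: "2 * ln (card \<Xi>) \<le> (\<delta> / 2)\<^sup>2 * N"
    using N by (simp add: card power_divide ln_realpow ac_simps)
  have "\<exists>y. (\<forall>j::nat. y j \<in> gauss_core n) \<and>
      (\<forall>\<xi>\<in>\<Xi>. (\<Sum>j<N. cos (ip n \<xi> (y j))) \<le> N * ((\<integral>x. cos (ip n \<xi> x) \<partial>\<nu>) + \<delta> / 2))"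
    by (rule \<nu>.exists_small_deviations[OF \<open>finite \<Xi>\<close> cos_m abs_cos_le_one core _ c])
       (use \<open>0 < \<delta>\<close> in simp)
  then obtain y where y: "\<And>j. y j \<in> gauss_core n"
    and net: "\<And>\<xi>. \<xi> \<in> \<Xi> \<Longrightarrow> (\<Sum>j<N. cos (ip n \<xi> (y j))) \<le> N * ((\<integral>x. cos (ip n \<xi> x) \<partial>\<nu>) + \<delta> / 2)"
    by blast
  have "(\<Sum>j<N. cos (ip n \<xi> (y j))) * exp (- (1 / sqrt n * enorm n \<xi>)\<^sup>2 / 2)
      \<le> N * ((\<integral>x. cos (ip n \<xi> x) \<partial>\<nu>) * exp (- (1 / sqrt n * enorm n \<xi>)\<^sup>2 / 2)
              + \<delta> * exp (- (1 / sqrt n * enorm n \<xi>)\<^sup>2 / 4))" (is "?S * exp (- ?q / 2) \<le> real N * (?\<phi> * _ + _)") for \<xi>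
  proof (cases "enorm n \<xi> \<le> \<eta> * real L")
    case True
    obtain \<xi>' where \<xi>': "\<xi>' \<in> \<Xi>" "\<And>i. i < n \<Longrightarrow> \<bar>\<xi> i - \<xi>' i\<bar> \<le> \<eta>"
      using exists_grid_point[OF \<open>\<eta> > 0\<close> True] unfolding \<Xi>_def by blast
    have step: "2 * real n * \<eta> = \<delta> / 4" using assms by (simp add: \<eta>_def)
    have d: "\<bar>cos (ip n \<xi> x) - cos (ip n \<xi>' x)\<bar> \<le> \<delta> / 4" if "x \<in> gauss_core n" for x
      using cos_ip_diff_le[of n \<xi> \<xi>' \<eta> x] \<xi>'(2) that unfolding step by (auto simp: gauss_core_def)
    have "?S \<le> (\<Sum>j<N. cos (ip n \<xi>' (y j)) + \<delta> / 4)"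
      using d[OF y] by (intro sum_mono) (smt (verit))
    also have "\<dots> \<le> N * ((\<integral>x. cos (ip n \<xi>' x) \<partial>\<nu>) + \<delta> / 2) + N * (\<delta> / 4)"
      using net[OF \<xi>'(1)] by (simp add: sum.distrib)
    finally have le: "?S \<le> N * ((\<integral>x. cos (ip n \<xi>' x) \<partial>\<nu>) + \<delta> / 2) + N * (\<delta> / 4)" .
    have "(\<integral>x. cos (ip n \<xi>' x) \<partial>\<nu>) \<le> (\<integral>x. cos (ip n \<xi> x) + \<delta> / 4 \<partial>\<nu>)"
      using core
    proof (intro integral_mono_AE int)
      show "AE x in \<nu>. cos (ip n \<xi>' x) \<le> cos (ip n \<xi> x) + \<delta> / 4"
        using core by eventually_elim (use d in \<open>smt (verit)\<close>)
    qed (use int in auto)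
    also have "(\<integral>x. cos (ip n \<xi> x) + \<delta> / 4 \<partial>\<nu>) = ?\<phi> + \<delta> / 4"
      using int by (simp add: \<nu>.prob_space)
    finally have "N * (\<integral>x. cos (ip n \<xi>' x) \<partial>\<nu>) \<le> N * (?\<phi> + \<delta> / 4)"
      by (rule mult_left_mono) simp
    with le have "?S \<le> N * (?\<phi> + \<delta>)"
      by (simp add: algebra_simps)
    then have "?S * exp (- ?q / 2) \<le> N * (?\<phi> + \<delta>) * exp (- ?q / 2)"
      by (intro mult_right_mono) auto
    also have "\<dots> = N * (?\<phi> * exp (- ?q / 2) + \<delta> * exp (- ?q / 2))"
      by (simp add: algebra_simps)
    also have "\<dots> \<le> N * (?\<phi> * exp (- ?q / 2) + \<delta> * exp (- ?q / 4))"
      using \<open>0 < \<delta>\<close> by (intro mult_left_mono add_left_mono) auto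
    finally show ?thesis .
  next
    case False
    \<comment> \<open>High frequencies: with \<open>?S\<close> at most \<open>N\<close> and
      \<open>?\<phi>\<close> at least -1, the claim reduces to 2 exp (- q/2) \<le> \<delta> exp (-
      q/4). Here q/4 \<ge> n^3 \<ge> n^2, so the lower bound on \<delta> applies.\<close>
    have "?S \<le> (\<Sum>j<N. 1)" by (intro sum_mono) simp
    then have S: "?S \<le> N" by simp
    have "\<bar>?\<phi>\<bar> \<le> (\<integral>x. 1 \<partial>\<nu>)"
      by (rule order_trans[OF integral_abs_bound integral_mono]) (use int in auto)
    then have \<phi>: "?\<phi> \<ge> - 1" by (simp add: \<nu>.prob_space)
    have "\<eta> * real L \<ge> 2 * real n ^ 2"
      using L assms(1) by (simp add: \<eta>_def field_simps power2_eq_square power3_eq_cube)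
    then have "enorm n \<xi> \<ge> 2 * real n ^ 2" using False by simp
    then have "(2 * real n ^ 2)\<^sup>2 \<le> (enorm n \<xi>)\<^sup>2" by (intro power_mono) auto
    then have "?q \<ge> (2 * real n ^ 2)\<^sup>2 / n"
      using assms(1) by (simp add: power_mult_distrib power_divide divide_right_mono)
    moreover have "(2 * real n ^ 2)\<^sup>2 / n = 4 * real n ^ 3"
      using assms(1) by (simp add: power2_eq_square power3_eq_cube)
    moreover have "real n ^ 2 \<le> real n ^ 3" using assms(1) by (intro power_increasing) auto
    ultimately have "real n ^ 2 \<le> ?q / 4" by simp
    then have "2 \<le> \<delta> * exp (?q / 4)"
      using \<delta> \<open>0 < \<delta>\<close> by (smt (verit) exp_le_cancel_iff mult_left_mono)
    then have "2 * exp (- ?q / 2) \<le> \<delta> * exp (?q / 4) * exp (- ?q / 2)"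
      by (intro mult_right_mono) auto
    also have "\<dots> = \<delta> * exp (- ?q / 4)"
      by (simp flip: exp_add)
    finally have e: "2 * exp (- ?q / 2) \<le> \<delta> * exp (- ?q / 4)" .
    have "?S * exp (- ?q / 2) \<le> N * exp (- ?q / 2)"
      using S by (intro mult_right_mono) auto
    also have "\<dots> \<le> N * (?\<phi> * exp (- ?q / 2) + \<delta> * exp (- ?q / 4))"
    proof (rule mult_left_mono)
      have "- 1 * exp (- ?q / 2) \<le> ?\<phi> * exp (- ?q / 2)"
        using \<phi> by (intro mult_right_mono) auto
      then show "exp (- ?q / 2) \<le> ?\<phi> * exp (- ?q / 2) + \<delta> * exp (- ?q / 4)"
        using e by simp
    qed simp
    finally show ?thesis .
  qed
  then show ?thesis using y by blast
qed

subsection \<open>Comparison of inverse powers of linear maps\<close>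

abbreviation gexp :: "nat \<Rightarrow> (nat \<Rightarrow> nat \<Rightarrow> real) \<Rightarrow> (nat \<Rightarrow> real) \<Rightarrow> real" where
  "gexp n S x \<equiv> exp (- (enorm n (linear_map n S x))\<^sup>2 / 2)"

lemma nn_integral_gexp:
  assumes [measurable]: "\<And>i. i < n \<Longrightarrow> (\<lambda>g. f g i) \<in> borel_measurable (gauss n)"
  shows "(\<integral>\<^sup>+g. ennreal (gexp n S (f g)) \<partial>gauss n) = ennreal (\<integral>g. gexp n S (f g) \<partial>gauss n)"
proof (rule nn_integral_eq_integral)
  show "integrable (gauss n) (\<lambda>g. gexp n S (f g))"
    by (rule gauss.integrable_const_bound[of _ 1]) auto
qed auto

text \<open>Conditioning on the core multiplies the Gaussian law by a density of at most 4/3,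
  harmless for a nonnegative integrand, and the extra smoothing only lowers the mean. Nonnegative
  integrals prepare for the mixture over \<open>t\<close>, where infinite values can occur.\<close>

lemma nn_gauss_average_comparison:
  fixes y :: "nat \<Rightarrow> nat \<Rightarrow> real"
  assumes "n \<ge> 1" "\<delta> > 0"
  defines "\<nu> \<equiv> uniform_measure (gauss n) (gauss_core n)"
  assumes le: "\<And>\<xi>. (\<Sum>j<N. cos (ip n \<xi> (y j))) * exp (- (\<sigma> * enorm n \<xi>)\<^sup>2 / 2)
      \<le> N * ((\<integral>x. cos (ip n \<xi> x) \<partial>\<nu>) * exp (- (\<sigma> * enorm n \<xi>)\<^sup>2 / 2)
              + \<delta> * exp (- (\<sigma> * enorm n \<xi>)\<^sup>2 / 4))"
  shows "(\<Sum>j<N. \<integral>\<^sup>+g. ennreal (gexp n S (\<lambda>i. y j i + \<sigma> * g i)) \<partial>gauss n)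
    \<le> ennreal N * (ennreal (4 / 3) * (\<integral>\<^sup>+g. ennreal (gexp n S g) \<partial>gauss n)
       + ennreal \<delta> * (\<integral>\<^sup>+g. ennreal (gexp n S (\<lambda>i. \<sigma> / sqrt 2 * g i)) \<partial>gauss n))"
proof -
  have core: "emeasure (gauss n) (gauss_core n) \<ge> ennreal (3 / 4)"
    using emeasure_gauss_core[OF assms(1)] .
  then have pos: "emeasure (gauss n) (gauss_core n) \<noteq> 0"
    by (auto simp: ennreal_eq_0_iff)
  have \<nu>: "prob_space \<nu>"
    unfolding \<nu>_def using pos by (intro prob_space_uniform_measure) auto
  interpret \<nu>: prob_space \<nu> by fact
  have [measurable_cong]: "sets \<nu> = sets (Pi\<^sub>M {..<n} (\<lambda>_. borel))"
    by (simp add: \<nu>_def sets_gauss)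
  have mcore: "measure (gauss n) (gauss_core n) \<ge> 3 / 4"
    using gauss_norm_bound[OF assms(1)] by (simp add: gauss_core_def)
  let ?q = "\<integral>g. gexp n S g \<partial>gauss n"
  define \<psi> where "\<psi> x = (\<integral>g. gexp n S (\<lambda>i. x i + \<sigma> * g i) \<partial>gauss n)" for x
  have \<psi>_le: "0 \<le> \<psi> x" "\<psi> x \<le> 1" for x
  proof -
    have "\<psi> x \<le> (\<integral>g. 1 \<partial>gauss n)" unfolding \<psi>_def
      by (rule integral_mono[OF gauss.integrable_const_bound[of _ 1]]) auto
    then show "\<psi> x \<le> 1" by (simp add: gauss.prob_space)
  qed (simp add: \<psi>_def)
  have \<psi>_m [measurable]: "\<psi> \<in> borel_measurable (gauss n)"
    unfolding \<psi>_def by measurable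
  then have \<psi>_\<nu> [measurable]: "\<psi> \<in> borel_measurable \<nu>"
    by (simp add: \<nu>_def)
  have int_\<psi>: "integrable \<nu> \<psi>" "integrable (gauss n) \<psi>"
    using \<psi>_le by (auto intro!: \<nu>.integrable_const_bound[of _ 1] gauss.integrable_const_bound[of _ 1])
  have "ennreal (\<integral>x. \<psi> x \<partial>\<nu>) = (\<integral>\<^sup>+x. ennreal (\<psi> x) \<partial>\<nu>)"
    using int_\<psi> \<psi>_le by (intro nn_integral_eq_integral[symmetric]) auto
  also have "\<dots> = (\<integral>\<^sup>+x. ennreal (\<psi> x) * indicator (gauss_core n) x \<partial>gauss n) / emeasure (gauss n) (gauss_core n)"
    unfolding \<nu>_def by (rule nn_integral_uniform_measure) auto
  also have "\<dots> \<le> ennreal ?q / emeasure (gauss n) (gauss_core n)"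
  proof (rule divide_right_mono_ennreal)
    have "(\<integral>\<^sup>+x. ennreal (\<psi> x) * indicator (gauss_core n) x \<partial>gauss n) \<le> (\<integral>\<^sup>+x. ennreal (\<psi> x) \<partial>gauss n)"
      by (intro nn_integral_mono) (auto simp: indicator_def)
    also have "\<dots> = ennreal (\<integral>x. \<psi> x \<partial>gauss n)"
      using int_\<psi> \<psi>_le by (intro nn_integral_eq_integral) auto
    also have "\<dots> \<le> ennreal ?q"
      unfolding \<psi>_def by (intro ennreal_leI gauss_smoothing_le)
    finally show "(\<integral>\<^sup>+x. ennreal (\<psi> x) * indicator (gauss_core n) x \<partial>gauss n) \<le> ennreal ?q" .
  qed
  also have "\<dots> = ennreal (?q / measure (gauss n) (gauss_core n))"
    unfolding gauss.emeasure_eq_measure using mcore by (intro divide_ennreal) auto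
  also have "\<dots> \<le> ennreal (4 / 3 * ?q)"
  proof (rule ennreal_leI)
    have "?q / measure (gauss n) (gauss_core n) \<le> ?q / (3 / 4)"
      using mcore by (intro divide_left_mono) auto
    then show "?q / measure (gauss n) (gauss_core n) \<le> 4 / 3 * ?q" by simp
  qed
  finally have A: "(\<integral>x. \<psi> x \<partial>\<nu>) \<le> 4 / 3 * ?q"
    by (subst (asm) ennreal_le_iff) auto
  have "(\<Sum>j<N. \<psi> (y j))
    \<le> N * ((\<integral>x. \<psi> x \<partial>\<nu>) + \<delta> * (\<integral>g. gexp n S (\<lambda>i. \<sigma> / sqrt 2 * g i) \<partial>gauss n))"
    unfolding \<psi>_def
    by (rule gauss_average_comparison[OF \<nu> _ le]) (simp add: \<nu>_def sets_gauss)
  also have "\<dots> \<le> N * (4 / 3 * (\<integral>g. gexp n S g \<partial>gauss n) + \<delta> * (\<integral>g. gexp n S (\<lambda>i. \<sigma> / sqrt 2 * g i) \<partial>gauss n))"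
    using A by (intro mult_left_mono) auto
  finally have "ennreal (\<Sum>j<N. \<psi> (y j)) \<le> ennreal \<dots>"
    by (rule ennreal_leI)
  moreover have "(\<Sum>j<N. \<integral>\<^sup>+g. ennreal (gexp n S (\<lambda>i. y j i + \<sigma> * g i)) \<partial>gauss n) = (\<Sum>j<N. ennreal (\<psi> (y j)))"
    unfolding \<psi>_def by (intro sum.cong refl nn_integral_gexp) measurable
  moreover have "(\<Sum>j<N. ennreal (\<psi> (y j))) = ennreal (\<Sum>j<N. \<psi> (y j))"
    using \<psi>_le by (intro sum_ennreal) auto
  moreover have "ennreal N * (ennreal (4 / 3) * (\<integral>\<^sup>+g. ennreal (gexp n S g) \<partial>gauss n)
       + ennreal \<delta> * (\<integral>\<^sup>+g. ennreal (gexp n S (\<lambda>i. \<sigma> / sqrt 2 * g i)) \<partial>gauss n))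
     = ennreal (N * (4 / 3 * (\<integral>g. gexp n S g \<partial>gauss n) + \<delta> * (\<integral>g. gexp n S (\<lambda>i. \<sigma> / sqrt 2 * g i) \<partial>gauss n)))"
  proof -
    have q: "(\<integral>\<^sup>+g. ennreal (gexp n S g) \<partial>gauss n) = ennreal ?q"
      "(\<integral>\<^sup>+g. ennreal (gexp n S (\<lambda>i. \<sigma> / sqrt 2 * g i)) \<partial>gauss n)
        = ennreal (\<integral>g. gexp n S (\<lambda>i. \<sigma> / sqrt 2 * g i) \<partial>gauss n)"
      by (rule nn_integral_gexp; measurable)+
    have "ennreal N * (ennreal (4 / 3) * ennreal a + ennreal \<delta> * ennreal b) = ennreal (N * (4 / 3 * a + \<delta> * b))"
      if "a \<ge> 0" "b \<ge> 0" for a b :: real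
      using that \<open>\<delta> > 0\<close> by (simp flip: ennreal_mult ennreal_plus)
    then show ?thesis unfolding q by simp
  qed
  ultimately show ?thesis by simp
qed

text \<open>The power \<open>u\<^sup>-\<^sup>k\<close> with value \<open>\<infinity>\<close> at \<open>0\<close>, where real division would give \<open>0\<close>.\<close>

definition rpow :: "nat \<Rightarrow> real \<Rightarrow> ennreal" where
  "rpow k u = (if u = 0 then \<infinity> else ennreal (1 / u ^ k))"

lemma borel_measurable_rpow [measurable]: "rpow k \<in> borel_measurable borel"
  unfolding rpow_def by measurable

lemma rpow_scale: "c > 0 \<Longrightarrow> rpow k (c * u) = ennreal (1 / c ^ k) * rpow k u"
  by (auto simp: rpow_def power_mult_distrib ennreal_mult_top simp flip: ennreal_mult')

definition rker :: "nat \<Rightarrow> real \<Rightarrow> ennreal" where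
  "rker k t = ennreal (t ^ (k - 1)) * indicator {0<..} t"

text \<open>For k \<ge> 1 this is 2^(k/2 - 1) Gamma (k/2). Its value never enters: it occurs on both
  sides of the comparison and is cancelled, being finite and nonzero.\<close>

definition rconst :: "nat \<Rightarrow> ennreal" where
  "rconst k = (\<integral>\<^sup>+t. rker k t * ennreal (exp (- t\<^sup>2 / 2)) \<partial>lborel)"

lemma borel_measurable_rker [measurable]: "rker k \<in> borel_measurable borel"
  unfolding rker_def by measurable

lemma rconst_finite: "rconst k \<noteq> \<infinity>"
proof -
  have "integrable lborel (\<lambda>x. std_normal_density x * x ^ (k - 1))"
    using integrable_normal_moment[of 1 0 "k - 1"] by simp
  then have "(\<integral>\<^sup>+x. ennreal (norm (std_normal_density x * x ^ (k - 1))) \<partial>lborel) < \<infinity>"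
    by (simp add: integrable_iff_bounded)
  then have "ennreal (sqrt (2 * pi)) * (\<integral>\<^sup>+x. ennreal (norm (std_normal_density x * x ^ (k - 1))) \<partial>lborel) < \<infinity>"
    by (simp add: ennreal_mult_less_top)
  moreover have "rconst k \<le> ennreal (sqrt (2 * pi)) * (\<integral>\<^sup>+x. ennreal (norm (std_normal_density x * x ^ (k - 1))) \<partial>lborel)"
    unfolding rconst_def
  proof (subst nn_integral_cmult[symmetric], simp, rule nn_integral_mono)
    fix x :: real
    show "rker k x * ennreal (exp (- x\<^sup>2 / 2)) \<le> ennreal (sqrt (2 * pi)) * ennreal (norm (std_normal_density x * x ^ (k - 1)))"
      by (auto simp: rker_def std_normal_density_def abs_mult indicator_def mult_ac simp flip: ennreal_mult')
  qed
  ultimately show ?thesis by auto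
qed

lemma rconst_nonzero: "rconst k \<noteq> 0"
proof -
  have "ennreal (exp (- 2)) = (\<integral>\<^sup>+t. ennreal (exp (- 2)) * indicator {1..2::real} t \<partial>lborel)"
    by (simp add: nn_integral_cmult_indicator)
  also have "\<dots> \<le> rconst k"
    unfolding rconst_def
  proof (rule nn_integral_mono)
    fix t :: real
    show "ennreal (exp (- 2)) * indicator {1..2} t \<le> rker k t * ennreal (exp (- t\<^sup>2 / 2))"
    proof (cases "t \<in> {1..2}")
      case True
      then have "1 \<le> t ^ (k - 1)" "t\<^sup>2 \<le> 2\<^sup>2" using power_mono[of t 2 2] by auto
      then have "1 * exp (- 2) \<le> t ^ (k - 1) * exp (- t\<^sup>2 / 2)"
        by (intro mult_mono) auto
      then show ?thesis using True by (simp add: rker_def flip: ennreal_mult')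
    qed auto
  qed
  finally show ?thesis by (auto simp: ennreal_eq_0_iff)
qed

lemma emeasure_lborel_atLeast: "emeasure lborel {a::real..} = \<infinity>"
proof (rule ccontr)
  assume "emeasure lborel {a..} \<noteq> \<infinity>"
  then obtain r where r: "emeasure lborel {a..} = ennreal r" "r \<ge> 0"
    by (cases "emeasure lborel {a..}") auto
  have "ennreal (r + 1) = emeasure lborel {a..a + (r + 1)}"
    using r(2) by simp
  also have "\<dots> \<le> emeasure lborel {a..}"
    by (intro emeasure_mono) auto
  finally show False using r by simp
qed

text \<open>Replacing \<open>t\<close> by \<open>u * t\<close> brings out the factor u^k. At
  \<open>u = 0\<close> the exponential is constant and the kernel is at least 1 on the half-line
  from 1, so the integral diverges in accordance with the convention for
  \<open>rpow\<close>.\<close>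

lemma rpow_mixture:
  assumes "u \<ge> 0" "k \<ge> 1"
  shows "(\<integral>\<^sup>+t. rker k t * ennreal (exp (- (t * u)\<^sup>2 / 2)) \<partial>lborel) = rconst k * rpow k u"
proof (cases "u = 0")
  case True
  have "\<infinity> = (\<integral>\<^sup>+t. indicator {1..} (t::real) \<partial>lborel)"
    by (simp add: emeasure_lborel_atLeast)
  also have "\<dots> \<le> (\<integral>\<^sup>+t. rker k t * ennreal (exp (- (t * u)\<^sup>2 / 2)) \<partial>lborel)"
    using True by (intro nn_integral_mono) (auto simp: rker_def indicator_def one_le_power)
  finally show ?thesis
    using True rconst_nonzero[of k] by (simp add: rpow_def top_unique ennreal_mult_top)
next
  case False
  then have "u > 0" using assms by simp
  have "rconst k = ennreal u * (\<integral>\<^sup>+t. rker k (u * t) * ennreal (exp (- (u * t)\<^sup>2 / 2)) \<partial>lborel)"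
    unfolding rconst_def using \<open>u > 0\<close> by (subst nn_integral_real_affine[of _ u 0]) auto
  also have "\<dots> = (\<integral>\<^sup>+t. ennreal u * (rker k (u * t) * ennreal (exp (- (u * t)\<^sup>2 / 2))) \<partial>lborel)"
    by (rule nn_integral_cmult[symmetric]) simp
  also have "\<dots> = (\<integral>\<^sup>+t. ennreal (u * u ^ (k - 1)) * (rker k t * ennreal (exp (- (t * u)\<^sup>2 / 2))) \<partial>lborel)"
    using \<open>u > 0\<close> by (intro nn_integral_cong)
      (auto simp: rker_def indicator_def zero_less_mult_iff power_mult_distrib ennreal_mult mult_ac)
  also have "u * u ^ (k - 1) = u ^ k"
    using \<open>k \<ge> 1\<close> by (cases k) auto
  also have "(\<integral>\<^sup>+t. ennreal (u ^ k) * (rker k t * ennreal (exp (- (t * u)\<^sup>2 / 2))) \<partial>lborel)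
      = ennreal (u ^ k) * (\<integral>\<^sup>+t. rker k t * ennreal (exp (- (t * u)\<^sup>2 / 2)) \<partial>lborel)"
    by (rule nn_integral_cmult) simp
  finally have "rconst k * ennreal (1 / u ^ k)
      = ennreal (1 / u ^ k) * (ennreal (u ^ k) * (\<integral>\<^sup>+t. rker k t * ennreal (exp (- (t * u)\<^sup>2 / 2)) \<partial>lborel))"
    by (simp add: mult.commute)
  also have "\<dots> = (\<integral>\<^sup>+t. rker k t * ennreal (exp (- (t * u)\<^sup>2 / 2)) \<partial>lborel)"
    using \<open>u > 0\<close> by (simp add: mult.assoc[symmetric] flip: ennreal_mult')
  finally show ?thesis
    using \<open>u > 0\<close> by (simp add: rpow_def)
qed

lemma linear_map_scale_matrix: "linear_map n (\<lambda>i j. t * T i j) x = (\<lambda>i. t * linear_map n T x i)"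
  by (auto simp: linear_map_def sum_distrib_left mult_ac fun_eq_iff)

lemma gexp_scale_matrix:
  "gexp n (\<lambda>i j. t * T i j) x = exp (- (t * enorm n (linear_map n T x))\<^sup>2 / 2)"
  by (simp add: linear_map_scale_matrix enorm_scale power_mult_distrib)

lemma nn_gauss_rpow_mixture:
  assumes [measurable]: "\<And>i. i < n \<Longrightarrow> (\<lambda>g. f g i) \<in> borel_measurable (gauss n)" and "k \<ge> 1"
  shows "(\<integral>\<^sup>+t. rker k t * (\<integral>\<^sup>+g. ennreal (gexp n (\<lambda>i j. t * T i j) (f g)) \<partial>gauss n) \<partial>lborel)
    = rconst k * (\<integral>\<^sup>+g. rpow k (enorm n (linear_map n T (f g))) \<partial>gauss n)"
proof -
  interpret P: pair_sigma_finite "gauss n" "lborel :: real measure"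
    by (intro pair_sigma_finite.intro prob_space_imp_sigma_finite prob_space_gauss sigma_finite_lborel)
  let ?u = "\<lambda>g. enorm n (linear_map n T (f g))"
  have "(\<integral>\<^sup>+t. rker k t * (\<integral>\<^sup>+g. ennreal (gexp n (\<lambda>i j. t * T i j) (f g)) \<partial>gauss n) \<partial>lborel)
      = (\<integral>\<^sup>+t. (\<integral>\<^sup>+g. rker k t * ennreal (exp (- (t * ?u g)\<^sup>2 / 2)) \<partial>gauss n) \<partial>lborel)"
    unfolding gexp_scale_matrix by (intro nn_integral_cong nn_integral_cmult[symmetric]) measurable
  also have "\<dots> = (\<integral>\<^sup>+g. (\<integral>\<^sup>+t. rker k t * ennreal (exp (- (t * ?u g)\<^sup>2 / 2)) \<partial>lborel) \<partial>gauss n)"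
    by (rule P.Fubini') measurable
  also have "\<dots> = (\<integral>\<^sup>+g. rconst k * rpow k (?u g) \<partial>gauss n)"
    by (simp only: rpow_mixture[OF L2_set_nonneg \<open>k \<ge> 1\<close>])
  also have "\<dots> = rconst k * (\<integral>\<^sup>+g. rpow k (?u g) \<partial>gauss n)"
    by (rule nn_integral_cmult) measurable
  finally show ?thesis .
qed

text \<open>The exponential comparison holds for every matrix, in particular for
  \<open>t * T\<close> with any \<open>t\<close>, and integration against the positive kernel
  preserves it. This turns Gaussians into inverse powers for all \<open>T\<close> at once.\<close>

lemma rpow_average_comparison:
  fixes y :: "nat \<Rightarrow> nat \<Rightarrow> real"
  assumes "n \<ge> 1" "k \<ge> 1" "\<sigma> > 0"
  defines "\<nu> \<equiv> uniform_measure (gauss n) (gauss_core n)"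
  assumes le: "\<And>\<xi>. (\<Sum>j<N. cos (ip n \<xi> (y j))) * exp (- (\<sigma> * enorm n \<xi>)\<^sup>2 / 2)
      \<le> N * ((\<integral>x. cos (ip n \<xi> x) \<partial>\<nu>) * exp (- (\<sigma> * enorm n \<xi>)\<^sup>2 / 2)
              + (\<sigma> / sqrt 2) ^ k * exp (- (\<sigma> * enorm n \<xi>)\<^sup>2 / 4))"
  shows "(\<Sum>j<N. \<integral>\<^sup>+g. rpow k (enorm n (linear_map n T (\<lambda>i. y j i + \<sigma> * g i))) \<partial>gauss n)
    \<le> ennreal (3 * real N) * (\<integral>\<^sup>+g. rpow k (enorm n (linear_map n T g)) \<partial>gauss n)"
proof -
  define \<delta> where "\<delta> = (\<sigma> / sqrt 2) ^ k"
  have \<sigma>2: "\<sigma> / sqrt 2 > 0" using \<open>\<sigma> > 0\<close> by simp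
  have "\<delta> > 0" using \<open>\<sigma> > 0\<close> by (simp add: \<delta>_def)
  let ?R = "\<lambda>f. \<integral>\<^sup>+g. rpow k (enorm n (linear_map n T (f g))) \<partial>gauss n"
  let ?G = "\<lambda>f t. \<integral>\<^sup>+g. ennreal (gexp n (\<lambda>i j. t * T i j) (f g)) \<partial>gauss n"
  have mG: "?G f \<in> borel_measurable borel" if [measurable]: "\<And>i. i < n \<Longrightarrow> (\<lambda>g. f g i) \<in> borel_measurable (gauss n)" for f
    unfolding gexp_scale_matrix by measurable
  let ?y = "\<lambda>j g i. y j i + \<sigma> * g i" and ?s = "\<lambda>g i. \<sigma> / sqrt 2 * g i"
  have m: "?G (?y j) \<in> borel_measurable borel" "?G ?s \<in> borel_measurable borel" "?G (\<lambda>g. g) \<in> borel_measurable borel" for j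
    by (rule mG; measurable)+
  note m [measurable]
  have c: "ennreal (4 / 3 * N) = ennreal (4 / 3) * ennreal N" "ennreal (\<delta> * N) = ennreal \<delta> * ennreal N"
    using \<open>\<delta> > 0\<close> by (simp_all flip: ennreal_mult)
  have "rconst k * (\<Sum>j<N. ?R (?y j)) = (\<Sum>j<N. \<integral>\<^sup>+t. rker k t * ?G (?y j) t \<partial>lborel)"
    unfolding sum_distrib_left
    by (intro sum.cong refl nn_gauss_rpow_mixture[symmetric] \<open>k \<ge> 1\<close>) measurable
  also have "\<dots> = (\<integral>\<^sup>+t. rker k t * (\<Sum>j<N. ?G (?y j) t) \<partial>lborel)"
    unfolding sum_distrib_left by (rule nn_integral_sum[symmetric]) measurable
  also have "\<dots> \<le> (\<integral>\<^sup>+t. rker k t * (ennreal N * (ennreal (4 / 3) * ?G (\<lambda>g. g) t + ennreal \<delta> * ?G ?s t)) \<partial>lborel)"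
    using nn_gauss_average_comparison[OF \<open>n \<ge> 1\<close> \<open>\<delta> > 0\<close>] le
    unfolding \<nu>_def \<delta>_def by (intro nn_integral_mono mult_left_mono) auto
  also have "\<dots> = (\<integral>\<^sup>+t. ennreal (4 / 3 * N) * (rker k t * ?G (\<lambda>g. g) t) + ennreal (\<delta> * N) * (rker k t * ?G ?s t) \<partial>lborel)"
    unfolding c by (intro nn_integral_cong) (simp only: algebra_simps)
  also have "\<dots> = ennreal (4 / 3 * N) * (\<integral>\<^sup>+t. rker k t * ?G (\<lambda>g. g) t \<partial>lborel)
      + ennreal (\<delta> * N) * (\<integral>\<^sup>+t. rker k t * ?G ?s t \<partial>lborel)"
    by (subst nn_integral_add, (measurable)[2]) (subst nn_integral_cmult, measurable)+
  also have "\<dots> = ennreal (4 / 3 * N) * (rconst k * ?R (\<lambda>g. g)) + ennreal (\<delta> * N) * (rconst k * ?R ?s)"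
    by (subst (1 2) nn_gauss_rpow_mixture[OF _ \<open>k \<ge> 1\<close>]) auto
  \<comment> \<open>Homogeneity of degree -k: shrinking by \<sigma> / sqrt 2 costs exactly
    1/\<delta>, which cancels the \<delta> in front. The error term becomes one Gaussian mean, and
    4/3 + 1 = 7/3 is below 3.\<close>
  also have "?R ?s = (\<integral>\<^sup>+g. ennreal (1 / \<delta>) * rpow k (enorm n (linear_map n T g)) \<partial>gauss n)"
  proof (rule nn_integral_cong)
    fix g
    show "rpow k (enorm n (linear_map n T (?s g))) = ennreal (1 / \<delta>) * rpow k (enorm n (linear_map n T g))"
      unfolding linear_map_scale enorm_scale \<delta>_def
      by (simp only: abs_of_pos[OF \<sigma>2] rpow_scale[OF \<sigma>2])
  qed
  also have "\<dots> = ennreal (1 / \<delta>) * ?R (\<lambda>g. g)"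
    by (rule nn_integral_cmult) measurable
  also have "ennreal (4 / 3 * N) * (rconst k * ?R (\<lambda>g. g)) + ennreal (\<delta> * N) * (rconst k * (ennreal (1 / \<delta>) * ?R (\<lambda>g. g)))
      = (ennreal (4 / 3 * N) + ennreal (\<delta> * N) * ennreal (1 / \<delta>)) * (rconst k * ?R (\<lambda>g. g))"
    by (simp add: algebra_simps)
  also have "ennreal (4 / 3 * N) + ennreal (\<delta> * N) * ennreal (1 / \<delta>) = ennreal (7 / 3 * N)"
    using \<open>\<delta> > 0\<close> by (simp flip: ennreal_mult' ennreal_plus)
  also have "ennreal (7 / 3 * N) * (rconst k * ?R (\<lambda>g. g)) \<le> ennreal (3 * real N) * (rconst k * ?R (\<lambda>g. g))"
    by (intro mult_right_mono ennreal_leI) auto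
  finally have "rconst k * (\<Sum>j<N. ?R (?y j)) \<le> rconst k * (ennreal (3 * real N) * ?R (\<lambda>g. g))"
    by (simp add: mult_ac)
  then show ?thesis
    using rconst_nonzero[of k] rconst_finite[of k] by (simp add: ennreal_mult_le_mult_iff)
qed

subsection \<open>Gaussian integrals and level sets\<close>

lemma ennreal_le_suminf: "f l \<le> (\<Sum>l. f l)" for f :: "nat \<Rightarrow> ennreal"
  using sum_le_suminf[of f "{l}"] by simp

text \<open>If 2^l b is the largest such level strictly below a finite \<open>x\<close> exceeding
  \<open>b\<close>, the layer \<open>l\<close> alone contributes twice that level, which is at least
  \<open>x\<close>. For infinite \<open>x\<close> every layer counts and the sum diverges.\<close>

lemma ennreal_le_dyadic_layers:
  assumes "b > 0"
  shows "x \<le> ennreal b + (\<Sum>l. ennreal (2 ^ (l + 1) * b) * indicator {y. ennreal (2 ^ l * b) < y} x)"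
    (is "_ \<le> _ + (\<Sum>l. ?f l)")
proof (cases "x \<le> ennreal b")
  case True
  then show ?thesis by (simp add: add_increasing2)
next
  case False
  have trm: "ennreal (2 ^ (l + 1) * b) \<le> (\<Sum>l. ?f l)" if "ennreal (2 ^ l * b) < x" for l
  proof -
    have "?f l \<le> (\<Sum>l. ?f l)"
      by (rule ennreal_le_suminf)
    then show ?thesis using that by simp
  qed
  show ?thesis
  proof (cases x)
    case (real r)
    then have "b < r" using False \<open>b > 0\<close> by (simp add: not_le)
    obtain m :: nat where "r / b < 2 ^ m"
      using real_arch_pow[of 2 "r / b"] by auto
    then have ex: "\<exists>m::nat. r \<le> 2 ^ m * b"
      using \<open>b > 0\<close> by (intro exI[of _ m]) (simp add: field_simps)
    define m where "m = (LEAST m::nat. r \<le> 2 ^ m * b)"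
    have m: "r \<le> 2 ^ m * b" unfolding m_def using ex by (rule LeastI_ex)
    then have "m \<noteq> 0" using \<open>b < r\<close> by (cases m) auto
    then obtain l where l: "m = l + 1" by (metis add.commute not0_implies_Suc plus_1_eq_Suc)
    then have "\<not> r \<le> 2 ^ l * b"
      using not_less_Least[of l "\<lambda>m. r \<le> 2 ^ m * b"] unfolding m_def by simp
    then have "ennreal (2 ^ l * b) < x"
      using real \<open>b > 0\<close> by (simp add: ennreal_less_iff)
    then have "ennreal (2 ^ (l + 1) * b) \<le> (\<Sum>l. ?f l)" by (rule trm)
    moreover have "x \<le> ennreal (2 ^ (l + 1) * b)"
      using m real l by (simp add: ennreal_leI)
    ultimately show ?thesis by (simp add: add_increasing)
  next
    case top
    have *: "ennreal r \<le> (\<Sum>l. ?f l)" if "r \<ge> 0" for r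
    proof -
      obtain l :: nat where "r / b < 2 ^ l"
        using real_arch_pow[of 2 "r / b"] by auto
      then have "r \<le> 2 ^ l * b" using \<open>b > 0\<close> by (simp add: field_simps)
      also have "\<dots> \<le> 2 ^ (l + 1) * b" using \<open>b > 0\<close> by simp
      finally have "ennreal r \<le> ennreal (2 ^ (l + 1) * b)" by (rule ennreal_leI)
      also have "\<dots> \<le> (\<Sum>l. ?f l)" using top by (intro trm) simp
      finally show ?thesis .
    qed
    have "(\<Sum>l. ?f l) = \<infinity>"
    proof (cases "\<Sum>l. ?f l")
      case (real r)
      then have "ennreal (r + 1) \<le> ennreal r" using *[of "r + 1"] by simp
      then show ?thesis using real by simp
    qed simp
    then show ?thesis by simp
  qed
qed

lemma sets_lebn: "sets (lebn n) = sets (gauss n)"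
  unfolding sets_gauss by (intro sets_PiM_cong) auto

lemma emeasure_gauss_le_lebn:
  assumes [measurable]: "A \<in> sets (lebn n)"
  shows "emeasure (gauss n) A \<le> ennreal ((1 / sqrt (2 * pi)) ^ n) * emeasure (lebn n) A"
proof -
  have "emeasure (gauss n) A
      = (\<integral>\<^sup>+x. ennreal ((1 / sqrt (2 * pi)) ^ n * exp (- (enorm n x)\<^sup>2 / 2)) * indicator A x \<partial>lebn n)"
    unfolding gauss_density by (rule emeasure_density) measurable
  also have "\<dots> \<le> (\<integral>\<^sup>+x. ennreal ((1 / sqrt (2 * pi)) ^ n) * indicator A x \<partial>lebn n)"
    by (intro nn_integral_mono mult_right_mono ennreal_leI) (auto simp: mult_left_le divide_le_eq)
  also have "\<dots> = ennreal ((1 / sqrt (2 * pi)) ^ n) * emeasure (lebn n) A"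
    by (rule nn_integral_cmult_indicator) simp
  finally show ?thesis .
qed

text \<open>Volume scaling makes the Gaussian mass of the level set at height 2^l b at most 2^(- l n
  / k), hence at most 4^(-l) because 2 k \<le> n. Against heights 2^(l+1) b this sums to 4 b, and
  the part below \<open>b\<close> adds one more \<open>b\<close>.\<close>

lemma gauss_integral_le_of_level_sets:
  assumes [measurable]: "F \<in> borel_measurable (gauss n)" and k: "k \<ge> 1" "2 * k \<le> n" and "\<beta> > 0"
    and level: "\<And>t. t > 0 \<Longrightarrow>
      emeasure (lebn n) {x \<in> space (lebn n). F x > ennreal (t ^ k)} \<le> ennreal ((2 / t) ^ n) * V"
    and V: "V \<le> ennreal (\<beta> ^ n)"
  shows "(\<integral>\<^sup>+x. F x \<partial>gauss n) \<le> ennreal (5 * \<beta> ^ k)"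
proof -
  have [measurable]: "F \<in> borel_measurable (lebn n)"
    using assms(1) by (simp add: measurable_cong_sets[OF sets_lebn refl])
  define b where "b = \<beta> ^ k"
  have "b > 0" using \<open>\<beta> > 0\<close> by (simp add: b_def)
  have lev: "emeasure (gauss n) {x \<in> space (gauss n). F x > ennreal (2 ^ l * b)} \<le> ennreal ((1 / 4) ^ l)" for l
  proof -
    define t where "t = root k (2 ^ l) * \<beta>"
    have "t > 0" using k \<open>\<beta> > 0\<close> by (simp add: t_def)
    have tk: "t ^ k = 2 ^ l * b" using k by (simp add: t_def b_def power_mult_distrib)
    have r1: "root k (2 ^ l) \<ge> 1" using k by simp
    have "(4::real) ^ l = (2 ^ l)\<^sup>2"
      by (simp add: power2_eq_square flip: power_mult_distrib)
    also have "\<dots> = (root k (2 ^ l)) ^ (2 * k)"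
      using k by (simp add: power_mult mult.commute[of 2])
    also have "\<dots> \<le> (root k (2 ^ l)) ^ n" using k r1 by (intro power_increasing) auto
    finally have r4: "4 ^ l \<le> (root k (2 ^ l)) ^ n" .
    \<comment> \<open>The Gaussian density bound beats the factor 2 that comes with the level
      sets.\<close>
    have pi1: "2 / sqrt (2 * pi) \<le> 1"
      using pi_gt3 by (simp add: real_le_rsqrt)
    have "emeasure (gauss n) {x \<in> space (gauss n). F x > ennreal (2 ^ l * b)}
        \<le> ennreal ((1 / sqrt (2 * pi)) ^ n) * emeasure (lebn n) {x \<in> space (lebn n). F x > ennreal (t ^ k)}"
      unfolding tk space_gauss by (rule emeasure_gauss_le_lebn) measurable
    also have "\<dots> \<le> ennreal ((1 / sqrt (2 * pi)) ^ n) * (ennreal ((2 / t) ^ n) * ennreal (\<beta> ^ n))"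
      using level[OF \<open>t > 0\<close>] V by (intro mult_left_mono order_trans[OF level[OF \<open>t > 0\<close>]]) auto
    also have "\<dots> = ennreal ((1 / sqrt (2 * pi)) ^ n * ((2 / t) ^ n * \<beta> ^ n))"
      using \<open>t > 0\<close> \<open>\<beta> > 0\<close> by (simp add: ennreal_mult)
    also have "\<dots> \<le> ennreal ((1 / 4) ^ l)"
    proof (rule ennreal_leI)
      have "(1 / sqrt (2 * pi)) ^ n * ((2 / t) ^ n * \<beta> ^ n) = (2 / sqrt (2 * pi)) ^ n / (root k (2 ^ l)) ^ n"
        using \<open>\<beta> > 0\<close> k by (simp add: t_def power_divide power_mult_distrib)
      also have "\<dots> \<le> 1 / 4 ^ l"
        using pi1 r4 by (intro frac_le power_le_one) auto
      finally show "(1 / sqrt (2 * pi)) ^ n * ((2 / t) ^ n * \<beta> ^ n) \<le> (1 / 4) ^ l"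
        by (simp add: power_divide)
    qed
    finally show ?thesis .
  qed
  have "(\<integral>\<^sup>+x. F x \<partial>gauss n)
      \<le> (\<integral>\<^sup>+x. ennreal b + (\<Sum>l. ennreal (2 ^ (l + 1) * b) * indicator {y. ennreal (2 ^ l * b) < y} (F x)) \<partial>gauss n)"
    by (intro nn_integral_mono ennreal_le_dyadic_layers \<open>b > 0\<close>)
  also have "\<dots> = ennreal b + (\<Sum>l. \<integral>\<^sup>+x. ennreal (2 ^ (l + 1) * b) * indicator {y. ennreal (2 ^ l * b) < y} (F x) \<partial>gauss n)"
    by (subst nn_integral_add; (subst nn_integral_suminf)?; (measurable)?) (simp add: gauss.emeasure_space_1)
  also have "\<dots> \<le> ennreal b + (\<Sum>l. ennreal (2 * b * (1 / 2) ^ l))"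
  proof (intro add_left_mono suminf_le)
    fix l
    have "(\<integral>\<^sup>+x. ennreal (2 ^ (l + 1) * b) * indicator {y. ennreal (2 ^ l * b) < y} (F x) \<partial>gauss n)
      = (\<integral>\<^sup>+x. ennreal (2 ^ (l + 1) * b) * indicator {x \<in> space (gauss n). F x > ennreal (2 ^ l * b)} x \<partial>gauss n)"
      by (intro nn_integral_cong) (auto simp: indicator_def)
    also have "\<dots> = ennreal (2 ^ (l + 1) * b) * emeasure (gauss n) {x \<in> space (gauss n). F x > ennreal (2 ^ l * b)}"
      by (rule nn_integral_cmult_indicator) measurable
    also have "\<dots> \<le> ennreal (2 ^ (l + 1) * b) * ennreal ((1 / 4) ^ l)"
      by (intro mult_left_mono lev) auto
    also have "\<dots> = ennreal (2 ^ (l + 1) * b * (1 / 4) ^ l)"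
      using \<open>b > 0\<close> by (simp add: ennreal_mult)
    also have "2 ^ (l + 1) * b * (1 / 4) ^ l = 2 * b * (1 / 2) ^ l"
      by (simp flip: power_mult_distrib)
    finally show "(\<integral>\<^sup>+x. ennreal (2 ^ (l + 1) * b) * indicator {y. ennreal (2 ^ l * b) < y} (F x) \<partial>gauss n)
      \<le> ennreal (2 * b * (1 / 2) ^ l)" .
  qed auto
  also have "(\<Sum>l. ennreal (2 * b * (1 / 2) ^ l)) = ennreal (\<Sum>l. 2 * b * (1 / 2) ^ l)"
    using \<open>b > 0\<close> by (intro suminf_ennreal2) (auto intro!: summable_mult summable_geometric)
  also have "(\<Sum>l. 2 * b * (1 / 2) ^ l) = 4 * b"
    by (subst suminf_mult) (auto simp: suminf_geometric)
  also have "ennreal b + ennreal (4 * b) = ennreal (5 * b)"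
    using \<open>b > 0\<close> by (simp flip: ennreal_plus)
  finally show ?thesis by (simp add: b_def)
qed

subsection \<open>Radial functions of sums of ellipsoids\<close>

text \<open>This identifies the topology of the sphere with the subspace topology inside the
  function type, so that the type-class theory of continuity and compactness applies although the
  dimension is a variable.\<close>

lemma nsphere_eq_top_of_set: "nsphere m = top_of_set (topspace (nsphere m))"
  by (simp add: nsphere euclidean_product_topology)

lemma continuous_map_nsphere_iff:
  "continuous_map (nsphere m) euclideanreal f \<longleftrightarrow> continuous_on (topspace (nsphere m)) f"
  by (subst nsphere_eq_top_of_set) simp

lemma continuous_on_coordinate [continuous_intros]:
  "continuous_on S (\<lambda>x::'a \<Rightarrow> 'b::topological_space. x i)"
  by (rule continuous_on_subset[OF continuous_on_product_coordinates]) simp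

lemma continuous_on_enorm [continuous_intros]:
  assumes "\<And>i. continuous_on S (\<lambda>x. f x i)"
  shows "continuous_on S (\<lambda>x. enorm n (f x))"
  unfolding L2_set_def by (intro continuous_intros assms)

lemma continuous_on_ip [continuous_intros]:
  assumes "\<And>i. continuous_on S (\<lambda>x. f x i)"
  shows "continuous_on S (\<lambda>x. ip n (f x) \<theta>)"
  unfolding ip_def by (intro continuous_intros assms)

lemma continuous_on_linear_map [continuous_intros]:
  assumes "\<And>i. continuous_on S (\<lambda>x. f x i)"
  shows "continuous_on S (\<lambda>x. linear_map n A (f x) i)"
  unfolding linear_map_def by (cases "i < n") (auto intro!: continuous_intros assms)

lemma closed_space_Rn: "closed (space_Rn n)"
proof -
  have "space_Rn n = (\<Inter>i\<in>{n..}. {x. x i = 0})" by (auto simp: topspace_Euclidean_space)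
  also have "closed \<dots>" by (intro closed_INT ballI closed_Collect_eq continuous_intros)
  finally show ?thesis .
qed

lemma abs_coordinate_le_enorm: "i < n \<Longrightarrow> \<bar>x i\<bar> \<le> enorm n x"
proof -
  assume "i < n"
  then have "(x i)\<^sup>2 \<le> (enorm n x)\<^sup>2"
    unfolding enorm_sq by (intro member_le_sum) auto
  then show ?thesis by (simp flip: abs_le_square_iff)
qed

text \<open>By Tychonoff, the product of intervals in the first \<open>n\<close> coordinates and of
  {0} in all others is compact, and \<open>S\<close> is a closed subset of it.\<close>

lemma compact_of_closed_enorm_bounded:
  assumes "closed S" "S \<subseteq> space_Rn n" "\<And>x. x \<in> S \<Longrightarrow> enorm n x \<le> R"
  shows "compact S"
proof -
  let ?B = "Pi\<^sub>E UNIV (\<lambda>i::nat. if i < n then {-R..R} else {0})"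
  have "compactin (product_topology (\<lambda>_::nat. euclideanreal) UNIV) ?B"
    unfolding compactin_PiE by auto
  then have "compact ?B"
    by (simp add: euclidean_product_topology)
  moreover have "S \<subseteq> ?B"
  proof
    fix x assume "x \<in> S"
    then have "x i = 0" if "i \<ge> n" for i using assms(2) that by (auto simp: topspace_Euclidean_space)
    moreover have "x i \<in> {-R..R}" if "i < n" for i
      using abs_coordinate_le_enorm[OF that, of x] assms(3)[OF \<open>x \<in> S\<close>] by (auto simp: abs_le_iff)
    ultimately show "x \<in> ?B" by auto
  qed
  ultimately show ?thesis
    using assms(1) compact_Int_closed[of ?B S] by (simp add: Int_absorb1)
qed

lemma unit_sphere_nonempty: "n \<ge> 1 \<Longrightarrow> unit_sphere n \<noteq> {}"
proof -
  assume "n \<ge> 1"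
  have "(\<lambda>i. if i = 0 then 1 else 0) \<in> unit_sphere n"
    unfolding unit_sphere_iff[OF \<open>n \<ge> 1\<close>] using \<open>n \<ge> 1\<close>
    by (auto simp: topspace_Euclidean_space L2_set_def if_distrib[of "\<lambda>x. x\<^sup>2"] cong: if_cong)
  then show ?thesis by blast
qed

lemma compact_unit_sphere:
  assumes "n \<ge> 1"
  shows "compact (unit_sphere n)"
proof (rule compact_of_closed_enorm_bounded[of _ n 1])
  have "unit_sphere n = space_Rn n \<inter> {v. enorm n v = 1}"
    using unit_sphere_iff[OF assms] by auto
  also have "closed \<dots>"
    by (intro closed_Int closed_space_Rn closed_Collect_eq continuous_intros)
  finally show "closed (unit_sphere n)" .
qed (use unit_sphere_iff[OF assms] in auto)

lemma normalize_in_unit_sphere: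
  assumes "n \<ge> 1" "x \<in> space_Rn n" "x \<noteq> (\<lambda>_. 0)"
  shows "enorm n x > 0" "(\<lambda>i. x i / enorm n x) \<in> unit_sphere n"
proof -
  have "enorm n x \<noteq> 0"
  proof
    assume "enorm n x = 0"
    then have "x i = 0" if "i < n" for i
      using abs_coordinate_le_enorm[OF that, of x] by simp
    moreover have "x i = 0" if "\<not> i < n" for i
      using assms(2) that by (auto simp: topspace_Euclidean_space)
    ultimately have "x i = 0" for i by (cases "i < n")
    then show False using assms(3) by blast
  qed
  then show *: "enorm n x > 0" by (simp add: order_le_neq_trans)
  have "enorm n (\<lambda>i. (1 / enorm n x) * x i) = 1"
    unfolding enorm_scale using * by simp
  then have "enorm n (\<lambda>i. x i / enorm n x) = 1" by simp
  moreover have "(\<lambda>i. x i / enorm n x) \<in> space_Rn n"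
    using assms(2) by (auto simp: topspace_Euclidean_space)
  ultimately show "(\<lambda>i. x i / enorm n x) \<in> unit_sphere n"
    using unit_sphere_iff[OF assms(1)] by blast
qed

text \<open>\<open>B\<close> is the inverse matrix, its columns being the preimages of the unit
  vectors. Only A B = id is computed; injectivity of \<open>A\<close> supplies the other
  direction.\<close>

lemma symmetric_ellipsoid_eq:
  assumes "symmetric_ellipsoid n E"
  obtains B where "E = {y \<in> space_Rn n. enorm n (linear_map n B y) \<le> 1}"
    "\<And>y. y \<in> space_Rn n \<Longrightarrow> linear_map n B y = (\<lambda>_. 0) \<Longrightarrow> y = (\<lambda>_. 0)"
proof -
  obtain A where bij: "bij_betw (linear_map n A) (space_Rn n) (space_Rn n)"
    and E: "E = linear_map n A ` {x \<in> space_Rn n. enorm n x \<le> 1}"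
    using assms unfolding symmetric_ellipsoid_def by blast
  define e :: "nat \<Rightarrow> nat \<Rightarrow> real" where "e j = (\<lambda>i. if i = j then 1 else 0)" for j
  define h where "h j = inv_into (space_Rn n) (linear_map n A) (e j)" for j
  define B where "B i j = h j i" for i j
  have Ah: "linear_map n A (h j) = e j" if "j < n" for j
  proof -
    have "e j \<in> space_Rn n" using that by (auto simp: e_def topspace_Euclidean_space)
    then show ?thesis unfolding h_def using bij by (simp add: bij_betw_def f_inv_into_f)
  qed
  have AB: "linear_map n A (linear_map n B y) = y" if "y \<in> space_Rn n" for y
  proof
    fix i
    show "linear_map n A (linear_map n B y) i = y i"
    proof (cases "i < n")
      case True
      have "linear_map n A (linear_map n B y) i = (\<Sum>l<n. \<Sum>j<n. A i l * (h j l * y j))"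
        using True by (simp add: linear_map_def B_def sum_distrib_left)
      also have "\<dots> = (\<Sum>j<n. \<Sum>l<n. A i l * (h j l * y j))" by (rule sum.swap)
      also have "\<dots> = (\<Sum>j<n. linear_map n A (h j) i * y j)"
        using True by (simp add: linear_map_def sum_distrib_left sum_distrib_right mult_ac)
      also have "\<dots> = (\<Sum>j<n. if i = j then y j else 0)"
        by (intro sum.cong) (auto simp: Ah e_def)
      also have "\<dots> = y i" using True by simp
      finally show ?thesis .
    qed (use that in \<open>auto simp: linear_map_def topspace_Euclidean_space\<close>)
  qed
  have B_in: "linear_map n B y \<in> space_Rn n" for y
    by (auto simp: linear_map_def topspace_Euclidean_space)
  show thesis
  proof
    show "E = {y \<in> space_Rn n. enorm n (linear_map n B y) \<le> 1}"
    proof safe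
      fix y assume "y \<in> E"
      then obtain x where x: "x \<in> space_Rn n" "enorm n x \<le> 1" "y = linear_map n A x"
        using E by auto
      then show y: "y \<in> space_Rn n" using bij by (auto simp: bij_betw_def)
      have "linear_map n A (linear_map n B y) = linear_map n A x"
        using AB[OF y] x by simp
      then have "linear_map n B y = x"
        using bij x(1) B_in by (auto simp: bij_betw_def inj_on_def)
      then show "enorm n (linear_map n B y) \<le> 1" using x by simp
    next
      fix y assume "y \<in> space_Rn n" "enorm n (linear_map n B y) \<le> 1"
      then show "y \<in> E" unfolding E using AB B_in by (intro image_eqI[of _ _ "linear_map n B y"]) auto
    qed
    show "y = (\<lambda>_. 0)" if "y \<in> space_Rn n" "linear_map n B y = (\<lambda>_. 0)" for y
      using AB[OF that(1)] that(2) by (auto simp: linear_map_def fun_eq_iff split: if_splits)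
  qed
qed

lemma enorm_linear_map_divide:
  "c > 0 \<Longrightarrow> enorm n (linear_map n T (\<lambda>i. x i / c)) = enorm n (linear_map n T x) / c"
  using linear_map_scale[where n = n and S = T and t = "1 / c" and x = x]
    enorm_scale[where n = n and t = "1 / c" and x = "linear_map n T x"] by simp

lemma star_set_ellipsoid:
  assumes "n \<ge> 1" "symmetric_ellipsoid n E"
  obtains B where "E = star_set n (\<lambda>v. 1 / enorm n (linear_map n B v))"
    "admissible_radial n (\<lambda>v. 1 / enorm n (linear_map n B v))"
    "\<And>v. v \<in> unit_sphere n \<Longrightarrow> enorm n (linear_map n B v) > 0"
proof -
  obtain B where E: "E = {y \<in> space_Rn n. enorm n (linear_map n B y) \<le> 1}"
    and inj: "\<And>y. y \<in> space_Rn n \<Longrightarrow> linear_map n B y = (\<lambda>_. 0) \<Longrightarrow> y = (\<lambda>_. 0)"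
    using symmetric_ellipsoid_eq[OF assms(2)] by blast
  have pos: "enorm n (linear_map n B y) > 0" if "y \<in> space_Rn n" "y \<noteq> (\<lambda>_. 0)" for y
    using inj[OF that(1)] that(2) by (intro normalize_in_unit_sphere(1)[OF assms(1)])
      (auto simp: topspace_Euclidean_space linear_map_def)
  have sph: "v \<in> space_Rn n \<and> v \<noteq> (\<lambda>_. 0)" if "v \<in> unit_sphere n" for v
    using that unit_sphere_iff[OF assms(1)] by (auto simp: L2_set_def)
  show thesis
  proof
    show vpos: "enorm n (linear_map n B v) > 0" if "v \<in> unit_sphere n" for v
      using pos sph that by blast
    show "admissible_radial n (\<lambda>v. 1 / enorm n (linear_map n B v))"
      unfolding admissible_radial_def continuous_map_nsphere_iff
      using vpos by (auto intro!: continuous_intros less_imp_neq[THEN not_sym])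
    show "E = star_set n (\<lambda>v. 1 / enorm n (linear_map n B v))"
    proof (intro set_eqI)
      fix x
      show "x \<in> E \<longleftrightarrow> x \<in> star_set n (\<lambda>v. 1 / enorm n (linear_map n B v))"
      proof (cases "x \<in> space_Rn n \<and> x \<noteq> (\<lambda>_. 0)")
        case True
        have "enorm n x > 0" using normalize_in_unit_sphere(1)[OF assms(1)] True by blast
        moreover have "c \<le> 1 / (a / c) \<longleftrightarrow> a \<le> 1" if "a > 0" "c > 0" for a c :: real
          using that by (simp add: field_simps)
        ultimately show ?thesis
          using True pos[of x] by (auto simp: E star_set_def enorm_linear_map_divide)
      next
        case False
        have "enorm n (linear_map n B (\<lambda>_. 0)) = 0" by (simp add: linear_map_def L2_set_def)
        then show ?thesis using False
          by (auto simp: E star_set_def topspace_Euclidean_space)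
      qed
    qed
  qed
qed

lemma star_body_radial_fun:
  assumes "n \<ge> 1" "star_body n K"
  shows "admissible_radial n (radial_fun n K)" "K = star_set n (radial_fun n K)"
proof -
  have "admissible_radial n (radial_fun n K) \<and> K = star_set n (radial_fun n K)"
    using someI_ex[OF assms(2)[unfolded star_body_def]] by (simp add: radial_fun_def)
  then show "admissible_radial n (radial_fun n K)" "K = star_set n (radial_fun n K)" by auto
qed

text \<open>In k-th powers a radial k-sum is an ordinary sum, so every ellipsoid contributes one
  matrix. That the list is nonempty makes the sum of inverse powers infinite at the origin.\<close>

lemma ellipsoid_radial_sums_radial_fun:
  assumes "n \<ge> 1" "k \<ge> 1" "L \<in> ellipsoid_radial_sums n k"
  shows "star_body n L \<and> (\<exists>Ts. Ts \<noteq> [] \<and> (\<forall>v\<in>unit_sphere n.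
      (\<forall>T\<in>set Ts. enorm n (linear_map n T v) > 0) \<and>
      radial_fun n L v ^ k = (\<Sum>T\<leftarrow>Ts. 1 / enorm n (linear_map n T v) ^ k)))"
  using assms(3)
proof induction
  case (single E)
  obtain B where B: "E = star_set n (\<lambda>v. 1 / enorm n (linear_map n B v))"
    "admissible_radial n (\<lambda>v. 1 / enorm n (linear_map n B v))"
    "\<And>v. v \<in> unit_sphere n \<Longrightarrow> enorm n (linear_map n B v) > 0"
    using star_set_ellipsoid[OF assms(1) single] by blast
  have "star_body n E" using B unfolding star_body_def by blast
  moreover have "radial_fun n E v ^ k = (\<Sum>T\<leftarrow>[B]. 1 / enorm n (linear_map n T v) ^ k)"
    if "v \<in> unit_sphere n" for v
    using radial_fun_eq[OF assms(1) B(2) that] B(1) by (simp add: power_divide)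
  ultimately show ?case using B(3) by (intro conjI exI[of _ "[B]"]) auto
next
  case (add L E)
  obtain B where B: "E = star_set n (\<lambda>v. 1 / enorm n (linear_map n B v))"
    "admissible_radial n (\<lambda>v. 1 / enorm n (linear_map n B v))"
    "\<And>v. v \<in> unit_sphere n \<Longrightarrow> enorm n (linear_map n B v) > 0"
    using star_set_ellipsoid[OF assms(1) add.hyps(2)] by blast
  have E: "star_body n E" using B unfolding star_body_def by blast
  from add.IH obtain Ts where L: "star_body n L" and Ts: "Ts \<noteq> []"
    "\<And>v T. v \<in> unit_sphere n \<Longrightarrow> T \<in> set Ts \<Longrightarrow> enorm n (linear_map n T v) > 0"
    "\<And>v. v \<in> unit_sphere n \<Longrightarrow> radial_fun n L v ^ k = (\<Sum>T\<leftarrow>Ts. 1 / enorm n (linear_map n T v) ^ k)"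
    by blast
  let ?S = "radial_sum n (real k) L E"
  have S: "star_body n ?S" using L E assms(2) by (intro star_body_radial_sum) auto
  let ?\<rho> = "\<lambda>v. (radial_fun n L v powr real k + radial_fun n E v powr real k) powr (1 / real k)"
  have pos: "radial_fun n M v > 0" if "star_body n M" "v \<in> unit_sphere n" for M v
    using star_body_radial_fun(1)[OF assms(1) that(1)] that(2) by (simp add: admissible_radial_def)
  have "admissible_radial n ?\<rho>"
    unfolding admissible_radial_def continuous_map_nsphere_iff
  proof (intro conjI ballI continuous_intros)
    show "continuous_on (unit_sphere n) (radial_fun n L)" "continuous_on (unit_sphere n) (radial_fun n E)"
      using star_body_radial_fun(1)[OF assms(1)] L E by (auto simp: admissible_radial_def continuous_map_nsphere_iff)
    fix v assume "v \<in> unit_sphere n"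
    then have p: "radial_fun n L v > 0" "radial_fun n E v > 0" using pos L E by auto
    then show "radial_fun n L v \<noteq> 0" "radial_fun n E v \<noteq> 0" by auto
    have "radial_fun n L v powr real k + radial_fun n E v powr real k > 0"
      using p by (simp add: add_pos_pos)
    then show "?\<rho> v > 0" "radial_fun n L v powr real k + radial_fun n E v powr real k \<noteq> 0" by auto
  qed
  then have \<rho>: "radial_fun n ?S v = ?\<rho> v" if "v \<in> unit_sphere n" for v
    unfolding radial_sum_def using radial_fun_eq[OF assms(1)] that by blast
  have "radial_fun n ?S v ^ k = (\<Sum>T\<leftarrow>B # Ts. 1 / enorm n (linear_map n T v) ^ k)"
    if "v \<in> unit_sphere n" for v
  proof -
    have p: "radial_fun n L v > 0" "radial_fun n E v > 0" using pos L E that by auto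
    then have "radial_fun n L v powr real k + radial_fun n E v powr real k > 0"
      by (simp add: add_pos_pos)
    then have "radial_fun n ?S v ^ k = radial_fun n L v powr real k + radial_fun n E v powr real k"
      unfolding \<rho>[OF that] using assms(2) by (simp add: powr_powr flip: powr_realpow)
    also have "\<dots> = radial_fun n L v ^ k + radial_fun n E v ^ k"
      using p by (simp add: powr_realpow)
    finally show ?thesis
      using Ts(3)[OF that] radial_fun_eq[OF assms(1) B(2) that] B(1) by (simp add: power_divide)
  qed
  then show ?case
    using S B(3) Ts(2) by (intro conjI exI[of _ "B # Ts"]) auto
qed

subsection \<open>Volume of generalized intersection bodies\<close>

lemma radial_fun_continuous_on:
  assumes "n \<ge> 1" "star_body n K"
  shows "continuous_on (unit_sphere n) (radial_fun n K)"
  using star_body_radial_fun(1)[OF assms] by (simp add: admissible_radial_def continuous_map_nsphere_iff)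

lemma radial_fun_pos:
  assumes "n \<ge> 1" "star_body n K" "v \<in> unit_sphere n"
  shows "radial_fun n K v > 0"
  using star_body_radial_fun(1)[OF assms(1,2)] assms(3) by (simp add: admissible_radial_def)

lemma radial_fun_diff_le:
  assumes "n \<ge> 1" "star_body n K" "star_body n L" "v \<in> unit_sphere n"
  shows "\<bar>radial_fun n K v - radial_fun n L v\<bar> \<le> radial_dist n K L"
  unfolding radial_dist_def
proof (rule cSUP_upper[OF assms(4)])
  have "compact ((\<lambda>v. \<bar>radial_fun n K v - radial_fun n L v\<bar>) ` unit_sphere n)"
    by (intro compact_continuous_image compact_unit_sphere continuous_intros radial_fun_continuous_on assms)
  then show "bdd_above ((\<lambda>v. \<bar>radial_fun n K v - radial_fun n L v\<bar>) ` unit_sphere n)"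
    by (intro bounded_imp_bdd_above compact_imp_bounded)
qed

lemma in_star_body_iff:
  assumes "n \<ge> 1" "star_body n D" "x \<in> space_Rn n" "x \<noteq> (\<lambda>_. 0)"
  shows "x \<in> D \<longleftrightarrow> enorm n x \<le> radial_fun n D (\<lambda>i. x i / enorm n x)"
  using star_body_radial_fun(2)[OF assms(1,2)] assms(3,4) by (auto simp: star_set_def)

lemma zero_in_star_body: "n \<ge> 1 \<Longrightarrow> star_body n D \<Longrightarrow> (\<lambda>_. 0) \<in> D"
  using star_body_radial_fun(2)[of n D] by (auto simp: star_set_def)

lemma star_body_subset: "n \<ge> 1 \<Longrightarrow> star_body n D \<Longrightarrow> D \<subseteq> space_Rn n"
  by (subst star_body_radial_fun(2)[of n D]) (auto simp: star_set_def topspace_Euclidean_space)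

text \<open>One approximant \<open>L\<close> suffices, with no limit taken. For x \<noteq> 0 the sum
  of inverse powers is the k-th power of \<rho>_L(x/|x|) / |x|; since the radial functions of
  \<open>D\<close> and \<open>L\<close> agree up to a factor 2, membership in \<open>D\<close> is
  read off with the losses (1/2)^k and t/2.\<close>

lemma BP_rpow_sum:
  assumes n: "n \<ge> 1" and k: "k \<ge> 1" and D: "D \<in> BP k n"
  obtains m :: nat and T :: "nat \<Rightarrow> nat \<Rightarrow> nat \<Rightarrow> real" where
    "\<And>x. x \<in> D \<Longrightarrow> ennreal ((1 / 2) ^ k) \<le> (\<Sum>l<m. rpow k (enorm n (linear_map n (T l) x)))"
    "\<And>x t. x \<in> space_Rn n \<Longrightarrow> t > 0 \<Longrightarrow>
       ennreal (t ^ k) < (\<Sum>l<m. rpow k (enorm n (linear_map n (T l) x))) \<Longrightarrow> (\<lambda>i. t / 2 * x i) \<in> D"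
proof -
  have starD: "star_body n D" using D by (simp add: BP_def radial_closure_def)
  obtain v0 where v0: "v0 \<in> unit_sphere n" "\<And>v. v \<in> unit_sphere n \<Longrightarrow> radial_fun n D v0 \<le> radial_fun n D v"
    using continuous_attains_inf[OF compact_unit_sphere[OF n] unit_sphere_nonempty[OF n]
        radial_fun_continuous_on[OF n starD]] by blast
  \<comment> \<open>Half the minimum of the radial function: a uniform error below it is a relative
    error below 1/2 in every direction.\<close>
  define \<epsilon> where "\<epsilon> = radial_fun n D v0 / 2"
  have "\<epsilon> > 0" using radial_fun_pos[OF n starD v0(1)] by (simp add: \<epsilon>_def)
  then obtain L where L: "L \<in> ellipsoid_radial_sums n k" "radial_dist n D L < \<epsilon>"
    using D by (auto simp: BP_def radial_closure_def)
  obtain Ts where starL: "star_body n L" and "Ts \<noteq> []" and Ts: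
    "\<And>v T. v \<in> unit_sphere n \<Longrightarrow> T \<in> set Ts \<Longrightarrow> enorm n (linear_map n T v) > 0"
    "\<And>v. v \<in> unit_sphere n \<Longrightarrow> radial_fun n L v ^ k = (\<Sum>T\<leftarrow>Ts. 1 / enorm n (linear_map n T v) ^ k)"
    using ellipsoid_radial_sums_radial_fun[OF n k L(1)] by blast
  have close: "radial_fun n D v \<le> 2 * radial_fun n L v" "radial_fun n L v \<le> 2 * radial_fun n D v"
    if "v \<in> unit_sphere n" for v
    using radial_fun_diff_le[OF n starD starL that] L(2) v0(2)[OF that] by (auto simp: \<epsilon>_def abs_le_iff)
  let ?F = "\<lambda>x. \<Sum>l<length Ts. rpow k (enorm n (linear_map n (Ts ! l) x))"
  have F_0: "?F (\<lambda>_. 0) = \<infinity>"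
  proof -
    have "linear_map n T (\<lambda>_. 0) = (\<lambda>_. 0)" for T by (auto simp: linear_map_def)
    moreover have "enorm n (\<lambda>_. 0) = 0" by (simp add: L2_set_def)
    ultimately show ?thesis using \<open>Ts \<noteq> []\<close> by (simp add: rpow_def ennreal_top_eq_mult_iff of_nat_eq_0_iff)
  qed
  have F: "?F x = ennreal ((radial_fun n L (\<lambda>i. x i / enorm n x) / enorm n x) ^ k)"
    if x: "x \<in> space_Rn n" "x \<noteq> (\<lambda>_. 0)" for x
  proof -
    let ?v = "\<lambda>i. x i / enorm n x"
    have v: "enorm n x > 0" "?v \<in> unit_sphere n" using normalize_in_unit_sphere[OF n x] by auto
    have "rpow k (enorm n (linear_map n (Ts ! l) x))
        = ennreal (1 / enorm n (linear_map n (Ts ! l) ?v) ^ k / enorm n x ^ k)" if "l < length Ts" for l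
    proof -
      have "enorm n (linear_map n (Ts ! l) x) > 0"
        using Ts(1)[OF v(2), of "Ts ! l"] v(1) that by (simp add: enorm_linear_map_divide zero_less_divide_iff)
      then show ?thesis using v(1) by (simp add: rpow_def enorm_linear_map_divide power_divide)
    qed
    then have "?F x = (\<Sum>l<length Ts. ennreal (1 / enorm n (linear_map n (Ts ! l) ?v) ^ k / enorm n x ^ k))"
      by simp
    also have "\<dots> = ennreal (\<Sum>l<length Ts. 1 / enorm n (linear_map n (Ts ! l) ?v) ^ k / enorm n x ^ k)"
      by (intro sum_ennreal) simp
    also have "(\<Sum>l<length Ts. 1 / enorm n (linear_map n (Ts ! l) ?v) ^ k / enorm n x ^ k)
        = radial_fun n L ?v ^ k / enorm n x ^ k"
      unfolding Ts(2)[OF v(2)] by (simp add: sum_list_sum_nth atLeast0LessThan sum_divide_distrib)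
    finally show ?thesis by (simp add: power_divide)
  qed
  show thesis
  proof
    fix x assume "x \<in> D"
    show "ennreal ((1 / 2) ^ k) \<le> ?F x"
    proof (cases "x = (\<lambda>_. 0)")
      case False
      have x: "x \<in> space_Rn n" using \<open>x \<in> D\<close> star_body_subset[OF n starD] by blast
      let ?v = "\<lambda>i. x i / enorm n x"
      have v: "enorm n x > 0" "?v \<in> unit_sphere n" using normalize_in_unit_sphere[OF n x False] by auto
      have "enorm n x \<le> radial_fun n D ?v" using in_star_body_iff[OF n starD x False] \<open>x \<in> D\<close> by blast
      also have "\<dots> \<le> 2 * radial_fun n L ?v" by (rule close[OF v(2)])
      finally have "1 / 2 \<le> radial_fun n L ?v / enorm n x" using v(1) by (simp add: field_simps)
      then show ?thesis unfolding F[OF x False] by (intro ennreal_leI power_mono) auto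
    qed (simp add: F_0)
  next
    fix x t assume x: "x \<in> space_Rn n" and t: "(t::real) > 0" and less: "ennreal (t ^ k) < ?F x"
    show "(\<lambda>i. t / 2 * x i) \<in> D"
    proof (cases "x = (\<lambda>_. 0)")
      case True
      then show ?thesis using zero_in_star_body[OF n starD] by simp
    next
      case False
      let ?v = "\<lambda>i. x i / enorm n x" and ?w = "\<lambda>i. t / 2 * x i"
      have v: "enorm n x > 0" "?v \<in> unit_sphere n" using normalize_in_unit_sphere[OF n x False] by auto
      have "t ^ k < (radial_fun n L ?v / enorm n x) ^ k"
        using less t unfolding F[OF x False] by (simp add: ennreal_less_iff)
      then have "t < radial_fun n L ?v / enorm n x"
        by (rule power_less_imp_less_base) (use radial_fun_pos[OF n starL v(2)] v(1) in simp)
      then have "t * enorm n x < radial_fun n L ?v" using v(1) by (simp add: field_simps)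
      also have "\<dots> \<le> 2 * radial_fun n D ?v" by (rule close[OF v(2)])
      finally have "enorm n ?w \<le> radial_fun n D ?v"
        unfolding enorm_scale using t by simp
      moreover have "(\<lambda>i. ?w i / enorm n ?w) = ?v"
        unfolding enorm_scale using t by (auto simp: fun_eq_iff)
      moreover have "?w \<in> space_Rn n" using x by (auto simp: topspace_Euclidean_space)
      moreover have "?w \<noteq> (\<lambda>_. 0)" using False t by (auto simp: fun_eq_iff)
      ultimately show ?thesis using in_star_body_iff[OF n starD, of ?w] by simp
    qed
  qed
qed

section \<open>Bodies as Borel sets in restricted coordinates\<close>

definition ext :: "nat \<Rightarrow> (nat \<Rightarrow> real) \<Rightarrow> nat \<Rightarrow> real" where
  "ext n x = (\<lambda>i. if i < n then x i else 0)"

text \<open>The product measure lives on functions undefined from \<open>n\<close> on, the bodies on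
  functions vanishing there. Written as a preimage, the restricted body inherits measurability
  directly from \<open>D\<close>.\<close>

definition rset :: "nat \<Rightarrow> (nat \<Rightarrow> real) set \<Rightarrow> (nat \<Rightarrow> real) set" where
  "rset n D = {x \<in> space (lebn n). ext n x \<in> D}"

lemma ext_in_space_Rn [simp]: "ext n x \<in> space_Rn n"
  by (auto simp: ext_def topspace_Euclidean_space)

lemma ip_ext [simp]: "ip n (ext n x) y = ip n x y"
  by (simp add: ip_def ext_def)

lemma enorm_ext [simp]: "enorm n (ext n x) = enorm n x"
  by (simp add: L2_set_def ext_def)

lemma linear_map_ext [simp]: "linear_map n T (ext n x) = linear_map n T x"
  by (simp add: linear_map_def ext_def fun_eq_iff)

lemma measurable_ext [measurable]: "ext n \<in> borel_measurable (lebn n)"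
proof (rule measurable_coordinatewise_then_product)
  fix i
  show "(\<lambda>x. ext n x i) \<in> borel_measurable (lebn n)"
  proof (cases "i < n")
    case True
    then have "(\<lambda>x. x i) \<in> lebn n \<rightarrow>\<^sub>M (lborel :: real measure)"
      by (intro measurable_component_singleton) auto
    then show ?thesis using True by (simp add: ext_def)
  qed (simp add: ext_def)
qed

lemma sets_rset: "D \<in> sets borel \<Longrightarrow> rset n D \<in> sets (lebn n)"
  using measurable_sets[OF measurable_ext, of D n] by (simp add: rset_def vimage_def Int_def conj_commute)

lemma restrict_image_eq_rset:
  assumes "D \<subseteq> space_Rn n"
  shows "(\<lambda>x. restrict x {..<n}) ` D = rset n D"
proof safe
  fix x assume "x \<in> D"
  then have "ext n (restrict x {..<n}) = x"
    using assms by (auto simp: ext_def topspace_Euclidean_space fun_eq_iff)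
  then show "restrict x {..<n} \<in> rset n D"
    using \<open>x \<in> D\<close> by (auto simp: rset_def space_PiM)
next
  fix x assume x: "x \<in> rset n D"
  then have "x = restrict (ext n x) {..<n}"
    by (auto simp: rset_def space_PiM ext_def fun_eq_iff PiE_iff extensional_def)
  then show "x \<in> (\<lambda>x. restrict x {..<n}) ` D"
    using x by (auto simp: rset_def)
qed

lemma emeasure_rset_finite:
  assumes "\<And>x. x \<in> D \<Longrightarrow> enorm n x \<le> R"
  shows "emeasure (lebn n) (rset n D) < \<infinity>"
proof -
  interpret L: product_sigma_finite "\<lambda>_::nat. lborel :: real measure"
    by (rule product_sigma_finite_lborel)
  have "rset n D \<subseteq> Pi\<^sub>E {..<n} (\<lambda>_. {-R..R})"
  proof
    fix x assume x: "x \<in> rset n D"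
    then have "enorm n x \<le> R" using assms[of "ext n x"] by (auto simp: rset_def)
    then have "x i \<in> {-R..R}" if "i < n" for i
      using abs_coordinate_le_enorm[OF that, of x] by (auto simp: abs_le_iff)
    then show "x \<in> Pi\<^sub>E {..<n} (\<lambda>_. {-R..R})"
      using x by (auto simp: rset_def space_PiM PiE_iff)
  qed
  then have "emeasure (lebn n) (rset n D) \<le> emeasure (lebn n) (Pi\<^sub>E {..<n} (\<lambda>_. {-R..R}))"
    by (intro emeasure_mono sets_PiM_I_finite) auto
  also have "\<dots> = (\<Prod>i<n. emeasure lborel {-R..R})"
    by (rule L.emeasure_PiM) auto
  also have "\<dots> < \<infinity>" by (simp add: power_less_top_ennreal emeasure_lborel_Icc_eq)
  finally show ?thesis .
qed

lemma emeasure_rset: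
  assumes "D \<subseteq> space_Rn n" "\<And>x. x \<in> D \<Longrightarrow> enorm n x \<le> R"
  shows "emeasure (lebn n) (rset n D) = ennreal (volume n D)"
  using emeasure_rset_finite[of D n R] assms(2)
  by (auto simp: volume_def restrict_image_eq_rset[OF assms(1)] emeasure_eq_ennreal_measure)

text \<open>On the space without the origin the body is the region where a continuous function is
  nonpositive, hence relatively closed. The origin is added separately because the direction x/|x|
  has no continuous extension there.\<close>

lemma star_body_borel:
  assumes "n \<ge> 1" "star_body n D"
  shows "D \<in> sets borel"
proof -
  define U where "U = space_Rn n - {\<lambda>_. 0}"
  define f where "f x = enorm n x - radial_fun n D (\<lambda>i. x i / enorm n x)" for x
  have v: "continuous_on U (\<lambda>x i. x i / enorm n x)"
  proof (rule continuous_on_coordinatewise_then_product, intro continuous_intros ballI)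
    fix x assume "x \<in> U"
    then show "enorm n x \<noteq> 0"
      using normalize_in_unit_sphere(1)[OF assms(1), of x] by (auto simp: U_def)
  qed
  have "continuous_on U (\<lambda>x. radial_fun n D (\<lambda>i. x i / enorm n x))"
    by (rule continuous_on_compose2[OF radial_fun_continuous_on[OF assms] v])
       (use normalize_in_unit_sphere[OF assms(1)] in \<open>auto simp: U_def\<close>)
  then have "continuous_on U f"
    unfolding f_def by (intro continuous_intros)
  then have "closedin (top_of_set U) (U \<inter> f -` {..0})"
    by (intro continuous_closedin_preimage) auto
  then obtain C where "closed C" "U \<inter> f -` {..0} = U \<inter> C"
    by (auto simp: closedin_closed)
  moreover have "D = insert (\<lambda>_. 0) (U \<inter> f -` {..0})"
  proof (rule set_eqI)
    fix x
    show "x \<in> D \<longleftrightarrow> x \<in> insert (\<lambda>_. 0) (U \<inter> f -` {..0})"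
      using in_star_body_iff[OF assms, of x] zero_in_star_body[OF assms] star_body_subset[OF assms]
      by (cases "x = (\<lambda>_. 0)"; cases "x \<in> space_Rn n") (auto simp: U_def f_def)
  qed
  ultimately have "D = {\<lambda>_. 0} \<union> ((space_Rn n - {\<lambda>_. 0}) \<inter> C)"
    by (auto simp: U_def)
  also have "\<dots> \<in> sets borel"
    by (intro sets.Un sets.Int sets.Diff borel_closed closed_space_Rn closed_singleton \<open>closed C\<close>)
  finally show ?thesis .
qed

lemma star_body_bounded:
  assumes "n \<ge> 1" "star_body n D"
  obtains R where "\<And>x. x \<in> D \<Longrightarrow> enorm n x \<le> R"
proof -
  obtain v0 where v0: "v0 \<in> unit_sphere n" "\<And>v. v \<in> unit_sphere n \<Longrightarrow> radial_fun n D v \<le> radial_fun n D v0"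
    using continuous_attains_sup[OF compact_unit_sphere[OF assms(1)] unit_sphere_nonempty[OF assms(1)]
        radial_fun_continuous_on[OF assms]] by blast
  have "enorm n x \<le> radial_fun n D v0" if "x \<in> D" for x
  proof (cases "x = (\<lambda>_. 0)")
    case True
    then show ?thesis using radial_fun_pos[OF assms v0(1)] by (simp add: L2_set_def)
  next
    case False
    have x: "x \<in> space_Rn n" using that star_body_subset[OF assms] by blast
    then have "enorm n x \<le> radial_fun n D (\<lambda>i. x i / enorm n x)"
      using in_star_body_iff[OF assms x False] that by blast
    also have "\<dots> \<le> radial_fun n D v0"
      using normalize_in_unit_sphere(2)[OF assms(1) x False] by (rule v0(2))
    finally show ?thesis .
  qed
  then show thesis by (rule that)
qed

lemma emeasure_rset_star_body:
  assumes "n \<ge> 1" "star_body n D"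
  shows "emeasure (lebn n) (rset n D) = ennreal (volume n D)"
  using star_body_bounded[OF assms] emeasure_rset[OF star_body_subset[OF assms]] by metis

text \<open>Two estimates of the sum of inverse powers \<open>F\<close> collide if the volume is too
  small: the level sets force its Gaussian mean below 5 / 50^k, while the perturbed points, lying in
  \<open>D\<close> with probability at least 3/4, force their average above (3/4) / 2^k. The
  comparison allows a factor of only 3 between them.\<close>

lemma volume_BP_ge:
  fixes y :: "nat \<Rightarrow> nat \<Rightarrow> real"
  assumes k: "k \<ge> 1" "2 * k \<le> n" and "N \<ge> 1" and D: "D \<in> BP k n"
  defines "\<nu> \<equiv> uniform_measure (gauss n) (gauss_core n)" and "\<sigma> \<equiv> 1 / sqrt n"
  assumes le: "\<And>\<xi>. (\<Sum>j<N. cos (ip n \<xi> (y j))) * exp (- (\<sigma> * enorm n \<xi>)\<^sup>2 / 2)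
      \<le> N * ((\<integral>x. cos (ip n \<xi> x) \<partial>\<nu>) * exp (- (\<sigma> * enorm n \<xi>)\<^sup>2 / 2)
              + (\<sigma> / sqrt 2) ^ k * exp (- (\<sigma> * enorm n \<xi>)\<^sup>2 / 4))"
    and sub: "\<And>j g. j < N \<Longrightarrow> g \<in> gauss_core n \<Longrightarrow> ext n (\<lambda>i. y j i + \<sigma> * g i) \<in> D"
  shows "volume n D \<ge> (1 / 50) ^ n"
proof (rule ccontr)
  assume "\<not> volume n D \<ge> (1 / 50) ^ n"
  then have V: "ennreal (volume n D) \<le> ennreal ((1 / 50) ^ n)"
    by (intro ennreal_leI) simp
  have n: "n \<ge> 1" using k by simp
  have "\<sigma> > 0" using n by (simp add: \<sigma>_def)
  have starD: "star_body n D" using D by (simp add: BP_def radial_closure_def)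
  obtain m :: nat and T :: "nat \<Rightarrow> nat \<Rightarrow> nat \<Rightarrow> real" where
    F1: "\<And>x. x \<in> D \<Longrightarrow> ennreal ((1 / 2) ^ k) \<le> (\<Sum>l<m. rpow k (enorm n (linear_map n (T l) x)))"
    and F2: "\<And>x t. x \<in> space_Rn n \<Longrightarrow> t > 0 \<Longrightarrow>
       ennreal (t ^ k) < (\<Sum>l<m. rpow k (enorm n (linear_map n (T l) x))) \<Longrightarrow> (\<lambda>i. t / 2 * x i) \<in> D"
    using BP_rpow_sum[OF n k(1) D] by metis
  define F where "F x = (\<Sum>l<m. rpow k (enorm n (linear_map n (T l) x)))" for x
  have F_ext: "F (ext n x) = F x" for x by (simp add: F_def)
  have [measurable]: "F \<in> borel_measurable (gauss n)" unfolding F_def by measurable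
  have "(\<integral>\<^sup>+x. F x \<partial>gauss n) \<le> ennreal (5 * (1 / 50) ^ k)"
  proof (rule gauss_integral_le_of_level_sets[OF _ k _ _ V])
    fix t :: real assume "t > 0"
    let ?\<phi> = "\<lambda>x. \<lambda>i\<in>{..<n}. 0 + t / 2 * x i"
    have S: "rset n D \<in> sets (lebn n)" by (rule sets_rset[OF star_body_borel[OF n starD]])
    have "?\<phi> \<in> lebn n \<rightarrow>\<^sub>M lebn n" by (intro measurable_restrict) auto
    then have pre: "?\<phi> -` rset n D \<inter> space (lebn n) \<in> sets (lebn n)" using S by (rule measurable_sets)
    \<comment> \<open>Where F exceeds t^k, multiplication by t/2 leads into \<open>D\<close>; so
      this level set lies in the dilate of \<open>D\<close> by 2/t, of volume (2/t)^n times that of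
      \<open>D\<close>.\<close>
    have "{x \<in> space (lebn n). F x > ennreal (t ^ k)} \<subseteq> ?\<phi> -` rset n D \<inter> space (lebn n)"
    proof (rule subsetI)
      fix x assume "x \<in> {x \<in> space (lebn n). F x > ennreal (t ^ k)}"
      then have x: "x \<in> space (lebn n)" "F x > ennreal (t ^ k)" by auto
      then have "(\<lambda>i. t / 2 * ext n x i) \<in> D"
        using F2[of "ext n x" t] \<open>t > 0\<close> by (simp add: F_def)
      also have "(\<lambda>i. t / 2 * ext n x i) = ext n (?\<phi> x)" by (auto simp: ext_def fun_eq_iff)
      finally show "x \<in> ?\<phi> -` rset n D \<inter> space (lebn n)"
        using x(1) by (auto simp: rset_def space_PiM)
    qed
    then have "emeasure (lebn n) {x \<in> space (lebn n). F x > ennreal (t ^ k)}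
        \<le> emeasure (lebn n) (?\<phi> -` rset n D \<inter> space (lebn n))"
      using pre by (rule emeasure_mono)
    also have "\<dots> = ennreal ((2 / t) ^ n) * (ennreal ((t / 2) ^ n) * emeasure (lebn n) (?\<phi> -` rset n D \<inter> space (lebn n)))"
      using \<open>t > 0\<close> by (simp add: mult.assoc[symmetric] flip: ennreal_mult' power_mult_distrib)
    also have "\<dots> = ennreal ((2 / t) ^ n) * ennreal (volume n D)"
      using emeasure_lebn_affine[OF _ S, of "t / 2" "\<lambda>_. 0"] \<open>t > 0\<close> emeasure_rset_star_body[OF n starD] by simp
    finally show "emeasure (lebn n) {x \<in> space (lebn n). F x > ennreal (t ^ k)}
        \<le> ennreal ((2 / t) ^ n) * ennreal (volume n D)" .
  qed auto
  then have up: "ennreal (3 * real N) * (\<integral>\<^sup>+x. F x \<partial>gauss n) \<le> ennreal (3 * real N * (5 * (1 / 50) ^ k))"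
    by (subst ennreal_mult) (auto intro: mult_left_mono)
  have h: "ennreal (a * (b * c)) = ennreal a * (ennreal b * ennreal c)" if "a \<ge> 0" "b \<ge> 0" "c \<ge> 0" for a b c
    using that by (simp add: ennreal_mult)
  have "ennreal (N * ((1 / 2) ^ k * (3 / 4))) = ennreal N * (ennreal ((1 / 2) ^ k) * ennreal (3 / 4))"
    by (rule h) auto
  also have "\<dots> = (\<Sum>j<N. ennreal ((1 / 2) ^ k) * ennreal (3 / 4))"
    by (simp add: ennreal_of_nat_eq_real_of_nat)
  also have "\<dots> \<le> (\<Sum>j<N. \<integral>\<^sup>+g. F (\<lambda>i. y j i + \<sigma> * g i) \<partial>gauss n)"
  proof (rule sum_mono)
    fix j assume j: "j \<in> {..<N}"
    have "ennreal ((1 / 2) ^ k) * ennreal (3 / 4) \<le> ennreal ((1 / 2) ^ k) * emeasure (gauss n) (gauss_core n)"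
      by (intro mult_left_mono emeasure_gauss_core n) auto
    also have "\<dots> = (\<integral>\<^sup>+g. ennreal ((1 / 2) ^ k) * indicator (gauss_core n) g \<partial>gauss n)"
      by (rule nn_integral_cmult_indicator[symmetric]) measurable
    also have "\<dots> \<le> (\<integral>\<^sup>+g. F (\<lambda>i. y j i + \<sigma> * g i) \<partial>gauss n)"
    proof (rule nn_integral_mono)
      fix g
      show "ennreal ((1 / 2) ^ k) * indicator (gauss_core n) g \<le> F (\<lambda>i. y j i + \<sigma> * g i)"
        using F1[OF sub[of j g]] j F_ext[of "\<lambda>i. y j i + \<sigma> * g i"]
        by (auto simp: indicator_def F_def)
    qed
    finally show "ennreal ((1 / 2) ^ k) * ennreal (3 / 4) \<le> (\<integral>\<^sup>+g. F (\<lambda>i. y j i + \<sigma> * g i) \<partial>gauss n)" .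
  qed
  also have "\<dots> = (\<Sum>j<N. \<Sum>l<m. \<integral>\<^sup>+g. rpow k (enorm n (linear_map n (T l) (\<lambda>i. y j i + \<sigma> * g i))) \<partial>gauss n)"
    unfolding F_def by (intro sum.cong refl nn_integral_sum) measurable
  also have "\<dots> = (\<Sum>l<m. \<Sum>j<N. \<integral>\<^sup>+g. rpow k (enorm n (linear_map n (T l) (\<lambda>i. y j i + \<sigma> * g i))) \<partial>gauss n)"
    by (rule sum.swap)
  also have "\<dots> \<le> (\<Sum>l<m. ennreal (3 * real N) * (\<integral>\<^sup>+g. rpow k (enorm n (linear_map n (T l) g)) \<partial>gauss n))"
    by (intro sum_mono rpow_average_comparison[OF n k(1) \<open>\<sigma> > 0\<close>] le[unfolded \<nu>_def])
  also have "\<dots> = ennreal (3 * real N) * (\<integral>\<^sup>+x. F x \<partial>gauss n)"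
    unfolding F_def sum_distrib_left[symmetric] by (subst nn_integral_sum) measurable
  also note up
  finally have "N * ((1 / 2) ^ k * (3 / 4)) \<le> 3 * real N * (5 * (1 / 50) ^ k)"
    by (subst (asm) ennreal_le_iff) auto
  \<comment> \<open>The constant 50 is chosen for this point: the inequality amounts to 25^k \<le>
    20, impossible for k \<ge> 1.\<close>
  then have "(1 / 2) ^ k * (3 / 4) \<le> 15 * (1 / 50 :: real) ^ k" using \<open>N \<ge> 1\<close> by simp
  then have "1 / 20 \<le> (1 / 25 :: real) ^ k"
    using power_mult_distrib[of 2 "25::real" k] by (simp add: power_divide field_simps)
  also have "\<dots> \<le> (1 / 25) ^ 1" using k by (intro power_decreasing) auto
  finally show False by simp
qed

subsection \<open>Polytopes with few vertices\<close>

definition support_max :: "nat \<Rightarrow> nat \<Rightarrow> (nat \<Rightarrow> nat \<Rightarrow> real) \<Rightarrow> (nat \<Rightarrow> real) \<Rightarrow> real" where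
  "support_max n N y \<theta> = Max ((\<lambda>j. \<bar>ip n (y j) \<theta>\<bar>) ` {..<N})"

text \<open>
  The convex hull of the points \<open>\<plusminus>y\<^sub>j\<close> plus a ball of radius \<open>r\<close>, described by its support function so that
  no separation theorem is needed.
\<close>

definition hull_body :: "nat \<Rightarrow> nat \<Rightarrow> (nat \<Rightarrow> nat \<Rightarrow> real) \<Rightarrow> real \<Rightarrow> (nat \<Rightarrow> real) set" where
  "hull_body n N y r =
    {x \<in> space_Rn n. \<forall>\<theta>. ip n x \<theta> \<le> support_max n N y \<theta> + r * enorm n \<theta>}"

lemma support_max_ge: "j < N \<Longrightarrow> \<bar>ip n (y j) \<theta>\<bar> \<le> support_max n N y \<theta>"
  unfolding support_max_def by (intro Max_ge) auto

lemma support_max_attained: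
  assumes "N \<ge> 1"
  obtains j where "j < N" "support_max n N y \<theta> = \<bar>ip n (y j) \<theta>\<bar>"
proof -
  have "support_max n N y \<theta> \<in> (\<lambda>j. \<bar>ip n (y j) \<theta>\<bar>) ` {..<N}"
    unfolding support_max_def using assms by (intro Max_in) (auto simp: lessThan_empty_iff)
  then show thesis using that by auto
qed

lemma support_max_nonneg: "N \<ge> 1 \<Longrightarrow> 0 \<le> support_max n N y \<theta>"
  by (metis support_max_attained abs_ge_zero)

lemma hull_body_subset: "hull_body n N y r \<subseteq> space_Rn n"
  by (auto simp: hull_body_def)

text \<open>The support inequality is tested in the direction \<open>x\<close> itself and divided by
  |x|.\<close>

lemma hull_body_bounded:
  assumes "N \<ge> 1" "\<And>j. j < N \<Longrightarrow> enorm n (y j) \<le> a" "x \<in> hull_body n N y r" "r \<ge> 0"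
  shows "enorm n x \<le> a + r"
proof (cases "enorm n x = 0")
  case True
  have "0 \<le> a" using assms(1) order_trans[OF L2_set_nonneg assms(2)[of 0]] by simp
  then show ?thesis using True assms(4) by simp
next
  case False
  obtain j where j: "j < N" "support_max n N y x = \<bar>ip n (y j) x\<bar>"
    using support_max_attained[OF assms(1)] by blast
  have "enorm n x * enorm n x = ip n x x" by (simp add: ip_self power2_eq_square)
  also have "\<dots> \<le> support_max n N y x + r * enorm n x"
    using assms(3) by (simp add: hull_body_def)
  also have "\<dots> \<le> enorm n (y j) * enorm n x + r * enorm n x"
    using ip_le_enorm[of n "y j" x] j by simp
  also have "\<dots> \<le> (a + r) * enorm n x"
    using assms(2)[OF j(1)] by (simp add: distrib_right mult_right_mono)
  finally show ?thesis using False by (simp add: order_le_neq_trans)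
qed

lemma closed_hull_body: "closed (hull_body n N y r)"
proof -
  have "hull_body n N y r = space_Rn n \<inter> (\<Inter>\<theta>. {x. ip n x \<theta> \<le> support_max n N y \<theta> + r * enorm n \<theta>})"
    by (auto simp: hull_body_def)
  also have "closed \<dots>"
    by (intro closed_Int closed_space_Rn closed_INT ballI closed_Collect_le continuous_intros)
  finally show ?thesis .
qed

lemma ip_uminus_right: "ip n x (\<lambda>i. - \<theta> i) = - ip n x \<theta>"
  by (simp add: ip_def sum_negf)

lemma ip_uminus_left: "ip n (\<lambda>i. - x i) \<theta> = - ip n x \<theta>"
  by (simp add: ip_def sum_negf)

lemma enorm_uminus: "enorm n (\<lambda>i. - x i) = enorm n x"
  by (simp add: L2_set_def)

lemma origin_symmetric_hull_body: "origin_symmetric (hull_body n N y r)"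
  unfolding origin_symmetric_def
proof
  fix x assume x: "x \<in> hull_body n N y r"
  have "ip n (\<lambda>i. - x i) \<theta> \<le> support_max n N y \<theta> + r * enorm n \<theta>" for \<theta>
  proof -
    have "ip n (\<lambda>i. - x i) \<theta> = ip n x (\<lambda>i. - \<theta> i)"
      by (simp add: ip_uminus_left ip_uminus_right)
    also have "\<dots> \<le> support_max n N y (\<lambda>i. - \<theta> i) + r * enorm n (\<lambda>i. - \<theta> i)"
      using x by (simp only: hull_body_def mem_Collect_eq)
    finally show ?thesis by (simp add: support_max_def ip_uminus_right enorm_uminus)
  qed
  then show "(\<lambda>i. - x i) \<in> hull_body n N y r"
    using x by (auto simp: hull_body_def topspace_Euclidean_space)
qed

lemma ball_subset_hull_body:
  assumes "N \<ge> 1" "x \<in> space_Rn n" "enorm n x \<le> r"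
  shows "x \<in> hull_body n N y r"
proof -
  have "ip n x \<theta> \<le> support_max n N y \<theta> + r * enorm n \<theta>" for \<theta>
  proof -
    have "ip n x \<theta> \<le> enorm n x * enorm n \<theta>" using ip_le_enorm[of n x \<theta>] by simp
    also have "\<dots> \<le> r * enorm n \<theta>" using assms(3) by (intro mult_right_mono) auto
    finally show ?thesis using support_max_nonneg[OF assms(1), of n y \<theta>] by simp
  qed
  then show ?thesis using assms(2) by (simp add: hull_body_def)
qed

lemma ext_add_in_hull_body:
  assumes "j < N" "enorm n z \<le> r"
  shows "ext n (\<lambda>i. y j i + z i) \<in> hull_body n N y r"
proof -
  have "ip n (\<lambda>i. y j i + z i) \<theta> \<le> support_max n N y \<theta> + r * enorm n \<theta>" for \<theta>
  proof -
    have "ip n (\<lambda>i. y j i + z i) \<theta> = ip n (y j) \<theta> + ip n z \<theta>"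
      by (simp add: ip_def distrib_right sum.distrib)
    moreover have "ip n z \<theta> \<le> r * enorm n \<theta>"
      using ip_le_enorm[of n z \<theta>] mult_right_mono[OF assms(2), of "enorm n \<theta>"] by simp
    ultimately show ?thesis using support_max_ge[OF assms(1), of n y \<theta>] by simp
  qed
  then show ?thesis by (simp add: hull_body_def)
qed

lemma convex_body_hull_body:
  assumes "n \<ge> 1" "N \<ge> 1" "r > 0" and "\<And>j. j < N \<Longrightarrow> enorm n (y j) \<le> a"
  shows "convex_body n (hull_body n N y r)"
  unfolding convex_body_def
proof (intro conjI ballI allI impI)
  have "enorm n x \<le> a + r" if "x \<in> hull_body n N y r" for x
    using hull_body_bounded[OF assms(2,4) that] assms(3) by simp
  then have "compact (hull_body n N y r)"
    by (rule compact_of_closed_enorm_bounded[OF closed_hull_body hull_body_subset])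
  then show "compactin (Euclidean_space n) (hull_body n N y r)"
    unfolding Euclidean_space_def euclidean_product_topology
    using hull_body_subset by (simp add: compactin_subtopology topspace_Euclidean_space)
  let ?U = "space_Rn n \<inter> {x. enorm n x < r}"
  have "open {x. enorm n x < r}" by (intro open_Collect_less continuous_intros)
  then have "openin (Euclidean_space n) ?U"
    unfolding Euclidean_space_def euclidean_product_topology
    by (auto simp: openin_open topspace_Euclidean_space)
  moreover have "?U \<subseteq> hull_body n N y r"
    using ball_subset_hull_body[OF assms(2)] by (auto simp: less_imp_le)
  moreover have "(\<lambda>_. 0) \<in> ?U"
    using assms(3) by (simp add: topspace_Euclidean_space L2_set_def)
  ultimately show "Euclidean_space n interior_of hull_body n N y r \<noteq> {}"
    using interior_of_maximal by blast
next
  fix x z u v assume x: "x \<in> hull_body n N y r" and z: "z \<in> hull_body n N y r"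
    and uv: "0 \<le> u" "0 \<le> v" "u + v = (1::real)"
  have "ip n (\<lambda>i. u * x i + v * z i) \<theta> \<le> support_max n N y \<theta> + r * enorm n \<theta>" (is "_ \<le> ?h") for \<theta>
  proof -
    have "ip n (\<lambda>i. u * x i + v * z i) \<theta> = u * ip n x \<theta> + v * ip n z \<theta>"
      by (simp add: ip_def algebra_simps sum.distrib sum_distrib_left)
    also have "\<dots> \<le> u * ?h + v * ?h"
      using x z uv by (intro add_mono mult_left_mono) (auto simp: hull_body_def)
    also have "\<dots> = ?h" using uv(3) by (simp flip: distrib_right)
    finally show ?thesis .
  qed
  then show "(\<lambda>i. u * x i + v * z i) \<in> hull_body n N y r"
    using x z by (auto simp: hull_body_def topspace_Euclidean_space)
qed

lemma emeasure_rset_hull_body: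
  assumes "N \<ge> 1" "\<And>j. j < N \<Longrightarrow> enorm n (y j) \<le> a" "r \<ge> 0"
  shows "emeasure (lebn n) (rset n (hull_body n N y r)) = ennreal (volume n (hull_body n N y r))"
  by (rule emeasure_rset[OF hull_body_subset]) (rule hull_body_bounded[OF assms(1,2) _ assms(3)])

text \<open>The cube of half-side r/n lies in the ball of radius r, since the Euclidean norm is at
  most the sum of the absolute coordinates.\<close>

lemma volume_hull_body_pos:
  assumes "n \<ge> 1" "N \<ge> 1" "\<And>j. j < N \<Longrightarrow> enorm n (y j) \<le> a" "r > 0"
  shows "volume n (hull_body n N y r) > 0"
proof -
  interpret L: product_sigma_finite "\<lambda>_::nat. lborel :: real measure"
    by (rule product_sigma_finite_lborel)
  let ?B = "Pi\<^sub>E {..<n} (\<lambda>_. {- (r / n)..r / n})"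
  have "?B \<subseteq> rset n (hull_body n N y r)"
  proof
    fix x assume x: "x \<in> ?B"
    have "enorm n x \<le> (\<Sum>i<n. \<bar>x i\<bar>)" by (rule L2_set_le_sum_abs)
    also have "\<dots> \<le> (\<Sum>i<n. r / n)"
    proof (rule sum_mono)
      fix i assume "i \<in> {..<n}"
      then have "x i \<in> {- (r / n)..r / n}" using x by (rule PiE_mem[rotated])
      then show "\<bar>x i\<bar> \<le> r / n" by (simp add: abs_le_iff)
    qed
    also have "\<dots> = r" using assms(1) by simp
    finally show "x \<in> rset n (hull_body n N y r)"
      using x ball_subset_hull_body[OF assms(2), of "ext n x" n r] by (auto simp: rset_def space_PiM PiE_iff)
  qed
  then have "emeasure (lebn n) ?B \<le> emeasure (lebn n) (rset n (hull_body n N y r))"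
    by (intro emeasure_mono sets_rset borel_closed closed_hull_body)
  moreover have "emeasure (lebn n) ?B = (\<Prod>i<n. emeasure lborel {- (r / n)..r / n})"
    by (rule L.emeasure_PiM) auto
  moreover have "\<dots> = ennreal ((2 * r / n) ^ n)"
    using assms(1,4) by (simp add: ennreal_power)
  ultimately have "ennreal ((2 * r / n) ^ n) \<le> ennreal (volume n (hull_body n N y r))"
    using emeasure_rset_hull_body[OF assms(2,3)] assms(4) by simp
  moreover have "(2 * r / n) ^ n > 0" using assms by simp
  ultimately show ?thesis
    by (metis ennreal_le_iff2 less_le_trans not_less)
qed

section \<open>Approximation by averages of vertices and the resulting volume bound\<close>

definition signed_point :: "nat \<Rightarrow> (nat \<Rightarrow> nat \<Rightarrow> real) \<Rightarrow> nat \<Rightarrow> nat \<Rightarrow> real" where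
  "signed_point N y q = (if q < N then y q else (\<lambda>i. - y (q - N) i))"

lemma enorm_triangle: "enorm n (\<lambda>i. x i + y i) \<le> enorm n x + enorm n y"
  by (rule L2_set_triangle_ineq)

text \<open>
  Maurey's argument: the support function inequality at \<open>- S\<close>, where \<open>S\<close> is the current error, yields a
  signed point whose deviation from \<open>x\<close> has inner product at most \<open>r \<bar>S\<bar>\<close> with \<open>S\<close>.
\<close>

lemma hull_body_approx:
  fixes m :: nat
  assumes "N \<ge> 1" "r \<ge> 0" and a: "\<And>j. j < N \<Longrightarrow> enorm n (y j) \<le> a" and x: "x \<in> hull_body n N y r"
  shows "\<exists>p. (\<forall>l<m. p l < 2 * N) \<and>
    enorm n (\<lambda>i. \<Sum>l<m. signed_point N y (p l) i - x i) \<le> (2 * a + r) * sqrt m + r * m"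
proof (induction m)
  case 0
  then show ?case by (simp add: L2_set_def)
next
  case (Suc m)
  then obtain p where p: "\<And>l. l < m \<Longrightarrow> p l < 2 * N"
    and IH: "enorm n (\<lambda>i. \<Sum>l<m. signed_point N y (p l) i - x i) \<le> (2 * a + r) * sqrt m + r * m"
    by blast
  define S where "S i = (\<Sum>l<m. signed_point N y (p l) i - x i)" for i
  \<comment> \<open>A signed vertex has norm at most a and the point x at most a + r, so
    \<open>b\<close> bounds every increment.\<close>
  define b where "b = 2 * a + r"
  obtain j where j: "j < N" "support_max n N y (\<lambda>i. - S i) = \<bar>ip n (y j) (\<lambda>i. - S i)\<bar>"
    using support_max_attained[OF assms(1)] by blast
  have "a \<ge> 0" using a[OF j(1)] L2_set_nonneg order_trans by blast
  then have "b \<ge> 0" using assms(2) by (simp add: b_def)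
  have "\<exists>q<2 * N. ip n S (signed_point N y q) = - \<bar>ip n (y j) (\<lambda>i. - S i)\<bar> \<and> enorm n (signed_point N y q) \<le> a"
  proof (cases "ip n (y j) S \<le> 0")
    case True
    then show ?thesis using j(1) a[OF j(1)]
      by (intro exI[of _ j]) (auto simp: signed_point_def ip_uminus_right ip_commute)
  next
    case False
    then show ?thesis using j(1) a[OF j(1)]
      by (intro exI[of _ "N + j"]) (auto simp: signed_point_def ip_uminus_right ip_commute[of n S] ip_uminus_left enorm_uminus)
  qed
  then obtain q where q: "q < 2 * N" "ip n S (signed_point N y q) = - \<bar>ip n (y j) (\<lambda>i. - S i)\<bar>"
    "enorm n (signed_point N y q) \<le> a" by blast
  define d where "d i = signed_point N y q i - x i" for i
  have "- ip n S x = ip n x (\<lambda>i. - S i)" by (simp add: ip_uminus_right ip_commute)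
  also have "\<dots> \<le> support_max n N y (\<lambda>i. - S i) + r * enorm n (\<lambda>i. - S i)"
    using x by (simp only: hull_body_def mem_Collect_eq)
  finally have "- ip n S x \<le> \<bar>ip n (y j) (\<lambda>i. - S i)\<bar> + r * enorm n S"
    by (simp add: j(2) enorm_uminus)
  then have Sd: "ip n S d \<le> r * enorm n S"
    using q(2) by (simp add: d_def ip_def right_diff_distrib sum_subtractf)
  have "enorm n d \<le> enorm n (signed_point N y q) + enorm n (\<lambda>i. - x i)"
    unfolding d_def diff_conv_add_uminus by (rule enorm_triangle)
  then have d: "enorm n d \<le> b"
    using q(3) hull_body_bounded[OF assms(1) a x assms(2)] by (simp add: enorm_uminus b_def)
  have "(enorm n (\<lambda>i. S i + d i))\<^sup>2 = (enorm n S)\<^sup>2 + 2 * ip n S d + (enorm n d)\<^sup>2"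
    unfolding enorm_sq ip_def by (simp add: power2_sum sum.distrib sum_distrib_left mult_ac)
  also have "\<dots> \<le> (enorm n S)\<^sup>2 + 2 * (r * enorm n S) + b\<^sup>2"
    using Sd d by (intro add_mono mult_left_mono power_mono) auto
  \<comment> \<open>Completing the square absorbs the drift 2 r |S| into the linear term, which
    grows by r per step; the remaining b^2 accumulates to b^2 m and yields the square-root
    term.\<close>
  also have "\<dots> \<le> (enorm n S + r)\<^sup>2 + b\<^sup>2"
    by (simp add: power2_sum mult_ac)
  also have "\<dots> \<le> (b * sqrt m + r * Suc m)\<^sup>2 + b\<^sup>2"
    using IH assms(2) unfolding S_def[symmetric] b_def[symmetric]
    by (intro add_right_mono power_mono) (auto simp: algebra_simps)
  also have "\<dots> = b\<^sup>2 * Suc m + 2 * (b * sqrt m * (r * Suc m)) + (r * Suc m)\<^sup>2"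
    by (simp add: power2_sum power_mult_distrib algebra_simps)
  also have "\<dots> \<le> b\<^sup>2 * Suc m + 2 * (b * sqrt (Suc m) * (r * Suc m)) + (r * Suc m)\<^sup>2"
    using \<open>b \<ge> 0\<close> assms(2) by (intro add_mono mult_left_mono mult_right_mono) auto
  also have "\<dots> = (b * sqrt (Suc m) + r * Suc m)\<^sup>2"
    by (simp add: power2_sum power_mult_distrib algebra_simps)
  finally have "enorm n (\<lambda>i. S i + d i) \<le> b * sqrt (Suc m) + r * Suc m"
    by (rule power2_le_imp_le) (use \<open>b \<ge> 0\<close> assms(2) in simp)
  moreover have "(\<lambda>i. \<Sum>l<Suc m. signed_point N y ((p(m := q)) l) i - x i) = (\<lambda>i. S i + d i)"
    by (simp add: S_def d_def fun_eq_iff)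
  ultimately show ?case using p q(1)
    by (intro exI[of _ "p(m := q)"]) (auto simp: b_def less_Suc_eq)
qed

text \<open>On the ball of radius sqrt n the Gaussian density is at least (2 pi e)^(-n/2), while its
  total mass is 1, so the volume is at most (2 pi e)^(n/2). Scaling and translation give all other
  balls.\<close>

lemma emeasure_lebn_ball:
  assumes "n \<ge> 1" "\<rho> > 0"
  shows "emeasure (lebn n) {x \<in> space (lebn n). enorm n (\<lambda>i. x i - c i) \<le> \<rho>} \<le> ennreal ((5 * \<rho> / sqrt n) ^ n)"
proof -
  let ?S = "{x \<in> space (lebn n). enorm n (\<lambda>i. x i - c i) \<le> \<rho>}"
  let ?B = "{x \<in> space (lebn n). enorm n x \<le> sqrt n}"
  let ?t = "\<rho> / sqrt n"
  have [measurable]: "?S \<in> sets (lebn n)" "?B \<in> sets (lebn n)" by measurable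
  have "?t > 0" using assms by simp
  have n0: "sqrt n > 0" using assms by simp
  have pre: "(\<lambda>x. \<lambda>i\<in>{..<n}. c i + ?t * x i) -` ?S \<inter> space (lebn n) = ?B"
  proof -
    have "enorm n (\<lambda>i. (\<lambda>i\<in>{..<n}. c i + ?t * x i) i - c i) = ?t * enorm n x" for x
    proof -
      have "enorm n (\<lambda>i. (\<lambda>i\<in>{..<n}. c i + ?t * x i) i - c i) = enorm n (\<lambda>i. ?t * x i)"
        by (intro L2_set_cong) auto
      then show ?thesis unfolding enorm_scale using \<open>?t > 0\<close> by (simp only: abs_of_pos)
    qed
    moreover have "?t * e \<le> \<rho> \<longleftrightarrow> e \<le> sqrt n" for e
      using n0 assms(2) by (simp add: field_simps)
    ultimately show ?thesis by (auto simp: space_PiM)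
  qed
  have "emeasure (lebn n) ?S = ennreal (?t ^ n) * emeasure (lebn n) ?B"
    using emeasure_lebn_affine[OF \<open>?t > 0\<close>, of ?S n c] unfolding pre by simp
  also have "emeasure (lebn n) ?B \<le> ennreal (5 ^ n)"
  proof -
    let ?c = "(1 / sqrt (2 * pi)) ^ n * exp (- real n / 2)"
    have "ennreal ?c * emeasure (lebn n) ?B = (\<integral>\<^sup>+x. ennreal ?c * indicator ?B x \<partial>lebn n)"
      by (rule nn_integral_cmult_indicator[symmetric]) measurable
    also have "\<dots> \<le> (\<integral>\<^sup>+x. ennreal ((1 / sqrt (2 * pi)) ^ n * exp (- (enorm n x)\<^sup>2 / 2)) * indicator ?B x \<partial>lebn n)"
    proof (intro nn_integral_mono)
      fix x
      have "(enorm n x)\<^sup>2 \<le> n" if "enorm n x \<le> sqrt n"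
        using power_mono[OF that, of 2] by simp
      then show "ennreal ?c * indicator ?B x \<le> ennreal ((1 / sqrt (2 * pi)) ^ n * exp (- (enorm n x)\<^sup>2 / 2)) * indicator ?B x"
        by (auto simp: indicator_def intro!: ennreal_leI mult_left_mono)
    qed
    also have "\<dots> = emeasure (gauss n) ?B"
      unfolding gauss_density by (rule emeasure_density[symmetric]) measurable
    also have "\<dots> \<le> 1" by (rule gauss.emeasure_le_1)
    finally have le: "ennreal ?c * emeasure (lebn n) ?B \<le> 1" .
    \<comment> \<open>The square root of 2 pi e is about 4.13; the rational bounds 8/3 and 7/4
      already give 14/3.\<close>
    have "(1 / 5) ^ n \<le> ?c"
    proof -
      have "exp (1 / 2 :: real) \<le> 1 + 1 / 2 + (1 / 2)\<^sup>2" by (rule exp_bound) auto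
      then have e: "exp (1 / 2 :: real) \<le> 7 / 4" by (simp add: power2_eq_square)
      have "2 * pi \<le> (8 / 3)\<^sup>2" using pi_less_4 pi_approx by (simp add: power2_eq_square)
      then have s: "sqrt (2 * pi) \<le> 8 / 3" using real_sqrt_le_mono[of "2 * pi" "(8 / 3)\<^sup>2"] by simp
      have "sqrt (2 * pi) * exp (1 / 2) \<le> 8 / 3 * (7 / 4)" using e s by (intro mult_mono) auto
      then have "sqrt (2 * pi) * exp (1 / 2) \<le> 5" by simp
      then have "1 / 5 \<le> 1 / (sqrt (2 * pi) * exp (1 / 2))" by (intro divide_left_mono) auto
      then have "(1 / 5) ^ n \<le> (1 / (sqrt (2 * pi) * exp (1 / 2))) ^ n" by (intro power_mono) auto
      also have "\<dots> = ?c"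
        by (simp add: power_divide power_mult_distrib exp_minus field_simps flip: exp_of_nat_mult)
      finally show ?thesis .
    qed
    then have "ennreal ((1 / 5) ^ n) * emeasure (lebn n) ?B \<le> 1"
      using le by (meson ennreal_leI mult_right_mono order_trans zero_le)
    then have "ennreal (5 ^ n) * (ennreal ((1 / 5) ^ n) * emeasure (lebn n) ?B) \<le> ennreal (5 ^ n) * 1"
      by (intro mult_left_mono) auto
    then show ?thesis
      by (simp add: mult.assoc[symmetric] flip: ennreal_mult' power_mult_distrib)
  qed
  finally have "emeasure (lebn n) ?S \<le> ennreal (?t ^ n) * ennreal (5 ^ n)"
    by (simp add: mult_left_mono)
  also have "\<dots> = ennreal ((5 * \<rho> / sqrt n) ^ n)"
    using \<open>?t > 0\<close> by (simp add: mult.commute flip: ennreal_mult' power_mult_distrib)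
  finally show ?thesis .
qed

text \<open>Dividing the approximation error by m shows that every point lies within (2 a + r) /
  sqrt m + r of an average of m signed vertices. There are at most (2 N)^m such averages, and each
  ball is bounded by the Gaussian estimate.\<close>

lemma volume_hull_body_le:
  assumes "n \<ge> 1" "N \<ge> 1" "m \<ge> 1" "r > 0" and a: "\<And>j. j < N \<Longrightarrow> enorm n (y j) \<le> a"
  shows "volume n (hull_body n N y r) \<le> real ((2 * N) ^ m) * (5 * ((2 * a + r) / sqrt m + r) / sqrt n) ^ n"
proof -
  let ?K = "hull_body n N y r"
  let ?\<rho> = "(2 * a + r) / sqrt m + r"
  have "a \<ge> 0" using assms(2) order_trans[OF L2_set_nonneg a[of 0]] by simp
  then have \<rho>: "?\<rho> > 0" using assms by (simp add: add_nonneg_pos)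
  have Q: "0 \<le> (5 * ?\<rho> / sqrt n) ^ n"
    by (intro zero_le_power divide_nonneg_nonneg mult_nonneg_nonneg less_imp_le[OF \<rho>]) auto
  define I where "I = Pi\<^sub>E {..<m} (\<lambda>_. {..<2 * N})"
  have cardI: "card I = (2 * N) ^ m" by (simp add: I_def card_PiE)
  define C where "C p = {x \<in> space (lebn n). enorm n (\<lambda>i. x i - (\<Sum>l<m. signed_point N y (p l) i) / m) \<le> ?\<rho>}" for p
  have [measurable]: "C p \<in> sets (lebn n)" for p unfolding C_def by measurable
  have "rset n ?K \<subseteq> (\<Union>p\<in>I. C p)"
  proof
    fix x assume x: "x \<in> rset n ?K"
    then have ext: "ext n x \<in> ?K" by (simp add: rset_def)
    obtain p where p: "\<And>l. l < m \<Longrightarrow> p l < 2 * N"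
      "enorm n (\<lambda>i. \<Sum>l<m. signed_point N y (p l) i - ext n x i) \<le> (2 * a + r) * sqrt m + r * m"
      using hull_body_approx[OF assms(2) less_imp_le[OF assms(4)] a ext, where m = m] by blast
    have "enorm n (\<lambda>i. x i - (\<Sum>l<m. signed_point N y (restrict p {..<m} l) i) / m)
        = enorm n (\<lambda>i. (- 1 / m) * (\<Sum>l<m. signed_point N y (p l) i - ext n x i))"
      using assms(3) by (intro L2_set_cong) (auto simp: ext_def sum_subtractf field_simps)
    also have "\<dots> = (1 / m) * enorm n (\<lambda>i. \<Sum>l<m. signed_point N y (p l) i - ext n x i)"
      unfolding enorm_scale by simp
    also have "\<dots> \<le> (1 / m) * ((2 * a + r) * sqrt m + r * m)"
      using p(2) by (intro mult_left_mono) auto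
    also have "\<dots> = ?\<rho>"
    proof -
      have "sqrt m / m = 1 / sqrt m" using assms(3) by (simp add: real_div_sqrt field_simps)
      then show ?thesis using assms(3) by (simp add: distrib_left mult.commute[of "1 / m"] divide_simps)
          (simp add: algebra_simps)
    qed
    finally have "x \<in> C (restrict p {..<m})" using x by (simp add: C_def rset_def)
    moreover have "restrict p {..<m} \<in> I" using p(1) by (auto simp: I_def)
    ultimately show "x \<in> (\<Union>p\<in>I. C p)" by blast
  qed
  moreover have "finite I" unfolding I_def by (intro finite_PiE) auto
  ultimately have "emeasure (lebn n) (rset n ?K) \<le> emeasure (lebn n) (\<Union>p\<in>I. C p)"
    by (intro emeasure_mono sets.finite_UN) auto
  also have "\<dots> \<le> (\<Sum>p\<in>I. emeasure (lebn n) (C p))"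
    using \<open>finite I\<close> by (intro emeasure_subadditive_finite) auto
  also have "\<dots> \<le> (\<Sum>p\<in>I. ennreal ((5 * ?\<rho> / sqrt n) ^ n))"
    unfolding C_def by (intro sum_mono emeasure_lebn_ball assms(1) \<rho>)
  also have "\<dots> = ennreal (real ((2 * N) ^ m)) * ennreal ((5 * ?\<rho> / sqrt n) ^ n)"
    by (simp only: sum_constant cardI ennreal_of_nat_eq_real_of_nat)
  also have "\<dots> = ennreal (real ((2 * N) ^ m) * (5 * ?\<rho> / sqrt n) ^ n)"
    by (rule ennreal_mult''[symmetric, OF Q])
  finally have "ennreal (volume n ?K) \<le> ennreal (real ((2 * N) ^ m) * (5 * ?\<rho> / sqrt n) ^ n)"
    using emeasure_rset_hull_body[OF assms(2) a] assms(4) by simp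
  then show ?thesis
    using ennreal_le_iff[OF mult_nonneg_nonneg[OF of_nat_0_le_iff Q]] by blast
qed

subsection \<open>The outer volume ratio distance\<close>

lemma d_ovr_ge:
  assumes "n \<ge> 1" "q > 0" "\<And>D. D \<in> \<C> \<Longrightarrow> K \<subseteq> D \<Longrightarrow> q ^ n \<le> volume n D / volume n K"
  shows "d_ovr n K \<C> \<ge> ereal q"
  unfolding d_ovr_def
proof (intro INF_greatest)
  fix D assume "D \<in> {D \<in> \<C>. K \<subseteq> D}"
  then have "q ^ n \<le> volume n D / volume n K" using assms(3) by blast
  then have "(q ^ n) powr (1 / n) \<le> (volume n D / volume n K) powr (1 / n)"
    using assms(2) by (intro powr_mono2) auto
  moreover have "(q ^ n) powr (1 / n) = q"
    using assms(1,2) by (simp add: powr_powr flip: powr_realpow)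
  ultimately show "ereal q \<le> ereal ((volume n D / volume n K) powr (1 / real n))" by simp
qed

lemma BP_volume_mono:
  assumes "n \<ge> 1" "D \<in> BP k n" "K \<subseteq> D" "emeasure (lebn n) (rset n K) = ennreal (volume n K)"
  shows "volume n K \<le> volume n D"
proof -
  have D: "star_body n D" using assms(2) by (simp add: BP_def radial_closure_def)
  have "emeasure (lebn n) (rset n K) \<le> emeasure (lebn n) (rset n D)"
    by (intro emeasure_mono sets_rset star_body_borel[OF assms(1) D]) (use assms(3) in \<open>auto simp: rset_def\<close>)
  then have "ennreal (volume n K) \<le> ennreal (volume n D)"
    by (simp add: assms(4) emeasure_rset_star_body[OF assms(1) D])
  then show ?thesis by (subst (asm) ennreal_le_iff) (auto simp: volume_def)
qed

text \<open>This covers the parameters for which the asserted bound is at most 1. The body is the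
  unit ball, as the hull of the origin enlarged by radius 1.\<close>

lemma exists_body_trivial_ratio:
  assumes "n \<ge> 1"
  shows "\<exists>K. convex_body n K \<and> origin_symmetric K \<and>
    (\<forall>D\<in>BP k n. K \<subseteq> D \<longrightarrow> 1 \<le> volume n D / volume n K)"
proof (intro exI conjI ballI impI)
  let ?K = "hull_body n 1 (\<lambda>_ _. 0) 1"
  have b: "enorm n ((\<lambda>_ _. 0) j) \<le> 0" for j :: nat by (simp add: L2_set_def)
  show "convex_body n ?K" using assms b by (intro convex_body_hull_body) auto
  show "origin_symmetric ?K" by (rule origin_symmetric_hull_body)
  fix D assume D: "D \<in> BP k n" "?K \<subseteq> D"
  have "volume n ?K \<le> volume n D"
    using b by (intro BP_volume_mono[OF assms D] emeasure_rset_hull_body) auto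
  moreover have "volume n ?K > 0" using assms b by (intro volume_hull_body_pos) auto
  ultimately show "1 \<le> volume n D / volume n ?K" by simp
qed

section \<open>Choice of parameters in the nontrivial range\<close>

lemma two_le_mult_exp_square:
  assumes "n \<ge> 2" "k \<le> n - 1"
  shows "2 * real n ^ k \<le> exp (real n ^ 2)"
proof -
  have "2 * real n ^ k \<le> real n * real n ^ (n - 1)"
    using assms by (intro mult_mono power_increasing) auto
  also have "\<dots> = real n ^ n" using assms by (cases n) auto
  also have "\<dots> \<le> exp (real n) ^ n"
    using exp_ge_add_one_self[of "real n"] by (intro power_mono) linarith+
  also have "\<dots> = exp (real n ^ 2)" by (simp add: power2_eq_square flip: exp_of_nat_mult)
  finally show ?thesis .
qed

text \<open>The constant 9000 is 50 * 180: volumes are at least 50^(-n) for bodies of the class and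
  at most (180 sqrt (\<Lambda>/n))^n for the hull.\<close>

lemma exists_body_large_ratio:
  assumes n: "n \<ge> 2" and k: "1 \<le> k" "k \<le> n - 1" and small: "16 * real k * ln n \<le> n"
  shows "\<exists>K. convex_body n K \<and> origin_symmetric K \<and>
    (\<forall>D\<in>BP k n. K \<subseteq> D \<longrightarrow> (sqrt (n / (16 * real k * ln n)) / 9000) ^ n \<le> volume n D / volume n K)"
proof -
  have n1: "n \<ge> 1" using n by simp
  \<comment> \<open>Chosen so that exp \<Lambda> = n^(16 k) dominates the number 2 N of signed
    vertices.\<close>
  define \<Lambda> where "\<Lambda> = 16 * real k * ln n"
  have "ln 2 \<le> ln (real n)" using n by simp
  moreover have "ln 2 \<ge> (1 / 2 :: real)"
    using ln_le_minus_one[of "1 / 2 :: real"] by (simp add: ln_div)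
  ultimately have ln: "ln (real n) \<ge> 1 / 2" by simp
  have "real k * (1 / 2) \<le> real k * ln n" using ln by (intro mult_left_mono) auto
  then have \<Lambda>k: "8 * real k \<le> \<Lambda>" by (simp add: \<Lambda>_def)
  moreover have "real k \<ge> 1" using k by simp
  ultimately have \<Lambda>: "\<Lambda> \<ge> 1" "\<Lambda> \<le> n" using small unfolding \<Lambda>_def by linarith+
  have k2: "2 * k \<le> n" using \<Lambda>k \<Lambda> by linarith
  define \<delta> where "\<delta> = (1 / sqrt n / sqrt 2) ^ k"
  have s: "1 / real n \<le> 1 / sqrt n / sqrt 2" "1 / sqrt n / sqrt 2 \<le> 1"
  proof -
    have "real n * 2 \<le> (real n)\<^sup>2" using n by (simp add: power2_eq_square)
    then have "sqrt n * sqrt 2 \<le> n"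
      by (metis of_nat_0_le_iff real_le_lsqrt real_sqrt_mult)
    then show "1 / real n \<le> 1 / sqrt n / sqrt 2"
      using n by (simp add: divide_left_mono)
    have "1 * 1 \<le> sqrt n * sqrt 2" using n by (intro mult_mono) auto
    then show "1 / sqrt n / sqrt 2 \<le> 1" by simp
  qed
  have "(1 / real n) ^ k \<le> \<delta>" unfolding \<delta>_def by (rule power_mono[OF s(1)]) simp
  moreover have "\<delta> \<le> 1" unfolding \<delta>_def by (rule power_le_one[OF _ s(2)]) simp
  ultimately have \<delta>: "1 / real n ^ k \<le> \<delta>" "\<delta> \<le> 1" by (simp_all add: power_divide)
  have nk: "real n ^ k > 0" using n by simp
  have "\<delta> > 0" using \<delta>(1) nk by (smt (verit) divide_pos_pos)
  \<comment> \<open>From \<delta> \<ge> n^(-k), these powers meet the requirements on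
    \<open>L\<close> and \<open>N\<close>, with the crude ln (1 + x) \<le> x. The waste is
    polynomial and harmless, as \<open>N\<close> matters only through its logarithm.\<close>
  define L where "L = 16 * n ^ (3 + k)"
  define N where "N = 256 * n ^ (4 + 3 * k)"
  have "N \<ge> 1" using n by (simp add: N_def)
  have c1: "2 \<le> \<delta> * exp (real n ^ 2)"
  proof -
    have "2 = 1 / real n ^ k * (2 * real n ^ k)" using nk by simp
    also have "\<dots> \<le> \<delta> * exp (real n ^ 2)"
      using \<delta>(1) \<open>\<delta> > 0\<close> two_le_mult_exp_square[OF n k(2)] by (intro mult_mono) auto
    finally show ?thesis .
  qed
  have c2: "16 * real n ^ 3 \<le> \<delta> * real L"
  proof -
    have "16 * real n ^ 3 = 1 / real n ^ k * real L" using nk by (simp add: L_def power_add)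
    also have "\<dots> \<le> \<delta> * real L" using \<delta>(1) by (intro mult_right_mono) auto
    finally show ?thesis .
  qed
  have c3: "8 * real n * ln (2 * real L + 1) \<le> \<delta>\<^sup>2 * N"
  proof -
    have "ln (2 * real L + 1) \<le> 2 * real L" using ln_add_one_self_le_self[of "2 * real L"] by (simp add: add.commute)
    then have "8 * real n * ln (2 * real L + 1) \<le> 8 * real n * (2 * real L)" by (intro mult_left_mono) auto
    also have "\<dots> = 256 * real n ^ (4 + k)" by (simp add: L_def eval_nat_numeral)
    also have "\<dots> = (1 / real n ^ k)\<^sup>2 * real N"
      using nk by (simp add: N_def power_add power_divide field_simps power_mult power2_eq_square power3_eq_cube mult.commute[of 3])
    also have "\<dots> \<le> \<delta>\<^sup>2 * N" using \<delta>(1) nk by (intro mult_right_mono power_mono) auto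
    finally show ?thesis .
  qed
  obtain y where y: "\<And>j::nat. y j \<in> gauss_core n" and le:
    "\<And>\<xi>. (\<Sum>j<N. cos (ip n \<xi> (y j))) * exp (- (1 / sqrt n * enorm n \<xi>)\<^sup>2 / 2)
      \<le> N * ((\<integral>x. cos (ip n \<xi> x) \<partial>uniform_measure (gauss n) (gauss_core n)) * exp (- (1 / sqrt n * enorm n \<xi>)\<^sup>2 / 2)
              + \<delta> * exp (- (1 / sqrt n * enorm n \<xi>)\<^sup>2 / 4))"
    using exists_good_points[OF n1 \<open>\<delta> > 0\<close> \<delta>(2) c1 c2 c3] by blast
  have a: "enorm n (y j) \<le> 2 * sqrt n" for j using y[of j] by (simp add: gauss_core_def)
  let ?K = "hull_body n N y 2"
  have pos: "volume n ?K > 0"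
    by (rule volume_hull_body_pos[OF n1 \<open>N \<ge> 1\<close> a]) simp
  \<comment> \<open>The number of averaged vertices is as large as possible subject to m \<Lambda>
    \<le> n, so that the count (2 N)^m stays below exp n \<le> 3^n. The smallness assumption makes
    it at least 1, and rounding down loses at most a factor 2.\<close>
  define m where "m = nat \<lfloor>n / \<Lambda>\<rfloor>"
  have q1: "n / \<Lambda> \<ge> 1" using \<Lambda> by simp
  then have fl: "\<lfloor>n / \<Lambda>\<rfloor> \<ge> 1" by (simp add: le_floor_iff)
  then have m: "m \<ge> 1" "m \<le> n / \<Lambda>" "n / \<Lambda> < m + 1"
    unfolding m_def by (auto simp: le_nat_iff) linarith+
  have "n / (2 * \<Lambda>) = (n / \<Lambda>) / 2" by simp
  then have m2: "n / (2 * \<Lambda>) \<le> m" using m by linarith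
  have mn: "real m \<le> n"
  proof -
    have "n / \<Lambda> \<le> n / 1" using \<Lambda> by (intro divide_left_mono) auto
    then show ?thesis using m(2) by simp
  qed
  have vK: "volume n ?K \<le> (180 * sqrt (\<Lambda> / n)) ^ n"
  proof -
    \<comment> \<open>The factor 512 in 2 N is absorbed into n^9; then 9 + 4 + 3 k \<le> 16 k
      because k \<ge> 1, which explains the 16.\<close>
    have "512 \<le> real n ^ 9" using power_mono[of 2 "real n" 9] n by simp
    then have "real (2 * N) \<le> real n ^ 9 * real n ^ (4 + 3 * k)"
      unfolding N_def by (simp add: mult_right_mono)
    also have "\<dots> \<le> real n ^ (16 * k)"
      unfolding power_add[symmetric] using n k by (intro power_increasing) auto
    also have "\<dots> = exp \<Lambda>"
      using exp_of_nat_mult[of "16 * k" "ln (real n)"] n by (simp add: \<Lambda>_def)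
    finally have "real (2 * N) ^ m \<le> exp \<Lambda> ^ m" by (intro power_mono) auto
    also have "\<dots> = exp (m * \<Lambda>)" by (simp add: exp_of_nat_mult)
    also have "\<dots> \<le> exp n" using m(2) \<Lambda> by (simp add: field_simps)
    also have "\<dots> = exp 1 ^ n" using exp_of_nat_mult[of n 1] by simp
    also have "\<dots> \<le> 3 ^ n" using exp_le by (intro power_mono) auto
    finally have e: "real ((2 * N) ^ m) \<le> 3 ^ n" by simp
    have sm: "sqrt m > 0" "sqrt n > 0" "sqrt m \<le> sqrt n" "1 \<le> sqrt n" using m n mn by auto
    \<comment> \<open>The covering radius is at most 8 sqrt n / sqrt m: the additive 2 is absorbed
      because m \<le> n. With 5 from the ball volume and 3/2 from the rounding of \<open>m\<close>
      this gives 60, and 3^n from the count makes it 180.\<close>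
    have "(2 * (2 * sqrt n) + 2) / sqrt m + 2 \<le> (6 * sqrt n) / sqrt m + 2 * (sqrt n / sqrt m)"
      using sm by (intro add_mono divide_right_mono) (auto simp: divide_simps)
    also have "\<dots> = 8 * sqrt n / sqrt m" by simp
    finally have "5 * ((2 * (2 * sqrt n) + 2) / sqrt m + 2) / sqrt n \<le> 5 * (8 * sqrt n / sqrt m) / sqrt n"
      using sm by (intro divide_right_mono mult_left_mono) auto
    also have "\<dots> = 40 * (1 / sqrt m)" using sm by simp
    also have "\<dots> \<le> 40 * (3 / 2 * sqrt (\<Lambda> / n))"
    proof (rule mult_left_mono)
      have "1 / sqrt m = sqrt (1 / m)" by (simp add: real_sqrt_divide)
      also have "\<dots> \<le> sqrt ((3 / 2)\<^sup>2 * (\<Lambda> / n))"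
      proof (rule real_sqrt_le_mono)
        have "1 / m \<le> 1 / (n / (2 * \<Lambda>))" using m2 m(1) n \<Lambda> by (intro divide_left_mono) auto
        also have "\<dots> \<le> (3 / 2)\<^sup>2 * (\<Lambda> / n)" using \<Lambda> n by (simp add: power2_eq_square field_simps)
        finally show "1 / m \<le> (3 / 2)\<^sup>2 * (\<Lambda> / n)" .
      qed
      also have "\<dots> = 3 / 2 * sqrt (\<Lambda> / n)"
        unfolding real_sqrt_mult[of "(3 / 2)\<^sup>2"] by simp
      finally show "1 / sqrt m \<le> 3 / 2 * sqrt (\<Lambda> / n)" .
    qed simp
    finally have f: "(5 * ((2 * (2 * sqrt n) + 2) / sqrt m + 2) / sqrt n) ^ n \<le> (60 * sqrt (\<Lambda> / n)) ^ n"
      by (intro power_mono) auto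
    have "volume n ?K \<le> real ((2 * N) ^ m) * (5 * ((2 * (2 * sqrt n) + 2) / sqrt m + 2) / sqrt n) ^ n"
      by (rule volume_hull_body_le[OF n1 \<open>N \<ge> 1\<close> m(1) _ a]) simp
    also have "\<dots> \<le> 3 ^ n * (60 * sqrt (\<Lambda> / n)) ^ n"
      using e f by (intro mult_mono) auto
    also have "\<dots> = (180 * sqrt (\<Lambda> / n)) ^ n"
      unfolding power_mult_distrib[symmetric] mult.assoc[symmetric] by simp
    finally show ?thesis .
  qed
  have "(sqrt (n / (16 * real k * ln n)) / 9000) ^ n \<le> volume n D / volume n ?K"
    if D: "D \<in> BP k n" "?K \<subseteq> D" for D
  proof -
    have vD: "volume n D \<ge> (1 / 50) ^ n"
    proof (rule volume_BP_ge[OF k(1) k2 \<open>N \<ge> 1\<close> D(1) le[unfolded \<delta>_def]])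
      fix j g assume j: "j < N" and g: "g \<in> gauss_core n"
      \<comment> \<open>Core perturbations have norm at most 2 sqrt n, so after scaling they fit
        into the ball of radius 2 added to the hull.\<close>
      have "enorm n (\<lambda>i. 1 / sqrt n * g i) \<le> 1 / sqrt n * (2 * sqrt n)"
        unfolding enorm_scale using g n by (auto simp: gauss_core_def pos_divide_le_eq)
      also have "\<dots> = 2" using n by simp
      finally show "ext n (\<lambda>i. y j i + 1 / sqrt n * g i) \<in> D"
        using ext_add_in_hull_body[OF j] D(2) by blast
    qed
    have "sqrt (n / \<Lambda>) / 9000 = (1 / 50) / (180 * sqrt (\<Lambda> / n))"
      by (simp add: real_sqrt_divide)
    then have "(sqrt (n / \<Lambda>) / 9000) ^ n = (1 / 50) ^ n / (180 * sqrt (\<Lambda> / n)) ^ n"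
      by (simp only: power_divide)
    also have "\<dots> \<le> volume n D / volume n ?K"
      by (rule frac_le[OF _ vD pos vK]) (simp add: volume_def)
    finally show ?thesis by (simp add: \<Lambda>_def)
  qed
  moreover have "convex_body n ?K"
    by (rule convex_body_hull_body[OF n1 \<open>N \<ge> 1\<close> _ a]) simp
  ultimately show ?thesis
    using origin_symmetric_hull_body by blast
qed

theorem corollary1p5:
  shows "\<exists>c::real. c > 0 \<and>
    (\<forall>n k :: nat. n \<ge> 2 \<and> 1 \<le> k \<and> k \<le> n - 1 \<longrightarrow>
      (\<exists>K. convex_body n K \<and> origin_symmetric K \<and>
        d_ovr n K (BP k n) \<ge>
          ereal (c * sqrt (real n / real k) * (ln (real n)) powr (- 1 / 2))))"
proof (intro exI[of _ "1 / 36000 :: real"] conjI allI impI)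
  fix n k :: nat assume nk: "n \<ge> 2 \<and> 1 \<le> k \<and> k \<le> n - 1"
  have ln: "ln (real n) > 0" using nk by simp
  let ?q = "1 / 36000 * sqrt (real n / real k) * (ln (real n)) powr (- 1 / 2)"
  \<comment> \<open>The 16 inside the root contributes a factor 4, and 4 * 9000 = 36000.\<close>
  have q: "?q = sqrt (n / (16 * real k * ln n)) / 9000"
  proof -
    have "(ln (real n)) powr (- 1 / 2) = 1 / sqrt (ln n)"
      using ln powr_minus_divide[of "ln (real n)" "1 / 2"] by (simp add: powr_half_sqrt)
    moreover have "sqrt (16 * real k * ln n) = 4 * sqrt k * sqrt (ln n)"
      using real_sqrt_mult[of "4\<^sup>2"] by (simp add: real_sqrt_mult)
    ultimately show ?thesis by (simp add: real_sqrt_divide)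
  qed
  have n1: "n \<ge> 1" using nk by simp
  have qpos: "?q > 0" using nk ln by simp
  show "\<exists>K. convex_body n K \<and> origin_symmetric K \<and> d_ovr n K (BP k n) \<ge> ereal ?q"
  \<comment> \<open>If this fails, the root is at most 1, so the claimed bound is already met by any
    body through K \<subseteq> D.\<close>
  proof (cases "16 * real k * ln n \<le> n")
    case True
    have "\<exists>K. convex_body n K \<and> origin_symmetric K \<and>
        (\<forall>D\<in>BP k n. K \<subseteq> D \<longrightarrow> ?q ^ n \<le> volume n D / volume n K)"
      unfolding q using nk by (intro exists_body_large_ratio True) auto
    then obtain K where K: "convex_body n K" "origin_symmetric K"
      "\<forall>D\<in>BP k n. K \<subseteq> D \<longrightarrow> ?q ^ n \<le> volume n D / volume n K"
      by blast
    have "d_ovr n K (BP k n) \<ge> ereal ?q"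
      by (rule d_ovr_ge[OF n1 qpos]) (use K(3) in blast)
    then show ?thesis using K(1,2) by blast
  next
    case False
    obtain K where K: "convex_body n K" "origin_symmetric K"
      "\<forall>D\<in>BP k n. K \<subseteq> D \<longrightarrow> 1 \<le> volume n D / volume n K"
      using exists_body_trivial_ratio[OF n1, of k] by blast
    have "n / (16 * real k * ln n) \<le> 1" using False by (simp add: divide_le_eq)
    then have "sqrt (n / (16 * real k * ln n)) \<le> 1" by (simp only: real_sqrt_le_1_iff)
    then have "?q \<le> 1" unfolding q by linarith
    then have "ereal ?q \<le> ereal 1" by simp
    also have "\<dots> \<le> d_ovr n K (BP k n)"
      by (rule d_ovr_ge[OF n1 zero_less_one]) (use K(3) in simp)
    finally show ?thesis using K(1,2) by blast
  qed
qed simp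

end
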